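(* Let $\mathcal{M}$ be an o-minimal expansion of a real closed field. Every definable fibre bundle $p\colon E\to B$ (with $E,B$ definable sets) is a definable fibration.
   Context: Definable means definable in $\mathcal{M}$ with parameters; definable sets carry the topology induced by the order topology on $M$ and product topologies; $I=[0,1]\subset M$. A definable continuous map $p\colon E\to B$ is a definable fibre bundle with fibre a definable set $F$ if there is a finite open definable covering $B=\bigcup_{i=1}^k U_i$ and, for each $i$, a definable homeomorphism $\varphi_i\colon U_i\times F\to p^{-1}(U_i)$ with $p\circ\varphi_i$ equal to the projection onto $U_i$. The map $p$ is a definable fibration if for every definable set $X$, every definable continuous homotopy $f\colon X\times I\to B$ and every definable continuous map $g\colon X\to E$ with $p\circ g=f(-,0)$, there is a definable continuous $h\colon X\times I\to E$ with $p\circ h=f$ and $h(-,0)=g$. *)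

theory Defs
  imports "HOL-Analysis.Analysis" "HOL-Computational_Algebra.Polynomial"
begin

definition real_closed :: "'a::linordered_field itself \<Rightarrow> bool" where
  "real_closed _ \<longleftrightarrow>
     (\<forall>x::'a. 0 \<le> x \<longrightarrow> (\<exists>y. y ^ 2 = x)) \<and>
     (\<forall>q::'a poly. odd (degree q) \<longrightarrow> (\<exists>x. poly q x = 0))"

text \<open>
  An expansion of the ordered field \<open>'a\<close> interprets additional function and relation symbols.
  A symbol carries no fixed arity: applied to \<open>n\<close> arguments it stands for an \<open>n\<close>-ary symbol,
  so one element of \<open>'f\<close> or \<open>'r\<close> names one symbol in each arity.  A language with
  prescribed arities is recovered by giving the other arities a constant interpretation.
\<close>

record ('f, 'r, 'a) expansion =
  fun_interp :: "'f \<Rightarrow> 'a list \<Rightarrow> 'a"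
  rel_interp :: "'r \<Rightarrow> 'a list \<Rightarrow> bool"

text \<open>Parameters are allowed through the constants \<open>Par\<close>, one for each element of \<open>'a\<close>.\<close>

datatype ('f, 'a) tm =
    Var nat
  | Par 'a
  | Add "('f, 'a) tm" "('f, 'a) tm"
  | Mul "('f, 'a) tm" "('f, 'a) tm"
  | App 'f "('f, 'a) tm list"

datatype ('f, 'r, 'a) fm =
    Equal "('f, 'a) tm" "('f, 'a) tm"
  | Less "('f, 'a) tm" "('f, 'a) tm"
  | Rel 'r "('f, 'a) tm list"
  | Not "('f, 'r, 'a) fm"
  | And "('f, 'r, 'a) fm" "('f, 'r, 'a) fm"
  | Exists nat "('f, 'r, 'a) fm"

primrec tm_val ::
  "('f, 'r, 'a::linordered_field) expansion \<Rightarrow> (nat \<Rightarrow> 'a) \<Rightarrow> ('f, 'a) tm \<Rightarrow> 'a" where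
  "tm_val M e (Var i) = e i"
| "tm_val M e (Par c) = c"
| "tm_val M e (Add s t) = tm_val M e s + tm_val M e t"
| "tm_val M e (Mul s t) = tm_val M e s * tm_val M e t"
| "tm_val M e (App f ts) = fun_interp M f (map (tm_val M e) ts)"

primrec sat ::
  "('f, 'r, 'a::linordered_field) expansion \<Rightarrow> (nat \<Rightarrow> 'a) \<Rightarrow> ('f, 'r, 'a) fm \<Rightarrow> bool" where
  "sat M e (Equal s t) \<longleftrightarrow> tm_val M e s = tm_val M e t"
| "sat M e (Less s t) \<longleftrightarrow> tm_val M e s < tm_val M e t"
| "sat M e (Rel r ts) \<longleftrightarrow> rel_interp M r (map (tm_val M e) ts)"
| "sat M e (Not \<phi>) \<longleftrightarrow> \<not> sat M e \<phi>"
| "sat M e (And \<phi> \<psi>) \<longleftrightarrow> sat M e \<phi> \<and> sat M e \<psi>"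
| "sat M e (Exists i \<phi>) \<longleftrightarrow> (\<exists>a. sat M (e(i := a)) \<phi>)"

primrec tm_vars :: "('f, 'a) tm \<Rightarrow> nat set" where
  "tm_vars (Var i) = {i}"
| "tm_vars (Par c) = {}"
| "tm_vars (Add s t) = tm_vars s \<union> tm_vars t"
| "tm_vars (Mul s t) = tm_vars s \<union> tm_vars t"
| "tm_vars (App f ts) = \<Union> (set (map tm_vars ts))"

primrec free_vars :: "('f, 'r, 'a) fm \<Rightarrow> nat set" where
  "free_vars (Equal s t) = tm_vars s \<union> tm_vars t"
| "free_vars (Less s t) = tm_vars s \<union> tm_vars t"
| "free_vars (Rel r ts) = \<Union> (tm_vars ` set ts)"
| "free_vars (Not \<phi>) = free_vars \<phi>"
| "free_vars (And \<phi> \<psi>) = free_vars \<phi> \<union> free_vars \<psi>"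
| "free_vars (Exists i \<phi>) = free_vars \<phi> - {i}"

text \<open>
  Points of the \<open>n\<close>-th Cartesian power are lists of length \<open>n\<close>.  The value of
  \<open>(!) xs\<close> beyond the length of \<open>xs\<close> is irrelevant by the condition on free variables.
\<close>

definition definable ::
  "('f, 'r, 'a::linordered_field) expansion \<Rightarrow> nat \<Rightarrow> 'a list set \<Rightarrow> bool" where
  "definable M n A \<longleftrightarrow>
     (\<exists>\<phi>. free_vars \<phi> \<subseteq> {..<n} \<and> A = {xs. length xs = n \<and> sat M ((!) xs) \<phi>})"

definition point_or_interval :: "'a::linorder set \<Rightarrow> bool" where
  "point_or_interval S \<longleftrightarrow>
     (\<exists>a. S = {a}) \<or> (\<exists>a b. S = {a<..<b}) \<or> (\<exists>a. S = {a<..}) \<or> (\<exists>b. S = {..<b}) \<or> S = UNIV"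

definition o_minimal :: "('f, 'r, 'a::linordered_field) expansion \<Rightarrow> bool" where
  "o_minimal M \<longleftrightarrow>
     (\<forall>S. definable M 1 ((\<lambda>x. [x]) ` S) \<longrightarrow>
        (\<exists>\<C>. finite \<C> \<and> (\<forall>C\<in>\<C>. point_or_interval C) \<and> S = \<Union>\<C>))"

text \<open>The product topology on the \<open>n\<close>-th power, transported to lists of length \<open>n\<close>.\<close>

definition power_topology :: "nat \<Rightarrow> 'a::linorder_topology list topology" where
  "power_topology n =
     pullback_topology {xs. length xs = n} (\<lambda>xs. \<lambda>i\<in>{..<n}. xs ! i)
       (product_topology (\<lambda>_. euclidean) {..<n})"

abbreviation induced_topology ::
  "nat \<Rightarrow> 'a::linorder_topology list set \<Rightarrow> 'a list topology" where
  "induced_topology n X \<equiv> subtopology (power_topology n) X"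

definition times_set :: "'a list set \<Rightarrow> 'a list set \<Rightarrow> 'a list set" (infixr \<open>\<otimes>\<^sub>d\<close> 80) where
  "X \<otimes>\<^sub>d Y = {x @ y |x y. x \<in> X \<and> y \<in> Y}"

definition unit_interval :: "'a::linordered_field list set" where
  "unit_interval = (\<lambda>t. [t]) ` {0..1}"

definition definable_map ::
  "('f, 'r, 'a::linordered_field) expansion \<Rightarrow> nat \<Rightarrow> 'a list set \<Rightarrow> nat \<Rightarrow> 'a list set \<Rightarrow>
     ('a list \<Rightarrow> 'a list) \<Rightarrow> bool" where
  "definable_map M n X m Y f \<longleftrightarrow> f \<in> X \<rightarrow> Y \<and> definable M (n + m) ((\<lambda>x. x @ f x) ` X)"

definition definable_continuous ::
  "('f, 'r, 'a::{linordered_field, linorder_topology}) expansion \<Rightarrow>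
     nat \<Rightarrow> 'a list set \<Rightarrow> nat \<Rightarrow> 'a list set \<Rightarrow> ('a list \<Rightarrow> 'a list) \<Rightarrow> bool" where
  "definable_continuous M n X m Y f \<longleftrightarrow>
     definable_map M n X m Y f \<and>
     continuous_map (induced_topology n X) (induced_topology m Y) f"

definition definable_homeomorphism ::
  "('f, 'r, 'a::{linordered_field, linorder_topology}) expansion \<Rightarrow>
     nat \<Rightarrow> 'a list set \<Rightarrow> nat \<Rightarrow> 'a list set \<Rightarrow> ('a list \<Rightarrow> 'a list) \<Rightarrow> bool" where
  "definable_homeomorphism M n X m Y f \<longleftrightarrow>
     definable_map M n X m Y f \<and>
     homeomorphic_map (induced_topology n X) (induced_topology m Y) f"

definition definable_fibre_bundle ::
  "('f, 'r, 'a::{linordered_field, linorder_topology}) expansion \<Rightarrow>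
     nat \<Rightarrow> 'a list set \<Rightarrow> nat \<Rightarrow> 'a list set \<Rightarrow> nat \<Rightarrow> 'a list set \<Rightarrow>
     ('a list \<Rightarrow> 'a list) \<Rightarrow> bool" where
  "definable_fibre_bundle M m E n B d F p \<longleftrightarrow>
     definable M m E \<and> definable M n B \<and> definable M d F \<and>
     definable_continuous M m E n B p \<and>
     (\<exists>(k::nat) U \<phi>.
        B = (\<Union>i\<in>{1..k}. U i) \<and>
        (\<forall>i\<in>{1..k}.
           definable M n (U i) \<and>
           openin (induced_topology n B) (U i) \<and>
           definable_homeomorphism M (n + d) (U i \<otimes>\<^sub>d F) m {e \<in> E. p e \<in> U i} (\<phi> i) \<and>
           (\<forall>u\<in>U i. \<forall>v\<in>F. p (\<phi> i (u @ v)) = u)))"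

definition definable_fibration ::
  "('f, 'r, 'a::{linordered_field, linorder_topology}) expansion \<Rightarrow>
     nat \<Rightarrow> 'a list set \<Rightarrow> nat \<Rightarrow> 'a list set \<Rightarrow> ('a list \<Rightarrow> 'a list) \<Rightarrow> bool" where
  "definable_fibration M m E n B p \<longleftrightarrow>
     definable M m E \<and> definable M n B \<and>
     definable_continuous M m E n B p \<and>
     (\<forall>l X f g.
        definable M l X \<and>
        definable_continuous M (l + 1) (X \<otimes>\<^sub>d unit_interval) n B f \<and>
        definable_continuous M l X m E g \<and>
        (\<forall>x\<in>X. p (g x) = f (x @ [0])) \<longrightarrow>
        (\<exists>h. definable_continuous M (l + 1) (X \<otimes>\<^sub>d unit_interval) m E h \<and>
             (\<forall>z\<in>X \<otimes>\<^sub>d unit_interval. p (h z) = f z) \<and>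
             (\<forall>x\<in>X. h (x @ [0]) = g x)))"

end

theory Submission
  imports Defs
begin

text \<open>
  Pull the trivialising cover of \<open>B\<close> back along \<open>f\<close> to sets \<open>V i\<close> in \<open>X \<times> I\<close>. Over each \<open>x\<close> the
  segment \<open>I\<close> has finitely many points at which membership in some \<open>V i\<close> changes, and by uniform
  finiteness their number is bounded independently of \<open>x\<close>. Hence finitely many index sequences
  suffice: \<open>X\<close> is the union of open definable sets, one for each sequence, over which \<open>I\<close> can be
  cut into consecutive pieces lying in the prescribed sets. The cut points can be chosen one after
  another as continuous definable functions of \<open>x\<close>, because the admissible ones form open convex
  sets, and parallel transport in the trivialisations extends a lift piece by piece. A partition of
  unity on \<open>X\<close> glues these lifts: the lift is extended below the graphs of increasing height
  functions, each increment being supported in one of the open sets.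

  Uniform finiteness is proved without cell decomposition, by induction on the number of
  parameters. The last parameter has a finite set of bad values, itself uniformly finite by
  induction, and between bad values the fibre cardinality is constant.
\<close>

section \<open>Definable predicates on environments\<close>

text \<open>The field need be neither complete nor archimedean, and \<open>X\<close> is an arbitrary
  definable set, so neither compactness of \<open>I\<close> nor a Lebesgue number is available. Both
  are replaced by suprema of definable sets in one variable: a definable property that is locally
  constant on an interval is constant, and a definable bound that exists near every point of a
  closed interval exists on all of it.

  Continuous functions are not chosen but written down as suprema. A radius admissible at
  \<open>x\<close>, diminished by a distance, stays admissible at that distance from
  \<open>x\<close>, so these suprema are Lipschitz with constant 1; cut points are quotients of two
  such suprema.

  The heights used for gluing are maxima rather than partial sums. With \<open>\<mu>\<close> the
  largest of the radii \<open>\<rho> \<sigma>\<close>, the function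
  \<open>max 0 (2 * \<rho> \<sigma> / \<mu> - 1)\<close> is 1 where
  \<open>\<rho> \<sigma> = \<mu>\<close> and vanishes where \<open>\<rho> \<sigma>\<close> is at
  most half of \<open>\<mu>\<close>. It is therefore supported in a relatively closed set on which
  the sequence \<open>\<sigma>\<close> is still usable, and closedness is what the pasting of
  continuous maps requires.\<close>

lemma finite_tm_vars: "finite (tm_vars s)"
  by (induction s) auto

lemma finite_free_vars: "finite (free_vars \<phi>)"
  by (induction \<phi>) (auto simp: finite_tm_vars)

lemma tm_val_cong: "(\<And>i. i \<in> tm_vars s \<Longrightarrow> e i = e' i) \<Longrightarrow> tm_val M e s = tm_val M e' s"
proof (induction s)
  case (App f ts)
  have "map (tm_val M e) ts = map (tm_val M e') ts"
    by (rule map_cong[OF refl], rule App.IH) (use App.prems in auto)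
  then show ?case by (simp only: tm_val.simps)
qed auto

lemma sat_cong: "(\<And>i. i \<in> free_vars \<phi> \<Longrightarrow> e i = e' i) \<Longrightarrow> sat M e \<phi> = sat M e' \<phi>"
proof (induction \<phi> arbitrary: e e')
  case (Equal s t)
  then show ?case using tm_val_cong[of s e e' M] tm_val_cong[of t e e' M] by auto
next
  case (Less s t)
  then show ?case using tm_val_cong[of s e e' M] tm_val_cong[of t e e' M] by auto
next
  case (Rel r ts)
  have "map (tm_val M e) ts = map (tm_val M e') ts"
    by (rule map_cong[OF refl], rule tm_val_cong) (use Rel in auto)
  then show ?case by (simp only: sat.simps)
next
  case (And \<phi> \<psi>)
  have "sat M e \<phi> = sat M e' \<phi>" by (rule And.IH(1)) (use And.prems in auto)
  moreover have "sat M e \<psi> = sat M e' \<psi>" by (rule And.IH(2)) (use And.prems in auto)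
  ultimately show ?case by simp
next
  case (Exists i \<phi>)
  have "sat M (e(i := a)) \<phi> = sat M (e'(i := a)) \<phi>" for a
    by (rule Exists.IH) (use Exists.prems in auto)
  then show ?case by simp
next
  case (Not \<phi>)
  have "sat M e \<phi> = sat M e' \<phi>" by (rule Not.IH) (use Not.prems in auto)
  then show ?case by simp
qed

section \<open>Renaming of variables\<close>

primrec tm_rename :: "(nat \<Rightarrow> nat) \<Rightarrow> ('f, 'a) tm \<Rightarrow> ('f, 'a) tm" where
  "tm_rename \<sigma> (Var i) = Var (\<sigma> i)"
| "tm_rename \<sigma> (Par c) = Par c"
| "tm_rename \<sigma> (Add s t) = Add (tm_rename \<sigma> s) (tm_rename \<sigma> t)"
| "tm_rename \<sigma> (Mul s t) = Mul (tm_rename \<sigma> s) (tm_rename \<sigma> t)"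
| "tm_rename \<sigma> (App f ts) = App f (map (tm_rename \<sigma>) ts)"

lemma tm_val_rename: "tm_val M e (tm_rename \<sigma> s) = tm_val M (\<lambda>i. e (\<sigma> i)) s"
proof (induction s)
  case (App f ts)
  have "map (\<lambda>t. tm_val M e (tm_rename \<sigma> t)) ts = map (tm_val M (\<lambda>i. e (\<sigma> i))) ts"
    by (rule map_cong[OF refl], rule App.IH)
  then show ?case by (simp only: tm_val.simps tm_rename.simps map_map o_def)
qed auto

text \<open>Phrased through truth values because the renamed formula must also change bound
  variables: \<open>\<sigma>\<close> need not be injective, so under a quantifier the bound variable
  is moved to an index outside the image of the free ones.\<close>

lemma sat_rename: "\<exists>\<psi>. \<forall>e. sat M e \<psi> = sat M (\<lambda>i. e (\<sigma> i)) \<phi>"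
proof (induction \<phi> arbitrary: \<sigma>)
  case (Equal s t)
  show ?case
    by (rule exI[of _ "Equal (tm_rename \<sigma> s) (tm_rename \<sigma> t)"]) (simp add: tm_val_rename)
next
  case (Less s t)
  show ?case
    by (rule exI[of _ "Less (tm_rename \<sigma> s) (tm_rename \<sigma> t)"]) (simp add: tm_val_rename)
next
  case (Rel r ts)
  show ?case
    by (rule exI[of _ "Rel r (map (tm_rename \<sigma>) ts)"]) (simp add: tm_val_rename o_def)
next
  case (Not \<phi>)
  obtain \<psi> where "\<forall>e. sat M e \<psi> = sat M (\<lambda>i. e (\<sigma> i)) \<phi>" using Not.IH by blast
  then show ?case by (intro exI[of _ "fm.Not \<psi>"]) simp
next
  case (And \<phi>1 \<phi>2)
  obtain \<psi>1 where "\<forall>e. sat M e \<psi>1 = sat M (\<lambda>i. e (\<sigma> i)) \<phi>1" using And.IH(1) by blast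
  moreover obtain \<psi>2 where "\<forall>e. sat M e \<psi>2 = sat M (\<lambda>i. e (\<sigma> i)) \<phi>2" using And.IH(2) by blast
  ultimately show ?case by (intro exI[of _ "And \<psi>1 \<psi>2"]) simp
next
  case (Exists i \<phi>)
  obtain j where j: "j \<notin> \<sigma> ` free_vars \<phi>"
    using ex_new_if_finite[of "\<sigma> ` free_vars \<phi>"] finite_free_vars infinite_UNIV_nat by blast
  obtain \<psi> where \<psi>: "\<forall>e. sat M e \<psi> = sat M (\<lambda>k. e ((\<sigma>(i := j)) k)) \<phi>"
    using Exists.IH by blast
  have "sat M (\<lambda>k. (e(j := a)) ((\<sigma>(i := j)) k)) \<phi> = sat M ((\<lambda>k. e (\<sigma> k))(i := a)) \<phi>" for e a
    by (rule sat_cong) (use j in auto)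
  then show ?case using \<psi> by (intro exI[of _ "Exists j \<psi>"]) simp
qed

text \<open>The environment is infinite and free variables are unrestricted, so closure under
  connectives, quantifiers and substitution needs no bookkeeping of arities. The arity returns in
  \<open>definable_iff\<close>.\<close>

definition dpred :: "('f, 'r, 'a::linordered_field) expansion \<Rightarrow> ((nat \<Rightarrow> 'a) \<Rightarrow> bool) \<Rightarrow> bool" where
  "dpred M P \<longleftrightarrow> (\<exists>\<phi>. \<forall>e. sat M e \<phi> = P e)"

lemma dpred_rename: "dpred M P \<Longrightarrow> dpred M (\<lambda>e. P (\<lambda>i. e (\<sigma> i)))"
proof -
  assume "dpred M P"
  then obtain \<phi> where "P = (\<lambda>e. sat M e \<phi>)" unfolding dpred_def by auto
  moreover obtain \<psi> where "\<forall>e. sat M e \<psi> = sat M (\<lambda>i. e (\<sigma> i)) \<phi>" using sat_rename by blast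
  ultimately show ?thesis unfolding dpred_def by auto
qed

lemma dpred_cong: "dpred M P \<Longrightarrow> (\<And>e. P e = Q e) \<Longrightarrow> dpred M Q"
  unfolding dpred_def by simp

text \<open>
  Bound variables are handled by de Bruijn indices: under a quantifier the new variable is
  \<open>e 0\<close> and the old environment is \<open>\<lambda>i. e (Suc i)\<close>.
\<close>

lemma dpred_ex:
  assumes "dpred M (\<lambda>e. P (\<lambda>i. e (Suc i)) (e 0))"
  shows "dpred M (\<lambda>e. \<exists>a. P e a)"
proof -
  obtain \<phi> where \<phi>: "\<And>e. sat M e \<phi> = P (\<lambda>i. e (Suc i)) (e 0)"
    using assms unfolding dpred_def by blast
  \<comment> \<open>The bound value is stored beyond all free variables, so that shifting the others
    down by one cannot collide with it.\<close>
  obtain j where j: "\<And>k. k \<in> free_vars \<phi> \<Longrightarrow> k < j"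
    using finite_free_vars finite_nat_set_iff_bounded by metis
  obtain \<psi> where \<psi>: "\<And>e. sat M e \<psi> = sat M (\<lambda>k. e (case k of 0 \<Rightarrow> j | Suc i \<Rightarrow> i)) \<phi>"
    using sat_rename[of M "\<lambda>k. case k of 0 \<Rightarrow> j | Suc i \<Rightarrow> i" \<phi>] by auto
  have "sat M (\<lambda>k. (e(j := a)) (case k of 0 \<Rightarrow> j | Suc i \<Rightarrow> i)) \<phi> = sat M (case_nat a e) \<phi>" for e a
    by (rule sat_cong) (use j in \<open>force split: nat.splits\<close>)
  then have "sat M e (Exists j \<psi>) = (\<exists>a. P e a)" for e
    by (simp add: \<psi> \<phi>)
  then show ?thesis unfolding dpred_def by blast
qed

section \<open>Closure under the logical operations\<close>

lemma dpred_not: "dpred M P \<Longrightarrow> dpred M (\<lambda>e. \<not> P e)"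
  proof -
  assume "dpred M P"
  then obtain \<phi> where "\<forall>e. sat M e \<phi> = P e" unfolding dpred_def by blast
  then show ?thesis unfolding dpred_def by (intro exI[of _ "fm.Not \<phi>"]) simp
qed

lemma dpred_conj: "dpred M P \<Longrightarrow> dpred M Q \<Longrightarrow> dpred M (\<lambda>e. P e \<and> Q e)"
  proof -
  assume "dpred M P" "dpred M Q"
  then obtain \<phi> \<psi> where "\<forall>e. sat M e \<phi> = P e" "\<forall>e. sat M e \<psi> = Q e" unfolding dpred_def by blast
  then show ?thesis unfolding dpred_def by (intro exI[of _ "And \<phi> \<psi>"]) simp
qed

lemma dpred_disj: "dpred M P \<Longrightarrow> dpred M Q \<Longrightarrow> dpred M (\<lambda>e. P e \<or> Q e)"
  using dpred_not[OF dpred_conj[OF dpred_not[of M P] dpred_not[of M Q]]] by simp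

lemma dpred_imp: "dpred M P \<Longrightarrow> dpred M Q \<Longrightarrow> dpred M (\<lambda>e. P e \<longrightarrow> Q e)"
  by (rule dpred_cong[OF dpred_disj[OF dpred_not[of M P], of Q]]) auto

lemma dpred_iff:
  fixes P Q :: "(nat \<Rightarrow> 'a::linordered_field) \<Rightarrow> bool"
  shows "dpred M P \<Longrightarrow> dpred M Q \<Longrightarrow> dpred M (\<lambda>e. P e = Q e)"
  by (rule dpred_cong[OF dpred_conj[OF dpred_imp[of M P Q] dpred_imp[of M Q P]]]) auto

lemma dpred_all: "dpred M (\<lambda>e. P (\<lambda>i. e (Suc i)) (e 0)) \<Longrightarrow> dpred M (\<lambda>e. \<forall>a. P e a)"
  using dpred_not[OF dpred_ex[of M "\<lambda>e a. \<not> P e a", OF dpred_not]] by simp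

lemma dpred_const: "dpred M (\<lambda>e. b)"
  unfolding dpred_def
  by (cases b) (auto intro: exI[of _ "Equal (Par 0) (Par 0)"] exI[of _ "Less (Par 0) (Par 0)"])

lemma dpred_if:
  "dpred M C \<Longrightarrow> dpred M P \<Longrightarrow> dpred M Q \<Longrightarrow> dpred M (\<lambda>e. if C e then P e else Q e)"
  by (rule dpred_cong[OF dpred_disj[OF dpred_conj[of M C P] dpred_conj[OF dpred_not[of M C], of Q]]]) auto

lemma dpred_finite_ball:
  assumes "finite S" "\<And>i. i \<in> S \<Longrightarrow> dpred M (P i)"
  shows "dpred M (\<lambda>e. \<forall>i\<in>S. P i e)"
  using assms by (induction S) (auto intro: dpred_const dpred_conj)

lemma dpred_finite_bex:
  assumes "finite S" "\<And>i. i \<in> S \<Longrightarrow> dpred M (P i)"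
  shows "dpred M (\<lambda>e. \<exists>i\<in>S. P i e)"
  using assms by (induction S) (auto intro: dpred_const dpred_disj)

text \<open>The coordinates are quantified one at a time, the last one outermost. The block then
  occupies the indices below \<open>n\<close> and the old environment is shifted by
  \<open>n\<close>.\<close>

lemma dpred_ex_list:
  "dpred M (\<lambda>e. P (\<lambda>i. e (i + n)) (map e [0..<n])) \<Longrightarrow> dpred M (\<lambda>e. \<exists>x. length x = n \<and> P e x)"
proof (induction n arbitrary: P)
  case (Suc n)
  have "dpred M (\<lambda>e. \<exists>a x. length x = n \<and> P e (x @ [a]))"
    by (rule dpred_ex, rule Suc.IH) (use Suc.prems in simp)
  moreover have "(\<exists>a x. length x = n \<and> P e (x @ [a])) = (\<exists>x. length x = Suc n \<and> P e x)" for e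
    by (metis length_append_singleton length_Suc_conv_rev)
  ultimately show ?case by simp
qed simp

lemma dpred_all_list:
  assumes "dpred M (\<lambda>e. P (\<lambda>i. e (i + n)) (map e [0..<n]))"
  shows "dpred M (\<lambda>e. \<forall>x. length x = n \<longrightarrow> P e x)"
  using dpred_not[OF dpred_ex_list[of M "\<lambda>e x. \<not> P e x", OF dpred_not[OF assms]]] by simp

text \<open>A scalar function is definable when its graph is. The value sits at index 0, as a
  freshly quantified variable does, so that graphs compose with \<open>dpred_ex\<close>.\<close>

definition dterm :: "('f, 'r, 'a::linordered_field) expansion \<Rightarrow> ((nat \<Rightarrow> 'a) \<Rightarrow> 'a) \<Rightarrow> bool" where
  "dterm M f \<longleftrightarrow> dpred M (\<lambda>e. f (\<lambda>i. e (Suc i)) = e 0)"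

lemma dterm_rename:
  assumes "dterm M f"
  shows "dterm M (\<lambda>e. f (\<lambda>i. e (\<sigma> i)))"
  using dpred_rename[OF assms[unfolded dterm_def], of "case_nat 0 (\<lambda>i. Suc (\<sigma> i))"]
  unfolding dterm_def by simp

text \<open>Substitution of a definable function is a quantification over its value: some
  \<open>a\<close> satisfies \<open>f e = a\<close> and \<open>P e a\<close>.\<close>

lemma dpred_bind:
  assumes "dterm M f" "dpred M (\<lambda>e. P (\<lambda>i. e (Suc i)) (e 0))"
  shows "dpred M (\<lambda>e. P e (f e))"
proof -
  have "dpred M (\<lambda>e. \<exists>a. f e = a \<and> P e a)"
    by (rule dpred_ex, rule dpred_conj) (use assms in \<open>simp_all add: dterm_def\<close>)
  then show ?thesis by simp
qed

lemma dpred_bind2: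
  assumes "dterm M f" "dterm M g" "dpred M (\<lambda>e. P (\<lambda>i. e (Suc (Suc i))) (e 1) (e 0))"
  shows "dpred M (\<lambda>e. P e (f e) (g e))"
proof (rule dpred_bind[OF assms(1), of "\<lambda>e a. P e a (g e)"])
  show "dpred M (\<lambda>e. P (\<lambda>i. e (Suc i)) (e 0) (g (\<lambda>i. e (Suc i))))"
    by (rule dpred_bind[OF dterm_rename[OF assms(2), of Suc],
          of "\<lambda>e a. P (\<lambda>i. e (Suc i)) (e 0) a"]) (use assms(3) in simp)
qed

section \<open>Definable arithmetic and comparisons\<close>

lemma dterm_var: "dterm M (\<lambda>e. e k)"
  unfolding dterm_def dpred_def by (rule exI[of _ "Equal (Var (Suc k)) (Var 0)"]) simp

lemma dterm_const: "dterm M (\<lambda>e. c)"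
  unfolding dterm_def dpred_def by (rule exI[of _ "Equal (Par c) (Var 0)"]) simp

lemma dpred_less: "dterm M f \<Longrightarrow> dterm M g \<Longrightarrow> dpred M (\<lambda>e. f e < g e)"
  by (rule dpred_bind2[of M f g "\<lambda>e a b. a < b"], assumption+)
    (unfold dpred_def, rule exI[of _ "Less (Var 1) (Var 0)"], simp)

lemma dpred_eq:
  fixes f g :: "(nat \<Rightarrow> 'a::linordered_field) \<Rightarrow> 'a"
  shows "dterm M f \<Longrightarrow> dterm M g \<Longrightarrow> dpred M (\<lambda>e. f e = g e)"
  by (rule dpred_bind2[of M f g "\<lambda>e a b. a = b"], assumption+)
    (unfold dpred_def, rule exI[of _ "Equal (Var 1) (Var 0)"], simp)

lemma dpred_le: "dterm M f \<Longrightarrow> dterm M g \<Longrightarrow> dpred M (\<lambda>e. f e \<le> g e)"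
  using dpred_not[OF dpred_less[of M g f]] by (simp add: not_less)

lemma dterm_bind2:
  assumes "dterm M f" "dterm M g" "dterm M (\<lambda>e. F (e 0) (e 1))"
  shows "dterm M (\<lambda>e. F (f e) (g e))"
proof -
  have F: "dpred M (\<lambda>e. F (e 1) (e 0) = e 2)"
    using dpred_rename[OF assms(3)[unfolded dterm_def], of "\<lambda>i. if i = 0 then 2 else if i = 1 then 1 else 0"]
    by (simp add: numeral_2_eq_2)
  show ?thesis unfolding dterm_def
    by (rule dpred_bind2[OF dterm_rename[OF assms(1), of Suc] dterm_rename[OF assms(2), of Suc],
          of "\<lambda>e a b. F a b = e 0"]) (use F in \<open>simp add: numeral_2_eq_2\<close>)
qed

lemma dterm_add: "dterm M f \<Longrightarrow> dterm M g \<Longrightarrow> dterm M (\<lambda>e. f e + g e)"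
  by (rule dterm_bind2[of M f g "(+)"], assumption+)
    (unfold dterm_def dpred_def, rule exI[of _ "Equal (Add (Var 1) (Var 2)) (Var 0)"],
      simp add: numeral_2_eq_2)

lemma dterm_mult: "dterm M f \<Longrightarrow> dterm M g \<Longrightarrow> dterm M (\<lambda>e. f e * g e)"
  by (rule dterm_bind2[of M f g "(*)"], assumption+)
    (unfold dterm_def dpred_def, rule exI[of _ "Equal (Mul (Var 1) (Var 2)) (Var 0)"],
      simp add: numeral_2_eq_2)

lemma dterm_uminus: "dterm M f \<Longrightarrow> dterm M (\<lambda>e. - f e)"
  using dterm_mult[OF dterm_const[of M "-1"], of f] by simp

lemma dterm_diff: "dterm M f \<Longrightarrow> dterm M g \<Longrightarrow> dterm M (\<lambda>e. f e - g e)"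
  using dterm_add[OF _ dterm_uminus[of M g], of f] by simp

lemma dterm_if:
  assumes "dpred M C" "dterm M f" "dterm M g"
  shows "dterm M (\<lambda>e. if C e then f e else g e)"
proof -
  have "dpred M (\<lambda>e. if C (\<lambda>i. e (Suc i)) then f (\<lambda>i. e (Suc i)) = e 0 else g (\<lambda>i. e (Suc i)) = e 0)"
    by (rule dpred_if)
      (use assms dpred_rename[OF assms(1), of Suc] in \<open>simp_all add: dterm_def\<close>)
  then show ?thesis unfolding dterm_def by (rule dpred_cong) auto
qed

lemma dterm_max: "dterm M f \<Longrightarrow> dterm M g \<Longrightarrow> dterm M (\<lambda>e. max (f e) (g e))"
  unfolding max_def by (intro dterm_if dpred_le)

lemma dterm_abs: "dterm M f \<Longrightarrow> dterm M (\<lambda>e. \<bar>f e\<bar>)"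
  unfolding abs_if by (intro dterm_if dpred_less dterm_uminus dterm_const)

lemma dterm_divide:
  assumes "dterm M f" "dterm M g"
  shows "dterm M (\<lambda>e. f e / g e)"
proof -
  \<comment> \<open>The summand \<open>0 * e 0\<close> turns the inverse into a function of two
    variables, the form expected by \<open>dterm_bind2\<close>. The defining formula follows the
    convention \<open>inverse 0 = 0\<close>.\<close>
  have "dterm M (\<lambda>e. inverse (e 1) + 0 * e 0)"
  proof -
    have "dpred M (\<lambda>e. if e 2 = 0 then e 0 = 0 else e 0 * e 2 = 1)"
      by (intro dpred_if dpred_eq dterm_mult dterm_var dterm_const)
    then show ?thesis unfolding dterm_def
      by (rule dpred_cong) (auto simp: numeral_2_eq_2 field_simps)
  qed
  from dterm_bind2[of M f g "\<lambda>a b. inverse b + 0 * a", OF assms this]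
  have "dterm M (\<lambda>e. inverse (g e))" by simp
  from dterm_mult[OF assms(1) this] show ?thesis by (simp add: divide_inverse)
qed

lemmas dpred_intros =
  dpred_ex dpred_all dpred_ex_list dpred_all_list dpred_not dpred_conj dpred_disj dpred_imp dpred_iff
  dpred_const dpred_less dpred_le dpred_eq dterm_var dterm_const dterm_add dterm_mult
  dterm_uminus dterm_diff dterm_abs dterm_max dterm_divide

text \<open>The length is the same for every environment, so lists behave as tuples and can be
  treated coordinate by coordinate.\<close>

definition dvec ::
  "('f, 'r, 'a::linordered_field) expansion \<Rightarrow> nat \<Rightarrow> ((nat \<Rightarrow> 'a) \<Rightarrow> 'a list) \<Rightarrow> bool" where
  "dvec M n v \<longleftrightarrow> (\<forall>e. length (v e) = n) \<and> (\<forall>i<n. dterm M (\<lambda>e. v e ! i))"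

lemma dvec_vars: "dvec M n (\<lambda>e. map (\<lambda>i. e (\<sigma> i)) [0..<n])"
  unfolding dvec_def by (simp add: dterm_var)

lemma dvec_const: "length x = n \<Longrightarrow> dvec M n (\<lambda>e. x)"
  unfolding dvec_def by (simp add: dterm_const)

lemma dvec_single: "dterm M f \<Longrightarrow> dvec M (Suc 0) (\<lambda>e. [f e])"
  unfolding dvec_def by simp

lemma dvec_append:
  assumes "dvec M n v" "dvec M m w"
  shows "dvec M (n + m) (\<lambda>e. v e @ w e)"
  unfolding dvec_def
proof (intro conjI allI impI)
  show "dterm M (\<lambda>e. (v e @ w e) ! i)" if "i < n + m" for i
    using assms that unfolding dvec_def nth_append by (cases "i < n") auto
qed (use assms in \<open>simp add: dvec_def\<close>)

lemma dvec_snoc: "dvec M n v \<Longrightarrow> dterm M f \<Longrightarrow> dvec M (Suc n) (\<lambda>e. v e @ [f e])"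
  using dvec_append[OF _ dvec_single, of M n v f] by simp

lemma dvec_rename: "dvec M n v \<Longrightarrow> dvec M n (\<lambda>e. v (\<lambda>i. e (\<sigma> i)))"
  unfolding dvec_def using dterm_rename[of M "\<lambda>e. v e ! _"] by simp

lemma dpred_list_eq:
  assumes "dvec M n v" "dvec M n w"
  shows "dpred M (\<lambda>e. v e = w e)"
proof -
  have "dpred M (\<lambda>e. \<forall>i\<in>{..<n}. v e ! i = w e ! i)"
    by (rule dpred_finite_ball) (use assms in \<open>auto simp: dvec_def intro: dpred_eq\<close>)
  moreover have "(\<forall>i\<in>{..<n}. v e ! i = w e ! i) = (v e = w e)" for e
    using assms unfolding dvec_def by (metis lessThan_iff nth_equalityI)
  ultimately show ?thesis by simp
qed

lemma dpred_bind_list: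
  assumes "dvec M n v" "dpred M (\<lambda>e. P (\<lambda>i. e (i + n)) (map e [0..<n]))"
  shows "dpred M (\<lambda>e. P e (v e))"
proof -
  have "dpred M (\<lambda>e. \<exists>x. length x = n \<and> v e = x \<and> P e x)"
    by (intro dpred_ex_list dpred_conj assms(2)
        dpred_list_eq[OF dvec_rename[OF assms(1)] dvec_vars[of M n "\<lambda>i. i"]])
  then show ?thesis using assms(1) unfolding dvec_def by simp
qed

lemma dpred_mem:
  assumes "dpred M (\<lambda>e. map e [0..<n] \<in> A)" "dvec M n v"
  shows "dpred M (\<lambda>e. v e \<in> A)"
  by (rule dpred_bind_list[OF assms(2)]) (rule assms(1))

lemma dterm_fun:
  assumes "dterm M (\<lambda>e. c (map e [0..<n]))" "dvec M n v"
  shows "dterm M (\<lambda>e. c (v e))"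
  unfolding dterm_def
proof (rule dpred_bind_list[OF dvec_rename[OF assms(2)], of "\<lambda>e x. c x = e 0"])
  show "dpred M (\<lambda>e. c (map e [0..<n]) = e (0 + n))"
    by (rule dpred_eq[OF assms(1) dterm_var])
qed

lemma dterm_fun1:
  assumes "dterm M (\<lambda>e. g (e 0))" "dterm M f"
  shows "dterm M (\<lambda>e. g (f e))"
  using dterm_bind2[OF assms(2) assms(2), of "\<lambda>a b. g a"] assms(1) by simp

lemma dpred_app1:
  assumes "dpred M (\<lambda>e. A (e 0))" "dterm M f"
  shows "dpred M (\<lambda>e. A (f e))"
  by (rule dpred_bind[OF assms(2)]) (rule assms(1))

lemma dpred_app2:
  assumes "dpred M (\<lambda>e. A (e 0) (e 1))" "dterm M f" "dterm M g"
  shows "dpred M (\<lambda>e. A (f e) (g e))"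
  by (rule dpred_bind2[OF assms(2,3)])
    (use dpred_rename[OF assms(1), of "\<lambda>i. if i = 0 then 1 else 0"] in simp)

lemma dpred_app_list:
  assumes A: "dpred M (\<lambda>e. A (map e [0..<n]) (e n))" and v: "dvec M n v" and f: "dterm M f"
  shows "dpred M (\<lambda>e. A (v e) (f e))"
proof (rule dpred_bind[OF f, of "\<lambda>e a. A (v e) a"])
  show "dpred M (\<lambda>e. A (v (\<lambda>i. e (Suc i))) (e 0))"
    by (rule dpred_bind_list[OF dvec_rename[OF v], of "\<lambda>e x. A x (e 0)"]) (use A in simp)
qed

lemmas dvec_intros = dvec_vars dvec_snoc dvec_append

lemma definable_iff:
  fixes A :: "'a::linordered_field list set"
  shows "definable M n A \<longleftrightarrow> A \<subseteq> {xs. length xs = n} \<and> dpred M (\<lambda>e. map e [0..<n] \<in> A)"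
proof
  assume "definable M n A"
  then obtain \<phi> where \<phi>: "free_vars \<phi> \<subseteq> {..<n}" "A = {xs. length xs = n \<and> sat M ((!) xs) \<phi>}"
    unfolding definable_def by blast
  have "sat M ((!) (map e [0..<n])) \<phi> = sat M e \<phi>" for e
    by (rule sat_cong) (use \<phi>(1) in auto)
  then have "dpred M (\<lambda>e. map e [0..<n] \<in> A)" unfolding \<phi>(2) dpred_def by auto
  then show "A \<subseteq> {xs. length xs = n} \<and> dpred M (\<lambda>e. map e [0..<n] \<in> A)" using \<phi>(2) by auto
next
  assume A: "A \<subseteq> {xs. length xs = n} \<and> dpred M (\<lambda>e. map e [0..<n] \<in> A)"
  \<comment> \<open>A formula for the predicate may mention variables from \<open>n\<close> on. The
    truth value does not depend on them, so each can be quantified away without changing the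
    meaning; the induction is on their number.\<close>
  have bind: "\<exists>\<psi>. free_vars \<psi> \<subseteq> {..<n} \<and> (\<forall>e. sat M e \<psi> = (map e [0..<n] \<in> A))"
    if "card (free_vars \<phi> - {..<n}) = k" "\<forall>e. sat M e \<phi> = (map e [0..<n] \<in> A)" for k \<phi>
    using that
  proof (induction k arbitrary: \<phi>)
    case 0
    then have "free_vars \<phi> - {..<n} = {}" by (simp add: finite_free_vars)
    then show ?case using 0 by blast
  next
    case (Suc k)
    then have "free_vars \<phi> - {..<n} \<noteq> {}" by (metis card.empty nat.distinct(1))
    then obtain i where i: "i \<in> free_vars \<phi> - {..<n}" by blast
    have "free_vars (Exists i \<phi>) - {..<n} = (free_vars \<phi> - {..<n}) - {i}" by auto
    then have "card (free_vars (Exists i \<phi>) - {..<n}) = k"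
      using Suc.prems(1) i finite_free_vars[of \<phi>] by simp
    moreover have "\<forall>e. sat M e (Exists i \<phi>) = (map e [0..<n] \<in> A)"
      using Suc.prems(2) i by (simp del: fun_upd_apply)
    ultimately show ?case by (rule Suc.IH)
  qed
  obtain \<phi> where "\<forall>e. sat M e \<phi> = (map e [0..<n] \<in> A)" using A unfolding dpred_def by blast
  from bind[OF refl this] obtain \<psi>
    where \<psi>: "free_vars \<psi> \<subseteq> {..<n}" "\<And>e. sat M e \<psi> = (map e [0..<n] \<in> A)" by blast
  have "map ((!) xs) [0..<n] = xs" if "length xs = n" for xs :: "'a list"
    using that map_nth[of xs] by simp
  then have "A = {xs. length xs = n \<and> sat M ((!) xs) \<psi>}" using A by (auto simp: \<psi>(2))
  then show "definable M n A" unfolding definable_def using \<psi>(1) by blast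
qed

section \<open>One-variable consequences of o-minimality\<close>

lemma point_or_interval_right_germ:
  fixes a :: "'a::linordered_field"
  assumes "point_or_interval C"
  shows "\<exists>b>a. (\<forall>x. a < x \<and> x < b \<longrightarrow> x \<in> C) \<or> (\<forall>x. a < x \<and> x < b \<longrightarrow> x \<notin> C)"
proof -
  consider c where "C = {c}" | c d where "C = {c<..<d}" | c where "C = {c<..}" | d where "C = {..<d}"
    | "C = UNIV"
    using assms unfolding point_or_interval_def by blast
  then show ?thesis
  proof cases
    case 1
    then show ?thesis
      by (intro exI[of _ "if a < c then c else a + 1"]) auto
  next
    case 2
    then show ?thesis
      by (intro exI[of _ "if a < c then c else if a < d then d else a + 1"]) auto
  next
    case 3
    then show ?thesis
      by (intro exI[of _ "if a < c then c else a + 1"]) auto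
  next
    case 4
    then show ?thesis
      by (intro exI[of _ "if a < d then d else a + 1"]) auto
  next
    case 5
    then show ?thesis by (intro exI[of _ "a + 1"]) auto
  qed
qed

lemma point_or_interval_lub:
  fixes K :: "'a::linordered_field"
  assumes "point_or_interval C" "C \<noteq> {}" "\<forall>x\<in>C. x \<le> K"
  shows "\<exists>s. (\<forall>x\<in>C. x \<le> s) \<and> (\<forall>y<s. \<exists>x\<in>C. y < x)"
proof -
  consider c where "C = {c}" | c d where "C = {c<..<d}" | c where "C = {c<..}" | d where "C = {..<d}"
    | "C = UNIV"
    using assms unfolding point_or_interval_def by blast
  then show ?thesis
  proof cases
    case (2 c d)
    then have "c < d" using assms(2) by auto
    then have "\<exists>x\<in>C. y < x" if "y < d" for y
      using dense[of "max c y" d] that 2 by auto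
    then show ?thesis using 2 by (intro exI[of _ d]) auto
  next
    case (3 c)
    then have "max (c + 1) (K + 1) \<in> C" by (auto simp: less_max_iff_disj)
    then show ?thesis using assms(3) by (meson add_le_same_cancel1 max.bounded_iff not_one_le_zero)
  next
    case (4 d)
    then have "\<exists>x\<in>C. y < x" if "y < d" for y
      using dense[of y d] that by auto
    then show ?thesis using 4 by (intro exI[of _ d]) auto
  next
    case 5
    then have "K + 1 \<in> C" by auto
    then show ?thesis using assms(3) by (meson add_le_same_cancel1 not_one_le_zero)
  qed auto
qed

section \<open>Suprema, connectedness and one-sided limits\<close>

locale o_minimal_expansion =
  fixes M :: "('f, 'r, 'a::linordered_field) expansion"
  assumes o_minimal: "o_minimal M"
begin

lemma definable_decomp:
  assumes "dpred M (\<lambda>e. S (e 0))"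
  obtains \<C> where "finite \<C>" "\<forall>C\<in>\<C>. point_or_interval C" "{x. S x} = \<Union>\<C>"
proof -
  have "definable M 1 ((\<lambda>x. [x]) ` {x. S x})"
    unfolding definable_iff using assms by (auto simp: image_iff)
  then have "\<exists>\<C>. finite \<C> \<and> (\<forall>C\<in>\<C>. point_or_interval C) \<and> {x. S x} = \<Union>\<C>"
    using o_minimal[unfolded o_minimal_def] by simp
  then show ?thesis using that by auto
qed

text \<open>One of the finitely many pieces is infinite, hence is not a single point. In the
  finiteness arguments below this turns infinitely many exceptions into an interval of
  exceptions.\<close>

lemma infinite_interval:
  assumes "dpred M (\<lambda>e. S (e 0))" "infinite {x. S x}"
  obtains p q where "p < q" "\<And>x. p < x \<Longrightarrow> x < q \<Longrightarrow> S x"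
proof -
  obtain \<C> where C: "finite \<C>" "\<forall>C\<in>\<C>. point_or_interval C" "{x. S x} = \<Union>\<C>"
    using definable_decomp[OF assms(1)] .
  then obtain C where CC: "C \<in> \<C>" "infinite C" using assms(2) finite_Union by metis
  have sub: "C \<subseteq> {x. S x}" using C CC by auto
  have "\<exists>p q. p < q \<and> {p<..<q} \<subseteq> C"
  proof -
    consider c where "C = {c}" | c d where "C = {c<..<d}" | c where "C = {c<..}" | d where "C = {..<d}"
      | "C = UNIV"
      using bspec[OF C(2) CC(1)] unfolding point_or_interval_def by blast
    then show ?thesis
    proof cases
      case 1
      then show ?thesis using CC by auto
    next
      case (2 c d)
      then have "c < d" using CC(2) by (metis finite.emptyI greaterThanLessThan_empty_iff not_le)
      then show ?thesis using 2 by blast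
    next
      case (3 c)
      then show ?thesis by (intro exI[of _ c] exI[of _ "c + 1"]) auto
    next
      case (4 d)
      then show ?thesis by (intro exI[of _ "d - 1"] exI[of _ d]) auto
    next
      case 5
      then show ?thesis by (intro exI[of _ 0] exI[of _ 1]) auto
    qed
  qed
  then obtain p q where "p < q" "{p<..<q} \<subseteq> C" by blast
  then show ?thesis using sub by (intro that[of p q]) auto
qed

lemma right_germ:
  assumes "dpred M (\<lambda>e. S (e 0))"
  obtains b where "b > a" "(\<forall>x. a < x \<and> x < b \<longrightarrow> S x) \<or> (\<forall>x. a < x \<and> x < b \<longrightarrow> \<not> S x)"
proof -
  obtain \<C> where C: "finite \<C>" "\<forall>C\<in>\<C>. point_or_interval C" "{x. S x} = \<Union>\<C>"
    using definable_decomp[OF assms(1)] .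
  have "\<exists>b>a. (\<forall>x. a < x \<and> x < b \<longrightarrow> x \<in> \<Union>\<C>) \<or> (\<forall>x. a < x \<and> x < b \<longrightarrow> x \<notin> \<Union>\<C>)"
    using C(1,2)
  proof (induction \<C>)
    case empty
    then show ?case by (intro exI[of _ "a + 1"]) auto
  next
    case (insert C \<C>)
    then obtain b where b: "b > a"
      "(\<forall>x. a < x \<and> x < b \<longrightarrow> x \<in> \<Union>\<C>) \<or> (\<forall>x. a < x \<and> x < b \<longrightarrow> x \<notin> \<Union>\<C>)" by auto
    obtain b' where b': "b' > a"
      "(\<forall>x. a < x \<and> x < b' \<longrightarrow> x \<in> C) \<or> (\<forall>x. a < x \<and> x < b' \<longrightarrow> x \<notin> C)"
      using point_or_interval_right_germ insert.prems by blast
    show ?case using b b' by (intro exI[of _ "min b b'"]) (simp, blast)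
  qed
  then obtain b where "b > a" "(\<forall>x. a < x \<and> x < b \<longrightarrow> x \<in> \<Union>\<C>) \<or> (\<forall>x. a < x \<and> x < b \<longrightarrow> x \<notin> \<Union>\<C>)"
    by blast
  then show ?thesis unfolding C(3)[symmetric] by (intro that[of b]) auto
qed

text \<open>The endpoints of the pieces are elements of the field by definition, which gives suprema
  of definable sets although the order itself may be incomplete.\<close>

lemma definable_lub:
  assumes "dpred M (\<lambda>e. S (e 0))" "S x0" "\<And>x. S x \<Longrightarrow> x \<le> K"
  obtains s where "\<And>x. S x \<Longrightarrow> x \<le> s" "\<And>y. y < s \<Longrightarrow> \<exists>x. S x \<and> y < x"
proof -
  obtain \<C> where C: "finite \<C>" "\<forall>C\<in>\<C>. point_or_interval C" "{x. S x} = \<Union>\<C>"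
    using definable_decomp[OF assms(1)] .
  have "(\<Union>\<C> = {}) \<or> (\<exists>s. (\<forall>x\<in>\<Union>\<C>. x \<le> s) \<and> (\<forall>y<s. \<exists>x\<in>\<Union>\<C>. y < x))"
    if "\<forall>x\<in>\<Union>\<C>. x \<le> K" using C(1,2) that
  proof (induction \<C>)
    case (insert C \<C>)
    show ?case
    proof (cases "C = {}")
      case True
      then show ?thesis using insert by auto
    next
      case False
      then obtain s where s: "\<forall>x\<in>C. x \<le> s" "\<forall>y<s. \<exists>x\<in>C. y < x"
        using point_or_interval_lub[of C K] insert.prems by auto
      show ?thesis
      proof (cases "\<Union>\<C> = {}")
        case True
        then have "\<Union>(insert C \<C>) = C" by auto
        then show ?thesis using s by metis
      next
        case False
        then obtain s' where s': "\<forall>x\<in>\<Union>\<C>. x \<le> s'" "\<forall>y<s'. \<exists>x\<in>\<Union>\<C>. y < x"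
          using insert by auto
        have "(\<forall>x\<in>\<Union>(insert C \<C>). x \<le> max s s') \<and> (\<forall>y<max s s'. \<exists>x\<in>\<Union>(insert C \<C>). y < x)"
          using s s' by (fastforce simp: less_max_iff_disj le_max_iff_disj)
        then show ?thesis by blast
      qed
    qed
  qed simp
  moreover have "\<forall>x\<in>\<Union>\<C>. x \<le> K" using assms(3) C(3) by auto
  moreover have "\<Union>\<C> \<noteq> {}" using assms(2) C(3) by auto
  ultimately obtain s where "\<forall>x\<in>\<Union>\<C>. x \<le> s" "\<forall>y<s. \<exists>x\<in>\<Union>\<C>. y < x" by blast
  then show ?thesis unfolding C(3)[symmetric] by (intro that[of s]) auto
qed

text \<open>Definable connectedness of a closed interval. At the supremum \<open>s\<close> of the
  initial segments on which \<open>P\<close> holds, the local hypothesis carries \<open>P\<close>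
  from a point just before \<open>s\<close> to points beyond \<open>s\<close>, so \<open>s\<close>
  must be \<open>q\<close>.\<close>

lemma interval_connected:
  assumes P: "dpred M (\<lambda>e. P (e 0))" and "p \<le> q" "P p"
    and loc: "\<And>y. p \<le> y \<Longrightarrow> y \<le> q \<Longrightarrow> \<exists>s>0. \<forall>y' y''. p \<le> y' \<and> y' \<le> q \<and> \<bar>y' - y\<bar> < s \<and>
      p \<le> y'' \<and> y'' \<le> q \<and> \<bar>y'' - y\<bar> < s \<longrightarrow> P y' \<longrightarrow> P y''"
  shows "P q"
proof -
  define S where "S = (\<lambda>y. p \<le> y \<and> y \<le> q \<and> (\<forall>z. p \<le> z \<and> z \<le> y \<longrightarrow> P z))"
  have dS: "dpred M (\<lambda>e. S (e 0))"
    unfolding S_def by (intro dpred_intros dpred_app1[OF P])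
  have "S p" unfolding S_def using assms by (auto simp: order.antisym)
  then obtain s where s: "\<And>x. S x \<Longrightarrow> x \<le> s" "\<And>y. y < s \<Longrightarrow> \<exists>x. S x \<and> y < x"
    using definable_lub[OF dS, of p q] unfolding S_def by blast
  have "p \<le> s" using s(1) \<open>S p\<close> by blast
  have "s \<le> q" using s(2)[of q] unfolding S_def by force
  obtain d where d: "d > 0" "\<And>y' y''. p \<le> y' \<Longrightarrow> y' \<le> q \<Longrightarrow> \<bar>y' - s\<bar> < d \<Longrightarrow>
      p \<le> y'' \<Longrightarrow> y'' \<le> q \<Longrightarrow> \<bar>y'' - s\<bar> < d \<Longrightarrow> P y' \<Longrightarrow> P y''"
    using loc[OF \<open>p \<le> s\<close> \<open>s \<le> q\<close>] by blast
  obtain y where y: "S y" "s - d < y" using s(2)[of "s - d"] d by auto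
  have "y \<le> s" using s(1) y by auto
  have Pz: "P z" if "p \<le> z" "z \<le> q" "z < s + d" for z
  proof (cases "z \<le> y")
    case True
    then show ?thesis using y that unfolding S_def by auto
  next
    case False
    show ?thesis
      by (rule d(2)[of y z]) (use y \<open>y \<le> s\<close> that False in \<open>auto simp: S_def abs_less_iff\<close>)
  qed
  have "S (min q (s + d / 2))"
    unfolding S_def using Pz d(1) \<open>p \<le> s\<close> assms(2) by (auto simp: field_simps)
  then have "min q (s + d / 2) \<le> s" using s(1) by blast
  then have "q \<le> s" using d(1) by (auto simp: min_def split: if_splits)
  then show ?thesis using Pz[of q] d(1) \<open>p \<le> q\<close> by auto
qed

text \<open>
  If every level set \<open>S c\<close> were finite, then \<open>Max (S c)\<close> would be monotone in \<open>c\<close>, and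
  neither a finite nor an infinite set of such maxima is possible.
\<close>

lemma uniform_on_subinterval:
  assumes R: "dpred M (\<lambda>e. R (e 0) (e 1))"
    and mono: "\<And>x c c'. R x c \<Longrightarrow> 0 < c' \<Longrightarrow> c' \<le> c \<Longrightarrow> R x c'"
    and "p < q" and ex: "\<And>x. p < x \<Longrightarrow> x < q \<Longrightarrow> \<exists>c>0. R x c"
  obtains c p' q' where "c > 0" "p' < q'" "\<And>x. p' < x \<Longrightarrow> x < q' \<Longrightarrow> p < x \<and> x < q \<and> R x c"
proof (rule ccontr)
  note that' = that
  assume "\<not> thesis"
  then have contra: False if "c > 0" "p' < q'" "\<And>x. p' < x \<Longrightarrow> x < q' \<Longrightarrow> p < x \<and> x < q \<and> R x c" for c p' q'
    using that' that by metis
  define S where "S = (\<lambda>c x. p < x \<and> x < q \<and> R x c)"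
  have dS: "dpred M (\<lambda>e. S (f e) (g e))" if "dterm M f" "dterm M g" for f g
    unfolding S_def by (intro dpred_intros dpred_app2[OF R] that)
  have fin: "finite {x. S c x}" if "c > 0" for c
  proof (rule ccontr)
    assume "infinite {x. S c x}"
    then obtain p' q' where "p' < q'" "\<And>x. p' < x \<Longrightarrow> x < q' \<Longrightarrow> S c x"
      using infinite_interval[of "S c"] dS[OF dterm_const dterm_var] by blast
    then show False using contra[OF \<open>c > 0\<close>, of p' q'] unfolding S_def by simp
  qed
  have Smono: "S c x \<Longrightarrow> 0 < c' \<Longrightarrow> c' \<le> c \<Longrightarrow> S c' x" for x c c'
    unfolding S_def using mono by blast
  obtain x0 where x0: "p < x0" "x0 < q" using dense assms(3) by blast
  obtain c0 where c0: "c0 > 0" "S c0 x0" using ex x0 unfolding S_def by blast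
  define mx where "mx = (\<lambda>c y. S c y \<and> (\<forall>z. S c z \<longrightarrow> z \<le> y))"
  define Im where "Im = (\<lambda>y. \<exists>c. 0 < c \<and> c \<le> c0 \<and> mx c y)"
  have dIm: "dpred M (\<lambda>e. Im (e 0))"
    unfolding Im_def mx_def by (intro dpred_intros dS)
  have mx_ex: "\<exists>y. mx c y" if "0 < c" "c \<le> c0" for c
    unfolding mx_def using Max_in[OF fin[OF that(1)]] Max_ge[OF fin[OF that(1)]]
      Smono[OF c0(2) that] by (metis empty_iff mem_Collect_eq)
  show False
  proof (cases "finite {y. Im y}")
    case True
    obtain y0 where "Im y0" using mx_ex[OF c0(1)] c0(1) unfolding Im_def by blast
    \<comment> \<open>A point to the right of the largest maximum \<open>x1\<close> enters the level
      set once \<open>c\<close> is small, and the maximum of that level set exceeds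
      \<open>x1\<close>.\<close>
    define x1 where "x1 = Max {y. Im y}"
    have "Im x1" unfolding x1_def using Max_in[OF True] \<open>Im y0\<close> by blast
    then have "p < x1" "x1 < q" unfolding Im_def mx_def S_def by auto
    then obtain x2 where x2: "x1 < x2" "x2 < q" using dense by blast
    obtain c where c: "c > 0" "R x2 c" using ex[OF less_trans[OF \<open>p < x1\<close> x2(1)] x2(2)] by blast
    have "S (min c c0) x2"
      unfolding S_def using x2 \<open>p < x1\<close> mono[OF c(2), of "min c c0"] c(1) c0(1) by auto
    obtain y where y: "mx (min c c0) y" using mx_ex[of "min c c0"] c c0 by auto
    then have "x2 \<le> y" using \<open>S (min c c0) x2\<close> unfolding mx_def by blast
    moreover have "Im y" unfolding Im_def using y c c0 by (intro exI[of _ "min c c0"]) auto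
    then have "y \<le> x1" unfolding x1_def using Max_ge[OF True] by blast
    ultimately show False using x2 by auto
  next
    case False
    then obtain p' q' where pq: "p' < q'" "\<And>x. p' < x \<Longrightarrow> x < q' \<Longrightarrow> Im x"
      using infinite_interval[OF dIm] by blast
    obtain x' where x': "p' < x'" "x' < q'" using dense pq(1) by blast
    then obtain c' where c': "0 < c'" "mx c' x'" using pq(2) unfolding Im_def by blast
    \<comment> \<open>Level sets grow as \<open>c\<close> decreases. A point \<open>x\<close> left
      of \<open>x'\<close> that is itself a maximum must belong to a larger \<open>c\<close>, hence
      it also lies in the level set of \<open>c'\<close>; that set then contains a whole
      interval.\<close>
    have "S c' x" if px: "p' < x" and xx: "x < x'" for x
    proof -
      obtain c where c: "0 < c" "mx c x" using pq(2)[OF px less_trans[OF xx x'(2)]] unfolding Im_def by blast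
      have "\<not> c \<le> c'"
        using Smono[of c' x' c] c c' xx unfolding mx_def by fastforce
      then show ?thesis using Smono[of c x c'] c c' unfolding mx_def by auto
    qed
    then have "{p'<..<x'} \<subseteq> {x. S c' x}" by auto
    then show False using fin[OF c'(1)] infinite_Ioo[OF x'(1)] finite_subset by blast
  qed
qed

text \<open>The limit is the supremum of the values that \<open>g\<close> eventually exceeds to the
  right of \<open>a\<close>. Nothing oscillates: whether \<open>g\<close> exceeds
  \<open>L + \<epsilon> / 2\<close> is decided on a whole interval to the right of \<open>a\<close>,
  and the answer must be negative.\<close>

lemma right_limit:
  assumes g: "dterm M (\<lambda>e. g (e 0))" and bd: "\<And>x. \<bar>g x\<bar> \<le> K"
  obtains L where "\<And>\<epsilon>. \<epsilon> > 0 \<Longrightarrow> \<exists>b>a. \<forall>x. a < x \<and> x < b \<longrightarrow> \<bar>g x - L\<bar> < \<epsilon>"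
proof -
  define T where "T = (\<lambda>y. \<exists>b>a. \<forall>x. a < x \<and> x < b \<longrightarrow> y < g x)"
  have dT: "dpred M (\<lambda>e. T (e 0))"
    unfolding T_def by (intro dpred_intros dterm_fun1[OF g])
  have "- K - 1 < g x" for x
    using abs_le_D2[OF bd[of x]] by linarith
  then have "T (- K - 1)"
    unfolding T_def by (intro exI[of _ "a + 1"]) auto
  have Tle: "y \<le> K" if T: "T y" for y
  proof -
    obtain b where b: "b > a" "\<forall>x. a < x \<and> x < b \<longrightarrow> y < g x" using T unfolding T_def by blast
    then obtain x where "a < x" "x < b" using dense by blast
    then show ?thesis using b(2) bd[of x] by (meson abs_le_D1 less_imp_le less_le_trans)
  qed
  obtain L where L: "\<And>x. T x \<Longrightarrow> x \<le> L" "\<And>y. y < L \<Longrightarrow> \<exists>x. T x \<and> y < x"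
    using definable_lub[OF dT \<open>T (- K - 1)\<close> Tle] by blast
  have "\<exists>b>a. \<forall>x. a < x \<and> x < b \<longrightarrow> \<bar>g x - L\<bar> < \<epsilon>" if eps: "\<epsilon> > 0" for \<epsilon>
  proof -
    obtain y where "T y" "L - \<epsilon> < y" using L(2)[of "L - \<epsilon>"] eps by auto
    then obtain b1 where b1: "b1 > a" "\<And>x. a < x \<Longrightarrow> x < b1 \<Longrightarrow> L - \<epsilon> < g x"
      unfolding T_def by (meson less_trans)
    have "\<not> T (L + \<epsilon> / 2)" using L(1)[of "L + \<epsilon> / 2"] eps by auto
    moreover have "dpred M (\<lambda>e. L + \<epsilon> / 2 < g (e 0))"
      by (intro dpred_intros dterm_fun1[OF g])
    ultimately obtain b2 where b2: "b2 > a" "\<forall>x. a < x \<and> x < b2 \<longrightarrow> \<not> L + \<epsilon> / 2 < g x"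
      using right_germ[of "\<lambda>x. L + \<epsilon> / 2 < g x" a] unfolding T_def by metis
    have "\<bar>g x - L\<bar> < \<epsilon>" if x: "a < x" "x < min b1 b2" for x
    proof -
      have "L - \<epsilon> < g x" using b1 x by auto
      moreover have "g x \<le> L + \<epsilon> / 2" using b2 x by (meson min_less_iff_conj not_le)
      moreover have "\<epsilon> / 2 < \<epsilon>" using \<open>\<epsilon> > 0\<close> by simp
      ultimately show ?thesis unfolding abs_less_iff by linarith
    qed
    then show ?thesis using b1(1) b2(1) by (intro exI[of _ "min b1 b2"]) auto
  qed
  then show ?thesis using that by blast
qed

text \<open>Infinitely many upward jumps would give an interval on which all jumps exceed one
  constant \<open>c\<close>. Close to the right of a point of that interval all values lie within
  \<open>c / 2\<close> of the right limit, which leaves no room for a jump by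
  \<open>c\<close>.\<close>

lemma finite_right_jumps_up:
  assumes g: "dterm M (\<lambda>e. g (e 0))" and bd: "\<And>x. \<bar>g x\<bar> \<le> K"
  shows "finite {x. \<exists>c>0. \<exists>b>x. \<forall>x'. x < x' \<and> x' < b \<longrightarrow> g x + c < g x'}"
proof (rule ccontr)
  define R where "R = (\<lambda>x c. \<exists>b>x. \<forall>x'. x < x' \<and> x' < b \<longrightarrow> g x + c < g x')"
  have dR: "dpred M (\<lambda>e. R (f e) (h e))" if "dterm M f" "dterm M h" for f h
    by (rule dpred_app2[of M R, OF _ that], unfold R_def, intro dpred_intros dterm_fun1[OF g])
  have mono: "R x c \<Longrightarrow> 0 < c' \<Longrightarrow> c' \<le> c \<Longrightarrow> R x c'" for x c c'
    unfolding R_def by (meson add_le_cancel_left le_less_trans)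
  have R_ex: "dpred M (\<lambda>e. \<exists>c>0. R (e 0) c)" by (intro dpred_intros dR)
  assume "\<not> ?thesis"
  then have "infinite {x. \<exists>c>0. R x c}" unfolding R_def by simp
  then obtain p q where pq: "p < q" "\<And>x. p < x \<Longrightarrow> x < q \<Longrightarrow> \<exists>c>0. R x c"
    using infinite_interval[of "\<lambda>x. \<exists>c>0. R x c"] by (metis (no_types, lifting) R_ex)
  obtain c p' q' where c: "c > 0" "p' < q'" "\<And>x. p' < x \<Longrightarrow> x < q' \<Longrightarrow> R x c"
    by (rule uniform_on_subinterval[of R p q, OF dR[OF dterm_var dterm_var] _ pq]) (blast intro: mono)+
  obtain x where x: "p' < x" "x < q'" using dense c(2) by blast
  obtain L where "\<And>\<epsilon>. \<epsilon> > 0 \<Longrightarrow> \<exists>b>x. \<forall>x'. x < x' \<and> x' < b \<longrightarrow> \<bar>g x' - L\<bar> < \<epsilon>"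
    using right_limit[OF g bd, of x] by blast
  then obtain b where b: "b > x" "\<And>x'. x < x' \<Longrightarrow> x' < b \<Longrightarrow> \<bar>g x' - L\<bar> < c / 2"
    using c(1) half_gt_zero by blast
  obtain y where y: "x < y" "y < min b q'" using dense[of x "min b q'"] b(1) x by auto
  then obtain b' where b': "b' > y" "\<And>z. y < z \<Longrightarrow> z < b' \<Longrightarrow> g y + c < g z"
    using c(3)[of y] x unfolding R_def by auto
  obtain z where z: "y < z" "z < min b b'" using dense[of y "min b b'"] b' y by auto
  have "g y + c < g z" using b'(2) z by auto
  moreover have "\<bar>g y - L\<bar> < c / 2" "\<bar>g z - L\<bar> < c / 2" using b(2) y z by auto
  ultimately show False unfolding abs_less_iff by linarith
qed

lemma finite_right_discontinuities:
  assumes g: "dterm M (\<lambda>e. g (e 0))" and bd: "\<And>x. \<bar>g x\<bar> \<le> K"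
  shows "finite {x. \<not> (\<forall>\<epsilon>>0. \<exists>b>x. \<forall>x'. x < x' \<and> x' < b \<longrightarrow> \<bar>g x' - g x\<bar> < \<epsilon>)}"
proof -
  \<comment> \<open>Downward jumps of \<open>g\<close> are upward jumps of \<open>- g\<close>;
    outside both sets the right limit can only be the value itself.\<close>
  define U where "U = (\<lambda>g :: 'a \<Rightarrow> 'a. {x. \<exists>c>0. \<exists>b>x. \<forall>x'. x < x' \<and> x' < b \<longrightarrow> g x + c < g x'})"
  have "finite (U g)" unfolding U_def by (rule finite_right_jumps_up[OF g bd])
  moreover have "finite (U (\<lambda>x. - g x))"
    unfolding U_def by (rule finite_right_jumps_up[of _ K]) (use bd in \<open>auto intro!: dterm_uminus g\<close>)
  moreover have "\<forall>\<epsilon>>0. \<exists>b>x. \<forall>x'. x < x' \<and> x' < b \<longrightarrow> \<bar>g x' - g x\<bar> < \<epsilon>"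
    if x: "x \<notin> U g" "x \<notin> U (\<lambda>x. - g x)" for x
  proof -
    obtain L where L: "\<And>\<epsilon>. \<epsilon> > 0 \<Longrightarrow> \<exists>b>x. \<forall>x'. x < x' \<and> x' < b \<longrightarrow> \<bar>g x' - L\<bar> < \<epsilon>"
      using right_limit[OF g bd, of x] by blast
    have "\<not> L > g x"
    proof
      assume "L > g x"
      then have pos: "(L - g x) / 2 > 0" by simp
      then obtain b where b: "b > x" "\<forall>x'. x < x' \<and> x' < b \<longrightarrow> \<bar>g x' - L\<bar> < (L - g x) / 2"
        using L by blast
      have "g x + (L - g x) / 2 < g x'" if "x < x'" "x' < b" for x'
      proof -
        have "\<bar>g x' - L\<bar> < (L - g x) / 2" using b(2) that by blast
        then show ?thesis unfolding abs_less_iff by (auto simp: field_simps)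
      qed
      then show False using x(1) b(1) pos unfolding U_def by blast
    qed
    moreover have "\<not> L < g x"
    proof
      assume "L < g x"
      then have pos: "(g x - L) / 2 > 0" by simp
      then obtain b where b: "b > x" "\<forall>x'. x < x' \<and> x' < b \<longrightarrow> \<bar>g x' - L\<bar> < (g x - L) / 2"
        using L by blast
      have "- g x + (g x - L) / 2 < - g x'" if "x < x'" "x' < b" for x'
      proof -
        have "\<bar>g x' - L\<bar> < (g x - L) / 2" using b(2) that by blast
        then show ?thesis unfolding abs_less_iff by (auto simp: field_simps)
      qed
      then show False using x(2) b(1) pos unfolding U_def by blast
    qed
    ultimately have "L = g x" by simp
    then show ?thesis using L by blast
  qed
  then have "{x. \<not> (\<forall>\<epsilon>>0. \<exists>b>x. \<forall>x'. x < x' \<and> x' < b \<longrightarrow> \<bar>g x' - g x\<bar> < \<epsilon>)}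
      \<subseteq> U g \<union> U (\<lambda>x. - g x)" by blast
  ultimately show ?thesis by (meson finite_UnI finite_subset)
qed

text \<open>Left limits are right limits of the reflected function. This is all the one-variable
  regularity that the finiteness argument uses, in place of piecewise monotonicity.\<close>

lemma finite_discontinuities:
  assumes g: "dterm M (\<lambda>e. g (e 0))" and bd: "\<And>x. \<bar>g x\<bar> \<le> K"
  shows "finite {x. \<not> (\<forall>\<epsilon>>0. \<exists>\<delta>>0. \<forall>x'. \<bar>x' - x\<bar> < \<delta> \<longrightarrow> \<bar>g x' - g x\<bar> < \<epsilon>)}"
proof -
  define D where "D = (\<lambda>g :: 'a \<Rightarrow> 'a. {x. \<not> (\<forall>\<epsilon>>0. \<exists>b>x. \<forall>x'. x < x' \<and> x' < b \<longrightarrow> \<bar>g x' - g x\<bar> < \<epsilon>)})"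
  have "finite (D g)" unfolding D_def by (rule finite_right_discontinuities[OF g bd])
  moreover have "finite (D (\<lambda>x. g (- x)))"
    unfolding D_def by (rule finite_right_discontinuities[of _ K])
      (use bd in \<open>auto intro!: dterm_fun1[OF g] dterm_uminus dterm_var\<close>)
  moreover have "\<exists>\<delta>>0. \<forall>x'. \<bar>x' - x\<bar> < \<delta> \<longrightarrow> \<bar>g x' - g x\<bar> < \<epsilon>"
    if x: "x \<notin> D g" "- x \<notin> D (\<lambda>x. g (- x))" and "\<epsilon> > 0" for x \<epsilon>
  proof -
    obtain b where b: "b > x" "\<And>x'. x < x' \<Longrightarrow> x' < b \<Longrightarrow> \<bar>g x' - g x\<bar> < \<epsilon>"
      using x(1) \<open>\<epsilon> > 0\<close> unfolding D_def by blast
    obtain b' where b': "b' > - x" "\<And>x'. - x < x' \<Longrightarrow> x' < b' \<Longrightarrow> \<bar>g (- x') - g (- (- x))\<bar> < \<epsilon>"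
      using x(2) \<open>\<epsilon> > 0\<close> unfolding D_def by blast
    have "\<bar>g x' - g x\<bar> < \<epsilon>" if x': "\<bar>x' - x\<bar> < min (b - x) (b' + x)" for x'
    proof -
      consider "x' = x" | "x < x'" | "x' < x" by fastforce
      then show ?thesis
      proof cases
        case 3
        then show ?thesis using b'(2)[of "- x'"] x' by (auto simp: abs_if split: if_splits)
      qed (use b x' \<open>\<epsilon> > 0\<close> in \<open>auto simp: abs_if split: if_splits\<close>)
    qed
    then show ?thesis using b(1) b'(1) by (intro exI[of _ "min (b - x) (b' + x)"]) auto
  qed
  then have "{x. \<not> (\<forall>\<epsilon>>0. \<exists>\<delta>>0. \<forall>x'. \<bar>x' - x\<bar> < \<delta> \<longrightarrow> \<bar>g x' - g x\<bar> < \<epsilon>)}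
      \<subseteq> D g \<union> uminus ` D (\<lambda>x. g (- x))"
    by (smt (verit) Collect_mono_iff UnI1 UnI2 image_eqI minus_minus mem_Collect_eq subsetI)
  ultimately show ?thesis by (meson finite_UnI finite_imageI finite_subset)
qed

end

section \<open>Uniform finiteness\<close>

lemma finite_uniform_positive:
  fixes P :: "'b \<Rightarrow> 'a::linordered_field \<Rightarrow> bool"
  assumes "finite F" "\<And>x. x \<in> F \<Longrightarrow> \<exists>s>0. P x s"
    and mono: "\<And>x s s'. P x s \<Longrightarrow> 0 < s' \<Longrightarrow> s' \<le> s \<Longrightarrow> P x s'"
  shows "\<exists>s>0. \<forall>x\<in>F. P x s"
  using assms(1,2)
proof (induction F)
  case empty
  then show ?case using zero_less_one by blast
next
  case (insert x F)
  then obtain s where s: "s > 0" "\<forall>x\<in>F. P x s" by blast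
  obtain s' where s': "s' > 0" "P x s'" using insert.prems by blast
  show ?case
    by (rule exI[of _ "min s s'"]) (use s s' mono in \<open>auto intro: mono\<close>)
qed

text \<open>Turns a bound on a cardinality into a recursion that a formula can express: quantify
  over an element and bound the number of elements below it.\<close>

lemma card_le_Suc_iff_initial:
  fixes S :: "'a::linorder set"
  assumes "finite S"
  shows "card S \<le> Suc k \<longleftrightarrow> (\<forall>b\<in>S. card {b' \<in> S. b' < b} \<le> k)"
proof
  assume le: "card S \<le> Suc k"
  show "\<forall>b\<in>S. card {b' \<in> S. b' < b} \<le> k"
  proof
    fix b assume b: "b \<in> S"
    have "{b' \<in> S. b' < b} \<subseteq> S - {b}" by auto
    then have "card {b' \<in> S. b' < b} \<le> card (S - {b})" using assms by (simp add: card_mono)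
    then show "card {b' \<in> S. b' < b} \<le> k" using le b assms by simp
  qed
next
  assume R: "\<forall>b\<in>S. card {b' \<in> S. b' < b} \<le> k"
  show "card S \<le> Suc k"
  proof (cases "S = {}")
    case False
    have "S \<subseteq> insert (Max S) {b' \<in> S. b' < Max S}"
      using assms Max_ge order_le_less by fastforce
    then have "card S \<le> card (insert (Max S) {b' \<in> S. b' < Max S})"
      using assms by (intro card_mono) auto
    also have "\<dots> \<le> Suc (card {b' \<in> S. b' < Max S})" using assms by (simp add: card_insert_if)
    also have "\<dots> \<le> Suc k" using R Max_in[OF assms False] by simp
    finally show ?thesis .
  qed simp
qed

lemma dpred_card_le:
  assumes "dpred M (\<lambda>e. B (\<lambda>i. e (Suc i)) (e 0))" "\<And>e. finite {b. B e b}"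
  shows "dpred M (\<lambda>e. card {b. B e b} \<le> k)"
  using assms
proof (induction k arbitrary: B)
  case 0
  have "dpred M (\<lambda>e. \<not> (\<exists>b. B e b))" by (intro dpred_not dpred_ex 0)
  moreover have "(\<not> (\<exists>b. B e b)) = (card {b. B e b} \<le> 0)" for e using 0(2)[of e] by auto
  ultimately show ?case by simp
next
  case (Suc k)
  have "dpred M (\<lambda>e. \<forall>b. B e b \<longrightarrow> card {b'. B e b' \<and> b' < b} \<le> k)"
  proof (intro dpred_all dpred_imp Suc.prems)
    have "dpred M (\<lambda>e. B (\<lambda>i. e (Suc (Suc i))) (e 0))"
      using dpred_rename[OF Suc.prems(1), of "case_nat 0 (\<lambda>i. Suc (Suc i))"] by simp
    then show "dpred M (\<lambda>e. card {b'. B (\<lambda>i. e (Suc i)) b' \<and> b' < e 0} \<le> k)"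
      by (intro Suc.IH dpred_intros) (simp_all add: Suc.prems(2))
  qed
  then show ?case
    by (rule dpred_cong) (use card_le_Suc_iff_initial[OF Suc.prems(2)] in simp)
qed

text \<open>The normal points of the o-minimal finiteness lemma: near \<open>(a, b)\<close> the set
  is empty, or each small window around \<open>b\<close> meets every nearby fibre exactly once.
  Demanding this for all window sizes below \<open>r\<close> encodes both uniqueness of the branch
  and its continuity at \<open>a\<close>.\<close>

definition normal_at :: "('a \<Rightarrow> 'a \<Rightarrow> bool) \<Rightarrow> 'a \<Rightarrow> 'a::linordered_field \<Rightarrow> bool" where
  "normal_at A a b \<longleftrightarrow>
    (if A a b
     then \<exists>r>0. \<forall>s. 0 < s \<and> s < r \<longrightarrow> (\<exists>t>0. \<forall>a'. \<bar>a' - a\<bar> < t \<longrightarrow>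
       (\<exists>b'. \<bar>b' - b\<bar> < s \<and> A a' b' \<and> (\<forall>b''. \<bar>b'' - b\<bar> < s \<and> A a' b'' \<longrightarrow> b'' = b')))
     else \<exists>s>0. \<exists>t>0. \<forall>a' b'. \<bar>a' - a\<bar> < t \<and> \<bar>b' - b\<bar> < s \<longrightarrow> \<not> A a' b')"

text \<open>Only ordinates in \<open>[-1, 1]\<close> are tested, because the fibres lie there; a
  bounded range is also what gives a lowest non-normal ordinate.\<close>

definition bad_at :: "('a \<Rightarrow> 'a \<Rightarrow> bool) \<Rightarrow> 'a::linordered_field \<Rightarrow> bool" where
  "bad_at A a \<longleftrightarrow> (\<exists>b. \<bar>b\<bar> \<le> 1 \<and> \<not> normal_at A a b)"

text \<open>Makes the non-normal ordinates a closed set, so that a lowest one is attained. For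
  \<open>b'\<close> at distance \<open>d\<close> from a point \<open>b\<close> of the fibre, the
  unique point of a window of radius above \<open>d\<close> already lies in the window of radius
  \<open>d / 2\<close>, so nearby fibres have no point near \<open>b'\<close>.\<close>

lemma normal_at_open:
  assumes "normal_at A a b"
  shows "\<exists>s>0. \<forall>b'. \<bar>b' - b\<bar> < s \<longrightarrow> normal_at A a b'"
proof (cases "A a b")
  case True
  then obtain r where r: "r > 0" "\<And>s. 0 < s \<Longrightarrow> s < r \<Longrightarrow> (\<exists>t>0. \<forall>a'. \<bar>a' - a\<bar> < t \<longrightarrow>
      (\<exists>b'. \<bar>b' - b\<bar> < s \<and> A a' b' \<and> (\<forall>b''. \<bar>b'' - b\<bar> < s \<and> A a' b'' \<longrightarrow> b'' = b')))"
    using assms unfolding normal_at_def by auto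
  have "normal_at A a b'" if b': "\<bar>b' - b\<bar> < r" for b'
  proof (cases "b' = b")
    case False
    define d where "d = \<bar>b' - b\<bar>"
    have d: "0 < d" "d < r" using False b' unfolding d_def by auto
    obtain s where s: "d < s" "s < r" using dense d by blast
    obtain t where t: "t > 0" "\<And>a'. \<bar>a' - a\<bar> < t \<Longrightarrow>
      (\<exists>b'. \<bar>b' - b\<bar> < s \<and> A a' b' \<and> (\<forall>b''. \<bar>b'' - b\<bar> < s \<and> A a' b'' \<longrightarrow> b'' = b'))"
      using r(2)[of s] s d by auto
    obtain t0 where t0: "t0 > 0" "\<And>a'. \<bar>a' - a\<bar> < t0 \<Longrightarrow>
      (\<exists>b'. \<bar>b' - b\<bar> < d / 2 \<and> A a' b' \<and> (\<forall>b''. \<bar>b'' - b\<bar> < d / 2 \<and> A a' b'' \<longrightarrow> b'' = b'))"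
      using r(2)[of "d / 2"] d by (auto simp: field_simps)
    have none: "\<not> A a' b''" if a': "\<bar>a' - a\<bar> < min t t0" and b'': "\<bar>b'' - b'\<bar> < min (d / 2) (s - d)" for a' b''
    proof
      assume A: "A a' b''"
      have "\<bar>a' - a\<bar> < t" "\<bar>a' - a\<bar> < t0" using a' by auto
      then obtain u v where u: "\<And>b''. \<bar>b'' - b\<bar> < s \<Longrightarrow> A a' b'' \<Longrightarrow> b'' = u"
        and v: "\<bar>v - b\<bar> < d / 2" "A a' v" using t(2)[of a'] t0(2)[of a'] by metis
      have "v = u" using u[of v] v s d by (auto simp: field_simps)
      have "\<bar>b'' - b\<bar> \<le> \<bar>b'' - b'\<bar> + d" unfolding d_def by (auto simp: abs_if)
      then have "b'' = u" using u[of b''] A b'' by auto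
      then have "\<bar>b'' - b\<bar> < d / 2" using v \<open>v = u\<close> by simp
      moreover have "d \<le> \<bar>b'' - b'\<bar> + \<bar>b'' - b\<bar>" unfolding d_def by (auto simp: abs_if)
      ultimately show False using b'' by auto
    qed
    have "\<not> A a b'" using none[of a b'] t(1) t0(1) d s by auto
    moreover have "0 < min (d / 2) (s - d)" "0 < min t t0" using t(1) t0(1) d s by auto
    ultimately show ?thesis unfolding normal_at_def using none by metis
  qed (use assms in simp)
  then show ?thesis using r(1) by blast
next
  case False
  then obtain s t where st: "s > 0" "t > 0" "\<And>a' b'. \<bar>a' - a\<bar> < t \<Longrightarrow> \<bar>b' - b\<bar> < s \<Longrightarrow> \<not> A a' b'"
    using assms unfolding normal_at_def by auto
  have "normal_at A a b'" if b': "\<bar>b' - b\<bar> < s" for b'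
  proof -
    have "\<not> A a' b''" if "\<bar>a' - a\<bar> < t" "\<bar>b'' - b'\<bar> < s - \<bar>b' - b\<bar>" for a' b''
      by (rule st(3)) (use that in \<open>auto simp: abs_if split: if_splits\<close>)
    moreover have "\<not> A a b'" using st b' by auto
    moreover have "0 < s - \<bar>b' - b\<bar>" using b' by simp
    ultimately show ?thesis unfolding normal_at_def using st(2) by metis
  qed
  then show ?thesis using st(1) by blast
qed

lemma dterm_graph:
  assumes "dpred M (\<lambda>e. G (e 0) (e 1))" "\<And>a b. g a = b \<longleftrightarrow> G a b"
  shows "dterm M (\<lambda>e. g (e 0))"
  unfolding dterm_def using dpred_app2[OF assms(1) dterm_var dterm_var, of "Suc 0" 0]
  by (simp add: assms(2))

section \<open>Bad parameters and local constancy of the fibre cardinality\<close>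

context o_minimal_expansion
begin

lemma definable_glb:
  assumes "dpred M (\<lambda>e. S (e 0))" "S x0" "\<And>x. S x \<Longrightarrow> K \<le> x"
  obtains s where "\<And>x. S x \<Longrightarrow> s \<le> x" "\<And>y. s < y \<Longrightarrow> \<exists>x. S x \<and> x < y"
proof -
  have "dpred M (\<lambda>e. S (- e 0))" by (rule dpred_app1[OF assms(1)]) (intro dpred_intros)
  moreover have "S (- (- x0))" using assms(2) by simp
  moreover have "x \<le> - K" if "S (- x)" for x using assms(3)[OF that] by (simp add: le_minus_iff)
  ultimately obtain s where s: "\<And>x. S (- x) \<Longrightarrow> x \<le> s" "\<And>y. y < s \<Longrightarrow> \<exists>x. S (- x) \<and> y < x"
    by (rule definable_lub[of "\<lambda>x. S (- x)" "- x0" "- K"]) auto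
  show ?thesis
  proof (rule that[of "- s"])
    show "- s \<le> x" if "S x" for x using s(1)[of "- x"] that by (simp add: minus_le_iff)
    show "\<exists>x. S x \<and> x < y" if y: "- s < y" for y
    proof -
      obtain x where "S (- x)" "- y < x" using s(2)[of "- y"] y by (auto simp: minus_less_iff)
      then show ?thesis by (intro exI[of _ "- x"]) (auto simp: minus_less_iff)
    qed
  qed
qed

text \<open>Stands in for compactness of the interval: that some \<open>t\<close> works from
  \<open>p\<close> up to \<open>y\<close> is a locally constant property of \<open>y\<close>, since
  by monotonicity the smaller of two values of \<open>t\<close> serves both parts.\<close>

lemma interval_uniform:
  assumes Q: "dpred M (\<lambda>e. Q (e 0) (e 1))"
    and mono: "\<And>t t' b. Q t b \<Longrightarrow> 0 < t' \<Longrightarrow> t' \<le> t \<Longrightarrow> Q t' b"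
    and "p \<le> q"
    and loc: "\<And>y. p \<le> y \<Longrightarrow> y \<le> q \<Longrightarrow>
      \<exists>s>0. \<exists>t>0. \<forall>b. p \<le> b \<and> b \<le> q \<and> \<bar>b - y\<bar> < s \<longrightarrow> Q t b"
  shows "\<exists>t>0. \<forall>b. p \<le> b \<and> b \<le> q \<longrightarrow> Q t b"
proof (rule interval_connected[of "\<lambda>y. \<exists>t>0. \<forall>b. p \<le> b \<and> b \<le> y \<longrightarrow> Q t b" p q])
  show "dpred M (\<lambda>e. \<exists>t>0. \<forall>b. p \<le> b \<and> b \<le> e 0 \<longrightarrow> Q t b)"
    by (intro dpred_intros dpred_app2[OF Q])
  obtain s t where "s > 0" "t > 0" "\<forall>b. p \<le> b \<and> b \<le> q \<and> \<bar>b - p\<bar> < s \<longrightarrow> Q t b"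
    using loc[of p] assms(3) by auto
  then show "\<exists>t>0. \<forall>b. p \<le> b \<and> b \<le> p \<longrightarrow> Q t b"
    using assms(3) by (intro exI[of _ t]) auto
  show "\<exists>s>0. \<forall>y' y''. p \<le> y' \<and> y' \<le> q \<and> \<bar>y' - y\<bar> < s \<and> p \<le> y'' \<and> y'' \<le> q \<and> \<bar>y'' - y\<bar> < s \<longrightarrow>
      (\<exists>t>0. \<forall>b. p \<le> b \<and> b \<le> y' \<longrightarrow> Q t b) \<longrightarrow> (\<exists>t>0. \<forall>b. p \<le> b \<and> b \<le> y'' \<longrightarrow> Q t b)"
    if y: "p \<le> y" "y \<le> q" for y
  proof -
    obtain s t where st: "s > 0" "t > 0" "\<And>b. p \<le> b \<Longrightarrow> b \<le> q \<Longrightarrow> \<bar>b - y\<bar> < s \<Longrightarrow> Q t b"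
      using loc[OF y] by blast
    have "\<exists>t>0. \<forall>b. p \<le> b \<and> b \<le> y'' \<longrightarrow> Q t b"
      if yy: "\<bar>y' - y\<bar> < s" "y'' \<le> q" "\<bar>y'' - y\<bar> < s" and t': "t' > 0" "\<forall>b. p \<le> b \<and> b \<le> y' \<longrightarrow> Q t' b"
      for y' y'' t'
    proof -
      have "Q (min t t') b" if b: "p \<le> b" "b \<le> y''" for b
      proof (cases "b \<le> y'")
        case True
        then have "Q t' b" using t' b by blast
        then show ?thesis using mono st(2) t'(1) by simp
      next
        case False
        have "Q t b" by (rule st(3)) (use False b yy in \<open>auto simp: abs_if split: if_splits\<close>)
        then show ?thesis using mono st(2) t'(1) by simp
      qed
      then show ?thesis using st(2) t'(1) by (intro exI[of _ "min t t'"]) auto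
    qed
    then show ?thesis using st(1) by blast
  qed
qed (use assms in auto)

text \<open>
  Otherwise some interval consists of bad points. Near a common continuity point of the lowest
  non-normal ordinate and of its two neighbours in the fibre, that ordinate is normal.
\<close>

lemma finite_bad:
  assumes A: "dpred M (\<lambda>e. A (e 0) (e 1))" and fin: "\<And>a. finite {b. A a b}"
    and bd: "\<And>a b. A a b \<Longrightarrow> \<bar>b\<bar> \<le> 1"
  shows "finite {a. bad_at A a}"
proof (rule ccontr)
  assume inf: "infinite {a. bad_at A a}"
  have dN: "dpred M (\<lambda>e. normal_at A (f e) (g e))" if "dterm M f" "dterm M g" for f g
  proof (rule dpred_app2[OF _ that])
    show "dpred M (\<lambda>e. normal_at A (e 0) (e 1))"
      unfolding normal_at_def by (intro dpred_if dpred_intros dpred_app2[OF A])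
  qed
  have dB: "dpred M (\<lambda>e. bad_at A (f e))" if "dterm M f" for f
    by (rule dpred_app1[OF _ that]) (unfold bad_at_def, intro dpred_intros dN)
  define least where "least = (\<lambda>a b. \<bar>b\<bar> \<le> 1 \<and> \<not> normal_at A a b \<and>
    (\<forall>b'. \<bar>b'\<bar> \<le> 1 \<and> \<not> normal_at A a b' \<longrightarrow> b \<le> b'))"
  have least_ex: "\<exists>b. least a b" if bad: "bad_at A a" for a
  proof -
    define S where "S = (\<lambda>b. \<bar>b\<bar> \<le> 1 \<and> \<not> normal_at A a b)"
    obtain x0 where "S x0" using bad unfolding bad_at_def S_def by blast
    moreover have "dpred M (\<lambda>e. S (e 0))" unfolding S_def by (intro dpred_intros dN)
    ultimately obtain s where s: "\<And>x. S x \<Longrightarrow> s \<le> x" "\<And>y. s < y \<Longrightarrow> \<exists>x. S x \<and> x < y"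
      using definable_glb[of S x0 "-1"] unfolding S_def by (auto simp: abs_le_iff)
    have "-1 \<le> s" using s(2)[of "-1"] unfolding S_def by (force simp: abs_le_iff)
    moreover have "s \<le> 1" using s(1)[OF \<open>S x0\<close>] \<open>S x0\<close> unfolding S_def by (auto simp: abs_le_iff)
    moreover have "\<not> normal_at A a s"
    proof
      assume "normal_at A a s"
      then obtain d where d: "d > 0" "\<And>b'. \<bar>b' - s\<bar> < d \<Longrightarrow> normal_at A a b'"
        using normal_at_open by blast
      obtain x where "S x" "x < s + d" using s(2)[of "s + d"] d(1) by auto
      then show False using d(2)[of x] s(1)[of x] unfolding S_def by auto
    qed
    ultimately show ?thesis
      unfolding least_def using s(1) unfolding S_def by (intro exI[of _ s]) (auto simp: abs_le_iff)
  qed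
  have least_unique: "least a b \<Longrightarrow> least a b' \<Longrightarrow> b = b'" for a b b'
    unfolding least_def by (meson order.antisym)
  define \<beta> where "\<beta> = (\<lambda>a. if bad_at A a then SOME b. least a b else 0)"
  have \<beta>: "least a (\<beta> a)" if "bad_at A a" for a
    unfolding \<beta>_def using someI_ex[OF least_ex[OF that]] that by simp
  have d\<beta>: "dterm M (\<lambda>e. \<beta> (e 0))"
  proof (rule dterm_graph)
    show "dpred M (\<lambda>e. if bad_at A (e 0) then least (e 0) (e 1) else e 1 = 0)"
      unfolding least_def by (intro dpred_if dpred_intros dN dB)
    show "\<beta> a = b \<longleftrightarrow> (if bad_at A a then least a b else b = 0)" for a b
      using \<beta>[of a] least_unique[of a "\<beta> a" b] by (auto simp: \<beta>_def)
  qed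
  have \<beta>_bd: "\<bar>\<beta> a\<bar> \<le> 1" for a
    using \<beta>[of a] unfolding least_def by (cases "bad_at A a") (auto simp: \<beta>_def)
  \<comment> \<open>If there is no neighbour above or below, the default values 2 and -2 lie outside
    \<open>[-1, 1]\<close>; thus both neighbours are total bounded functions and keep a positive
    distance from \<open>\<beta>\<close>.\<close>
  define up where "up = (\<lambda>a. if \<exists>b. A a b \<and> \<beta> a < b then Min {b. A a b \<and> \<beta> a < b} else 2)"
  define lo where "lo = (\<lambda>a. if \<exists>b. A a b \<and> b < \<beta> a then Max {b. A a b \<and> b < \<beta> a} else - 2)"
  have finU: "finite {b. A a b \<and> \<beta> a < b}" and finL: "finite {b. A a b \<and> b < \<beta> a}" for a
    using fin[of a] by (auto intro: rev_finite_subset)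
  have up_iff: "up a = b \<longleftrightarrow> (if \<exists>b. A a b \<and> \<beta> a < b
      then A a b \<and> \<beta> a < b \<and> (\<forall>b'. A a b' \<and> \<beta> a < b' \<longrightarrow> b \<le> b') else b = 2)" for a b
    unfolding up_def using Min_eq_iff[OF finU, of a b] by auto
  have lo_iff: "lo a = b \<longleftrightarrow> (if \<exists>b. A a b \<and> b < \<beta> a
      then A a b \<and> b < \<beta> a \<and> (\<forall>b'. A a b' \<and> b' < \<beta> a \<longrightarrow> b' \<le> b) else b = - 2)" for a b
    unfolding lo_def using Max_eq_iff[OF finL, of a b] by auto
  have dup: "dterm M (\<lambda>e. up (e 0))"
    by (rule dterm_graph[OF _ up_iff]) (intro dpred_if dpred_intros dpred_app2[OF A] dterm_fun1[OF d\<beta>])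
  have dlo: "dterm M (\<lambda>e. lo (e 0))"
    by (rule dterm_graph[OF _ lo_iff]) (intro dpred_if dpred_intros dpred_app2[OF A] dterm_fun1[OF d\<beta>])
  have up: "\<beta> a < up a" "\<bar>up a\<bar> \<le> 2" "\<And>b. A a b \<Longrightarrow> \<beta> a < b \<Longrightarrow> up a \<le> b" for a
    using up_iff[of a "up a"] \<beta>_bd[of a] bd[of a "up a"] by (auto simp: abs_le_iff split: if_splits)
  have lo: "lo a < \<beta> a" "\<bar>lo a\<bar> \<le> 2" "\<And>b. A a b \<Longrightarrow> b < \<beta> a \<Longrightarrow> b \<le> lo a" for a
    using lo_iff[of a "lo a"] \<beta>_bd[of a] bd[of a "lo a"] by (auto simp: abs_le_iff split: if_splits)
  obtain p q where pq: "p < q" "\<And>x. p < x \<Longrightarrow> x < q \<Longrightarrow> bad_at A x"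
    using infinite_interval[of "bad_at A", OF dB[OF dterm_var] inf] by blast
  \<comment> \<open>After shrinking, the lowest non-normal ordinate either belongs to the fibre
    throughout the interval or never does; \<open>v\<close> records which.\<close>
  obtain v p' q' where v: "p' < q'" "\<And>x. p' < x \<Longrightarrow> x < q' \<Longrightarrow> bad_at A x \<and> A x (\<beta> x) = v"
  proof -
    have "{p<..<q} \<subseteq> {x. bad_at A x \<and> A x (\<beta> x) = True} \<union> {x. bad_at A x \<and> A x (\<beta> x) = False}"
      using pq(2) by auto
    then have "infinite ({x. bad_at A x \<and> A x (\<beta> x) = True} \<union> {x. bad_at A x \<and> A x (\<beta> x) = False})"
      using infinite_Ioo[OF pq(1)] finite_subset by blast
    then obtain v where inf: "infinite {x. bad_at A x \<and> A x (\<beta> x) = v}" by blast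
    have "dpred M (\<lambda>e. bad_at A (e 0) \<and> A (e 0) (\<beta> (e 0)) = v)"
      by (intro dpred_intros dB dpred_app2[OF A] dterm_fun1[OF d\<beta>])
    then obtain p' q' where "p' < q'" "\<And>x. p' < x \<Longrightarrow> x < q' \<Longrightarrow> bad_at A x \<and> A x (\<beta> x) = v"
      by (rule infinite_interval[OF _ inf]) (rule that)
    then show ?thesis by (rule that)
  qed
  define D where "D = (\<lambda>g :: 'a \<Rightarrow> 'a. {x. \<not> (\<forall>\<epsilon>>0. \<exists>\<delta>>0. \<forall>x'. \<bar>x' - x\<bar> < \<delta> \<longrightarrow> \<bar>g x' - g x\<bar> < \<epsilon>)})"
  have "finite (D \<beta>)" "finite (D up)" "finite (D lo)"
    unfolding D_def
    by (rule finite_discontinuities[OF d\<beta> \<beta>_bd] finite_discontinuities[OF dup up(2)]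
        finite_discontinuities[OF dlo lo(2)])+
  then have "finite (D \<beta> \<union> D up \<union> D lo)" by simp
  then obtain a where a: "a \<in> {p'<..<q'}" "a \<notin> D \<beta> \<union> D up \<union> D lo"
    using infinite_Ioo[OF v(1)] by (meson finite_subset subsetI)
  have cont: "\<exists>\<delta>>0. \<forall>x'. \<bar>x' - a\<bar> < \<delta> \<longrightarrow> \<bar>g x' - g a\<bar> < \<epsilon>" if "\<epsilon> > 0" "g \<in> {\<beta>, up, lo}" for g \<epsilon>
    using a(2) that unfolding D_def by auto
  \<comment> \<open>Half of the smaller gap: when \<open>up\<close> and \<open>lo\<close> move by
    less than \<open>d\<close>, they stay outside the window of radius \<open>d\<close> around
    \<open>\<beta> a\<close>, so \<open>\<beta> x\<close> is the only point that the fibre over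
    \<open>x\<close> can have there.\<close>
  define d where "d = min (up a - \<beta> a) (\<beta> a - lo a) / 2"
  have d: "d > 0" unfolding d_def using up(1)[of a] lo(1)[of a] by simp
  have d2: "\<beta> a + d + d \<le> up a" "lo a \<le> \<beta> a - d - d" unfolding d_def by (auto simp: min_def field_simps)
  obtain t1 where t1: "t1 > 0" "\<And>x'. \<bar>x' - a\<bar> < t1 \<Longrightarrow> \<bar>up x' - up a\<bar> < d"
    using cont[OF d, of up] by auto
  obtain t2 where t2: "t2 > 0" "\<And>x'. \<bar>x' - a\<bar> < t2 \<Longrightarrow> \<bar>lo x' - lo a\<bar> < d"
    using cont[OF d, of lo] by auto
  define t where "t = min (min t1 t2) (min (a - p') (q' - a))"
  have t: "t > 0" unfolding t_def using t1 t2 a by auto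
  have only: "b = \<beta> x" if "\<bar>x - a\<bar> < t" "\<bar>b - \<beta> a\<bar> < d" "A x b" for x b
  proof (rule ccontr)
    assume "b \<noteq> \<beta> x"
    then have "b < \<beta> x \<or> \<beta> x < b" by auto
    moreover have "\<bar>up x - up a\<bar> < d" "\<bar>lo x - lo a\<bar> < d" using t1(2) t2(2) that(1) unfolding t_def by auto
    ultimately show False
      using up(3)[OF that(3)] lo(3)[OF that(3)] d2 that(2) by (auto simp: abs_less_iff)
  qed
  have pq': "p' < x \<and> x < q'" if "\<bar>x - a\<bar> < t" for x
    using that unfolding t_def by (auto simp: abs_if split: if_splits)
  have "normal_at A a (\<beta> a)"
  proof (cases v)
    case True
    have "\<exists>t>0. \<forall>a'. \<bar>a' - a\<bar> < t \<longrightarrow>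
       (\<exists>b'. \<bar>b' - \<beta> a\<bar> < s \<and> A a' b' \<and> (\<forall>b''. \<bar>b'' - \<beta> a\<bar> < s \<and> A a' b'' \<longrightarrow> b'' = b'))"
      if s: "0 < s" "s < d" for s
    proof -
      obtain t3 where t3: "t3 > 0" "\<And>x'. \<bar>x' - a\<bar> < t3 \<Longrightarrow> \<bar>\<beta> x' - \<beta> a\<bar> < s"
        using cont[OF s(1), of \<beta>] by auto
      have "\<exists>b'. \<bar>b' - \<beta> a\<bar> < s \<and> A a' b' \<and> (\<forall>b''. \<bar>b'' - \<beta> a\<bar> < s \<and> A a' b'' \<longrightarrow> b'' = b')"
        if "\<bar>a' - a\<bar> < min t t3" for a'
        using that t3(2)[of a'] v(2)[of a'] pq'[of a'] only[of a'] s True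
        by (intro exI[of _ "\<beta> a'"]) auto
      then show ?thesis using t t3(1) by (intro exI[of _ "min t t3"]) auto
    qed
    moreover have "A a (\<beta> a)" using v(2)[of a] True a(1) by auto
    ultimately show ?thesis unfolding normal_at_def using d by auto
  next
    case False
    have "\<not> A a' b'" if "\<bar>a' - a\<bar> < t" "\<bar>b' - \<beta> a\<bar> < d" for a' b'
      using only[OF that] v(2)[of a'] pq'[OF that(1)] False by auto
    moreover have "\<not> A a (\<beta> a)" using v(2)[of a] False a(1) by auto
    ultimately show ?thesis unfolding normal_at_def using d t by auto
  qed
  moreover have "least a (\<beta> a)" using \<beta> v(2) a(1) by auto
  ultimately show False unfolding least_def by blast
qed

text \<open>Normality at the points of the fibre continues each of them to exactly one point of a
  nearby fibre; normality at the other ordinates, made uniform on \<open>[-1, 1]\<close>, excludes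
  further points.\<close>

lemma card_locally_constant:
  assumes A: "dpred M (\<lambda>e. A (e 0) (e 1))" and fin: "\<And>a. finite {b. A a b}"
    and bd: "\<And>a b. A a b \<Longrightarrow> \<bar>b\<bar> \<le> 1" and good: "\<not> bad_at A a"
  shows "\<exists>t>0. \<forall>a'. \<bar>a' - a\<bar> < t \<longrightarrow> card {b. A a' b} = card {b. A a b}"
proof -
  have norm: "normal_at A a b" if "\<bar>b\<bar> \<le> 1" for b using good that unfolding bad_at_def by blast
  define F where "F = {b. A a b}"
  have finF: "finite F" unfolding F_def by (rule fin)
  define uniq where "uniq = (\<lambda>b s t. \<forall>a'. \<bar>a' - a\<bar> < t \<longrightarrow>
       (\<exists>b'. \<bar>b' - b\<bar> < s \<and> A a' b' \<and> (\<forall>b''. \<bar>b'' - b\<bar> < s \<and> A a' b'' \<longrightarrow> b'' = b')))"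
  \<comment> \<open>Separation by \<open>2 * s\<close> makes the windows of radius \<open>s\<close>
    disjoint, so different points of the fibre continue to different points.\<close>
  have "\<exists>s>0. \<forall>b\<in>F. (\<forall>b'\<in>F. b \<noteq> b' \<longrightarrow> 2 * s \<le> \<bar>b - b'\<bar>) \<and> (\<forall>s'. 0 < s' \<and> s' \<le> s \<longrightarrow> (\<exists>t>0. uniq b s' t))"
  proof (rule finite_uniform_positive[OF finF])
    fix b assume b: "b \<in> F"
    have "\<exists>s>0. \<forall>b'\<in>F. b \<noteq> b' \<longrightarrow> 2 * s \<le> \<bar>b - b'\<bar>"
    proof (rule finite_uniform_positive[OF finF])
      show "\<exists>s>0. b \<noteq> b' \<longrightarrow> 2 * s \<le> \<bar>b - b'\<bar>" for b'
        by (rule exI[of _ "if b = b' then 1 else \<bar>b - b'\<bar> / 2"]) auto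
    qed auto
    then obtain s1 where s1: "s1 > 0" "\<forall>b'\<in>F. b \<noteq> b' \<longrightarrow> 2 * s1 \<le> \<bar>b - b'\<bar>" by blast
    have "A a b" using b unfolding F_def by simp
    then obtain r where r: "r > 0" "\<And>s. 0 < s \<Longrightarrow> s < r \<Longrightarrow> \<exists>t>0. uniq b s t"
      using norm[OF bd[OF \<open>A a b\<close>]] unfolding normal_at_def uniq_def by auto
    obtain s2 where s2: "0 < s2" "s2 < r" using dense r(1) by blast
    show "\<exists>s>0. (\<forall>b'\<in>F. b \<noteq> b' \<longrightarrow> 2 * s \<le> \<bar>b - b'\<bar>) \<and> (\<forall>s'. 0 < s' \<and> s' \<le> s \<longrightarrow> (\<exists>t>0. uniq b s' t))"
    proof (rule exI[of _ "min s1 s2"], intro conjI ballI impI allI)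
      show "2 * min s1 s2 \<le> \<bar>b - b'\<bar>" if "b' \<in> F" "b \<noteq> b'" for b'
      proof -
        have "2 * s1 \<le> \<bar>b - b'\<bar>" using s1 that by blast
        then show ?thesis by (auto simp: min_def)
      qed
      show "\<exists>t>0. uniq b s' t" if "0 < s' \<and> s' \<le> min s1 s2" for s'
        by (rule r(2)) (use that s2 in auto)
    qed (use s1(1) s2 in auto)
  next
    fix b s s' :: 'a
    assume "(\<forall>b'\<in>F. b \<noteq> b' \<longrightarrow> 2 * s \<le> \<bar>b - b'\<bar>) \<and> (\<forall>s'. 0 < s' \<and> s' \<le> s \<longrightarrow> (\<exists>t>0. uniq b s' t))"
      "0 < s'" "s' \<le> s"
    then show "(\<forall>b'\<in>F. b \<noteq> b' \<longrightarrow> 2 * s' \<le> \<bar>b - b'\<bar>) \<and> (\<forall>s''. 0 < s'' \<and> s'' \<le> s' \<longrightarrow> (\<exists>t>0. uniq b s'' t))"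
      by (meson mult_left_mono order_trans zero_le_numeral)
  qed
  then obtain s where s: "s > 0" "\<And>b b'. b \<in> F \<Longrightarrow> b' \<in> F \<Longrightarrow> b \<noteq> b' \<Longrightarrow> 2 * s \<le> \<bar>b - b'\<bar>"
    "\<And>b. b \<in> F \<Longrightarrow> \<exists>t>0. uniq b s t" by (metis order_refl)
  have "\<exists>t>0. \<forall>b\<in>F. uniq b s t"
    by (rule finite_uniform_positive[OF finF s(3)]) (auto simp: uniq_def)
  then obtain t1 where t1: "t1 > 0" "\<And>b. b \<in> F \<Longrightarrow> uniq b s t1" by blast
  \<comment> \<open>Every point of a nearby fibre is close to an old one. At a point of the fibre
    its own window suffices; at any other ordinate normality empties a whole box.\<close>
  define Q where "Q = (\<lambda>t b. \<forall>a'. \<bar>a' - a\<bar> < t \<and> A a' b \<longrightarrow> (\<exists>b'. A a b' \<and> \<bar>b - b'\<bar> < s))"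
  have "\<exists>t>0. \<forall>b. -1 \<le> b \<and> b \<le> 1 \<longrightarrow> Q t b"
  proof (rule interval_uniform)
    show "dpred M (\<lambda>e. Q (e 0) (e 1))"
      unfolding Q_def by (intro dpred_intros dpred_app2[OF A])
    fix y :: 'a assume y: "-1 \<le> y" "y \<le> 1"
    then have nm: "normal_at A a y" by (intro norm) (auto simp: abs_le_iff)
    show "\<exists>s>0. \<exists>t>0. \<forall>b. -1 \<le> b \<and> b \<le> 1 \<and> \<bar>b - y\<bar> < s \<longrightarrow> Q t b"
    proof (cases "A a y")
      case True
      then show ?thesis unfolding Q_def using s(1) zero_less_one by blast
    next
      case False
      then obtain s' t where "s' > 0" "t > 0" "\<And>a' b'. \<bar>a' - a\<bar> < t \<Longrightarrow> \<bar>b' - y\<bar> < s' \<Longrightarrow> \<not> A a' b'"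
        using nm unfolding normal_at_def by auto
      then show ?thesis unfolding Q_def by blast
    qed
  qed (auto simp: Q_def)
  then obtain t2 where t2: "t2 > 0" "\<And>b. \<bar>b\<bar> \<le> 1 \<Longrightarrow> Q t2 b" by (auto simp: abs_le_iff)
  have "card {b. A a' b} = card F" if a': "\<bar>a' - a\<bar> < min t1 t2" for a'
  proof -
    define u where "u = (\<lambda>b. SOME b'. \<bar>b' - b\<bar> < s \<and> A a' b')"
    have u: "\<bar>u b - b\<bar> < s" "A a' (u b)" "\<And>b''. \<bar>b'' - b\<bar> < s \<Longrightarrow> A a' b'' \<Longrightarrow> b'' = u b" if b: "b \<in> F" for b
    proof -
      have "\<bar>a' - a\<bar> < t1" using a' by simp
      from t1(2)[OF b, unfolded uniq_def, rule_format, OF this]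
      obtain b' where b': "\<bar>b' - b\<bar> < s \<and> A a' b'" "\<And>b''. \<bar>b'' - b\<bar> < s \<Longrightarrow> A a' b'' \<Longrightarrow> b'' = b'"
        by blast
      have "\<bar>u b - b\<bar> < s \<and> A a' (u b)" unfolding u_def by (rule someI[where x = b']) (rule b'(1))
      then show "\<bar>u b - b\<bar> < s" "A a' (u b)" "\<And>b''. \<bar>b'' - b\<bar> < s \<Longrightarrow> A a' b'' \<Longrightarrow> b'' = u b"
        using b' by blast+
    qed
    have "bij_betw u F {b. A a' b}"
    proof (rule bij_betw_imageI)
      show "inj_on u F"
      proof (rule inj_onI, rule ccontr)
        fix x y assume xy: "x \<in> F" "y \<in> F" "u x = u y" "x \<noteq> y"
        have "\<bar>u x - x\<bar> < s" "\<bar>u x - y\<bar> < s" using u(1)[OF xy(1)] u(1)[OF xy(2)] xy(3) by auto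
        then show False using s(2)[OF xy(1,2,4)] by (auto simp: abs_if split: if_splits)
      qed
      show "u ` F = {b. A a' b}"
      proof (intro equalityI subsetI)
        fix b assume "b \<in> {b. A a' b}"
        then have b: "A a' b" by simp
        then obtain b' where "b' \<in> F" "\<bar>b - b'\<bar> < s"
          using t2(2)[OF bd[OF b]] a' unfolding Q_def F_def by auto
        then show "b \<in> u ` F" using u(3) b by blast
      qed (use u(2) in auto)
    qed
    then show ?thesis by (metis bij_betw_same_card)
  qed
  then have "\<forall>a'. \<bar>a' - a\<bar> < min t1 t2 \<longrightarrow> card {b. A a' b} = card F" by blast
  moreover have "0 < min t1 t2" using t1(1) t2(1) by simp
  ultimately show ?thesis unfolding F_def by blast
qed

lemma card_constant_between:
  assumes A: "dpred M (\<lambda>e. A (e 0) (e 1))" and fin: "\<And>a. finite {b. A a b}"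
    and bd: "\<And>a b. A a b \<Longrightarrow> \<bar>b\<bar> \<le> 1" and "p \<le> q"
    and good: "\<And>a. p \<le> a \<Longrightarrow> a \<le> q \<Longrightarrow> \<not> bad_at A a"
  shows "card {b. A q b} = card {b. A p b}"
proof (rule interval_connected[of "\<lambda>y. card {b. A y b} = card {b. A p b}" p q])
  have le: "dpred M (\<lambda>e. card {b. A (e 0) b} \<le> k)" for k
    by (rule dpred_card_le) (intro dpred_app2[OF A] dpred_intros fin)+
  \<comment> \<open>Equality with \<open>k\<close> is the conjunction of an upper and a lower bound;
    \<open>k = 0\<close> is separate because \<open>k - 1\<close> is truncated subtraction.\<close>
  have "dpred M (\<lambda>e. card {b. A (e 0) b} \<le> k \<and> (k = 0 \<or> \<not> card {b. A (e 0) b} \<le> k - 1))" for k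
    by (intro dpred_intros le)
  from this[of "card {b. A p b}"] show "dpred M (\<lambda>e. card {b. A (e 0) b} = card {b. A p b})"
    by (rule dpred_cong) auto
  show "\<exists>s>0. \<forall>y' y''. p \<le> y' \<and> y' \<le> q \<and> \<bar>y' - y\<bar> < s \<and> p \<le> y'' \<and> y'' \<le> q \<and> \<bar>y'' - y\<bar> < s \<longrightarrow>
      card {b. A y' b} = card {b. A p b} \<longrightarrow> card {b. A y'' b} = card {b. A p b}"
    if "p \<le> y" "y \<le> q" for y
  proof -
    have "\<exists>t>0. \<forall>a'. \<bar>a' - y\<bar> < t \<longrightarrow> card {b. A a' b} = card {b. A y b}"
      by (rule card_locally_constant[OF A fin _ good[OF that]]) (rule bd)
    then show ?thesis by metis
  qed
qed (use assms in auto)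

end

section \<open>Induction on the number of parameters\<close>

definition unif_finite :: "('f, 'r, 'a::linordered_field) expansion \<Rightarrow> nat \<Rightarrow> bool" where
  "unif_finite M n \<longleftrightarrow>
    (\<forall>A. dpred M (\<lambda>e. A (map e [0..<n]) (e n)) \<longrightarrow>
      (\<forall>x. length x = n \<longrightarrow> finite {b. A x b} \<and> (\<forall>b. A x b \<longrightarrow> \<bar>b\<bar> \<le> 1)) \<longrightarrow>
      (\<exists>N. \<forall>x. length x = n \<longrightarrow> card {b. A x b} \<le> N))"

text \<open>The least element of the fibre of \<open>R\<close> depends definably on
  \<open>x\<close>, so over it \<open>A\<close> becomes a family with only \<open>n\<close>
  parameters and \<open>UF\<close> applies. Removing the least elements lowers the bound
  \<open>K\<close> by one.\<close>

lemma bounded_over_finite_fibres: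
  fixes M :: "('f, 'r, 'a::linordered_field) expansion"
  assumes UF: "unif_finite M n"
    and A: "dpred M (\<lambda>e. A (map e [0..<Suc n]) (e (Suc n)))"
    and fibA: "\<And>x. length x = Suc n \<Longrightarrow> finite {b. A x b} \<and> (\<forall>b. A x b \<longrightarrow> \<bar>b\<bar> \<le> 1)"
    and "dpred M (\<lambda>e. R (map e [0..<n]) (e n))"
    and "\<And>x. length x = n \<Longrightarrow> finite {y. R x y} \<and> card {y. R x y} \<le> K"
  shows "\<exists>N. \<forall>x y. length x = n \<and> R x y \<longrightarrow> card {b. A (x @ [y]) b} \<le> N"
  using assms(4,5)
proof (induction K arbitrary: R)
  case 0
  have "\<not> R x y" if "length x = n" for x y
    using 0(2)[OF that] by (auto simp: card_eq_0_iff)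
  then show ?case by blast
next
  case (Suc K)
  note R = dpred_app_list[OF Suc.prems(1)]
  define A0 where "A0 = (\<lambda>x b. \<exists>y. R x y \<and> (\<forall>y'. R x y' \<longrightarrow> y \<le> y') \<and> A (x @ [y]) b)"
  define R' where "R' = (\<lambda>x y. R x y \<and> (\<exists>y'. R x y' \<and> y' < y))"
  have "dpred M (\<lambda>e. A0 (map e [0..<n]) (e n))"
    unfolding A0_def by (intro dpred_intros R dpred_app_list[OF A] dvec_intros)
  moreover have A0_eq: "{b. A0 x b} = {b. A (x @ [y]) b}" if "R x y" "\<forall>y'. R x y' \<longrightarrow> y \<le> y'" for x y
    unfolding A0_def using that by (metis (no_types, opaque_lifting) order.antisym)
  have "finite {b. A0 x b} \<and> (\<forall>b. A0 x b \<longrightarrow> \<bar>b\<bar> \<le> 1)" if x: "length x = n" for x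
  proof (cases "\<exists>y. R x y \<and> (\<forall>y'. R x y' \<longrightarrow> y \<le> y')")
    case True
    then obtain y where y: "R x y" "\<forall>y'. R x y' \<longrightarrow> y \<le> y'" by blast
    have "length (x @ [y]) = Suc n" using x by simp
    from fibA[OF this] show ?thesis using A0_eq[OF y] by auto
  next
    case False
    then have "\<not> A0 x b" for b unfolding A0_def by blast
    then show ?thesis by auto
  qed
  ultimately obtain N0 where N0: "\<And>x. length x = n \<Longrightarrow> card {b. A0 x b} \<le> N0"
    using UF unfolding unif_finite_def by blast
  have dR': "dpred M (\<lambda>e. R' (map e [0..<n]) (e n))"
    unfolding R'_def by (intro dpred_intros R dvec_intros)
  have "finite {y. R' x y} \<and> card {y. R' x y} \<le> K" if x: "length x = n" for x
  proof (cases "{y. R x y} = {}")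
    case True
    then show ?thesis unfolding R'_def by auto
  next
    case False
    have fin: "finite {y. R x y}" and le: "card {y. R x y} \<le> Suc K" using Suc.prems(2)[OF x] by auto
    have "{y. R' x y} \<subseteq> {y. R x y} - {Min {y. R x y}}"
      unfolding R'_def using Min_le[OF fin] by (auto simp: not_le[symmetric])
    moreover have "card ({y. R x y} - {Min {y. R x y}}) \<le> K"
      using Min_in[OF fin False] le fin by simp
    ultimately show ?thesis using fin by (meson card_mono finite_Diff finite_subset order_trans)
  qed
  from Suc.IH[OF dR' this] obtain N1
    where N1: "\<And>x y. length x = n \<Longrightarrow> R' x y \<Longrightarrow> card {b. A (x @ [y]) b} \<le> N1" by blast
  have "card {b. A (x @ [y]) b} \<le> max N0 N1" if "length x = n" "R x y" for x y
  proof (cases "\<forall>y'. R x y' \<longrightarrow> y \<le> y'")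
    case True
    then show ?thesis using N0[OF that(1)] A0_eq[OF that(2)] by (simp add: le_max_iff_disj)
  next
    case False
    then have "R' x y" unfolding R'_def using that(2) by (auto simp: not_le)
    then show ?thesis using N1[OF that(1)] by (simp add: le_max_iff_disj)
  qed
  then show ?case by blast
qed

context o_minimal_expansion
begin

text \<open>
  Between consecutive bad parameters the fibre cardinality is constant, so it suffices to bound
  it at the bad parameters and at the midpoints; both are uniformly finite in number.
\<close>

lemma unif_finite_bounded_parameter:
  assumes UF: "unif_finite M n"
    and A: "dpred M (\<lambda>e. A (map e [0..<Suc n]) (e (Suc n)))"
    and fibA: "\<And>x. length x = Suc n \<Longrightarrow> finite {b. A x b} \<and> (\<forall>b. A x b \<longrightarrow> \<bar>b\<bar> \<le> 1)"
    and bdA: "\<And>x y b. length x = n \<Longrightarrow> A (x @ [y]) b \<Longrightarrow> \<bar>y\<bar> \<le> 1"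
  shows "\<exists>N. \<forall>x y. length x = n \<longrightarrow> card {b. A (x @ [y]) b} \<le> N"
proof -
  note dA = dpred_app_list[OF A]
  define B where "B = (\<lambda>x y. bad_at (\<lambda>y b. A (x @ [y]) b) y)"
  have dB: "dpred M (\<lambda>e. B (map e [0..<n]) (e n))"
    unfolding B_def bad_at_def normal_at_def by (intro dpred_if dpred_intros dA dvec_intros)
  have dAx: "dpred M (\<lambda>e. A (x @ [e 0]) (e 1))" if "length x = n" for x
    by (intro dA dvec_snoc dvec_const that dpred_intros)
  have finx: "finite {b. A (x @ [y]) b}" and bdx: "\<And>b. A (x @ [y]) b \<Longrightarrow> \<bar>b\<bar> \<le> 1" if "length x = n" for x y
    using fibA[of "x @ [y]"] that by auto
  have finB: "finite {y. B x y}" if "length x = n" for x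
    unfolding B_def by (rule finite_bad[OF dAx[OF that] finx[OF that]]) (rule bdx[OF that])
  \<comment> \<open>Near a parameter outside \<open>[-1, 1]\<close> all fibres are empty, so it is
    not bad. The bad parameters thus form a family to which \<open>UF\<close> applies.\<close>
  have bdB: "\<bar>y\<bar> \<le> 1" if x: "length x = n" and B: "B x y" for x y
  proof (rule ccontr)
    assume y: "\<not> \<bar>y\<bar> \<le> 1"
    have "\<not> A (x @ [a']) b" if "\<bar>a' - y\<bar> < \<bar>y\<bar> - 1" for a' b
      using bdA[OF x, of a' b] that by (auto simp: abs_if split: if_splits)
    moreover have "\<not> A (x @ [y]) b" for b using bdA[OF x, of y b] y by blast
    moreover have "0 < \<bar>y\<bar> - 1" using y by simp
    ultimately have "normal_at (\<lambda>y b. A (x @ [y]) b) y b" for b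
      unfolding normal_at_def using zero_less_one by metis
    then show False using B unfolding B_def bad_at_def by blast
  qed
  have "\<exists>K. \<forall>x. length x = n \<longrightarrow> card {b. B x b} \<le> K"
    using UF[unfolded unif_finite_def, rule_format, OF dB] finB bdB by simp
  then obtain K where K: "\<And>x. length x = n \<Longrightarrow> card {b. B x b} \<le> K" by blast
  \<comment> \<open>The added points -2 and 2 enclose \<open>[-1, 1]\<close>, so every parameter
    there that is not bad has a neighbour from \<open>B'\<close> on each side.\<close>
  define B' where "B' = (\<lambda>x b. B x b \<or> b = - 2 \<or> b = 2)"
  \<comment> \<open>Pairs with \<open>b = b'\<close> yield the points of \<open>B'\<close>
    themselves, the other pairs yield midpoints; counting ordered pairs explains the bound
    \<open>(K + 2) * (K + 2)\<close>.\<close>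
  define R where "R = (\<lambda>x y. \<exists>b b'. B' x b \<and> B' x b' \<and> y + y = b + b')"
  have dR: "dpred M (\<lambda>e. R (map e [0..<n]) (e n))"
    unfolding R_def B'_def by (intro dpred_intros dpred_app_list[OF dB] dvec_intros)
  have finB': "finite {b. B' x b}" if "length x = n" for x
    unfolding B'_def using finB[OF that] by simp
  have cardR: "finite {y. R x y} \<and> card {y. R x y} \<le> (K + 2) * (K + 2)" if x: "length x = n" for x
  proof -
    have "{b. B' x b} = {b. B x b} \<union> {- 2, 2}" unfolding B'_def by auto
    then have "card {b. B' x b} \<le> card {b. B x b} + card {- 2, 2 :: 'a}" by (metis card_Un_le)
    also have "\<dots> \<le> K + 2" using K[OF x] card_insert_le_m1[of 2 "{2::'a}" "- 2"] by (simp add: add_mono)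
    finally have c: "card {b. B' x b} \<le> K + 2" .
    have sub: "{y. R x y} \<subseteq> (\<lambda>(b, b'). (b + b') / 2) ` ({b. B' x b} \<times> {b. B' x b})"
    proof
      fix y assume "y \<in> {y. R x y}"
      then obtain b b' where "B' x b" "B' x b'" "y + y = b + b'" unfolding R_def by blast
      moreover from this(3) have "y = (b + b') / 2" by (metis field_sum_of_halves add_divide_distrib)
      ultimately show "y \<in> (\<lambda>(b, b'). (b + b') / 2) ` ({b. B' x b} \<times> {b. B' x b})"
        by (intro image_eqI[of _ _ "(b, b')"]) simp_all
    qed
    have fin: "finite ({b. B' x b} \<times> {b. B' x b})" using finB'[OF x] by simp
    have "card {y. R x y} \<le> card ({b. B' x b} \<times> {b. B' x b})"
      by (rule surj_card_le[OF fin sub])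
    also have "\<dots> \<le> (K + 2) * (K + 2)" unfolding card_cartesian_product by (rule mult_le_mono[OF c c])
    finally show ?thesis using finite_surj[OF fin sub] by simp
  qed
  obtain N where N: "\<And>x y. length x = n \<Longrightarrow> R x y \<Longrightarrow> card {b. A (x @ [y]) b} \<le> N"
    using bounded_over_finite_fibres[OF UF A fibA dR cardR] by blast
  have "card {b. A (x @ [y]) b} \<le> N" if x: "length x = n" for x y
  proof -
    consider "\<not> \<bar>y\<bar> \<le> 1" | "B x y" | "\<bar>y\<bar> \<le> 1" "\<not> B x y" by blast
    then show ?thesis
    proof cases
      case 1
      then have "{b. A (x @ [y]) b} = {}" using bdA[OF x] by auto
      then show ?thesis by simp
    next
      case 2
      then have "R x y" unfolding R_def B'_def by blast
      then show ?thesis using N[OF x] by blast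
    next
      case 3
      define lo where "lo = Max {b. B' x b \<and> b < y}"
      define hi where "hi = Min {b. B' x b \<and> y < b}"
      have fl: "finite {b. B' x b \<and> b < y}" and fh: "finite {b. B' x b \<and> y < b}"
        using finB'[OF x] by (auto intro: rev_finite_subset)
      have "- 2 \<in> {b. B' x b \<and> b < y}" "2 \<in> {b. B' x b \<and> y < b}"
        using 3(1) unfolding B'_def by (auto simp: abs_le_iff)
      then have lo: "B' x lo" "lo < y" and hi: "B' x hi" "y < hi"
        unfolding lo_def hi_def using Max_in[OF fl] Min_in[OF fh] by blast+
      have none: "\<not> B x z" if "lo < z" "z < hi" for z
      proof
        assume "B x z"
        then have "B' x z" "z \<noteq> y" using 3(2) unfolding B'_def by auto
        then consider "B' x z \<and> z < y" | "B' x z \<and> y < z" by fastforce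
        then show False
          using Max_ge[OF fl, of z] Min_le[OF fh, of z] that unfolding lo_def hi_def by cases auto
      qed
      define c where "c = (lo + hi) / 2"
      have c: "lo < c" "c < hi" unfolding c_def using lo hi by auto
      have "c + c = lo + hi" unfolding c_def by simp
      then have "R x c" unfolding R_def using lo(1) hi(1) by blast
      have eq: "card {b. A (x @ [q]) b} = card {b. A (x @ [p]) b}" if "p \<le> q" "lo < p" "q < hi" for p q
      proof (rule card_constant_between[of "\<lambda>y b. A (x @ [y]) b", OF dAx[OF x] finx[OF x] _ that(1)])
        show "\<bar>b\<bar> \<le> 1" if "A (x @ [a]) b" for a b using bdx[OF x that] .
        show "\<not> bad_at (\<lambda>y b. A (x @ [y]) b) a" if "p \<le> a" "a \<le> q" for a
          using none[of a] that \<open>lo < p\<close> \<open>q < hi\<close> unfolding B_def by auto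
      qed
      have "card {b. A (x @ [y]) b} = card {b. A (x @ [c]) b}"
        using eq[of y c] eq[of c y] lo hi c by (cases "y \<le> c") auto
      then show ?thesis using N[OF x \<open>R x c\<close>] by simp
    qed
  qed
  then show ?thesis by blast
qed

text \<open>The induction hypothesis speaks of fibres inside \<open>[-1, 1]\<close>, and the bad
  values of the last parameter must form such fibres, so that parameter has to be bounded. Values
  outside \<open>[-1, 1]\<close> are brought inside by inversion.\<close>

lemma unif_finite_Suc:
  assumes UF: "unif_finite M n"
  shows "unif_finite M (Suc n)"
  unfolding unif_finite_def
proof (intro allI impI)
  fix A :: "'a list \<Rightarrow> 'a \<Rightarrow> bool"
  assume A: "dpred M (\<lambda>e. A (map e [0..<Suc n]) (e (Suc n)))"
    and fib: "\<forall>x. length x = Suc n \<longrightarrow> finite {b. A x b} \<and> (\<forall>b. A x b \<longrightarrow> \<bar>b\<bar> \<le> 1)"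
  note dA = dpred_app_list[OF A]
  define A1 where "A1 = (\<lambda>x b. \<bar>x ! n\<bar> \<le> 1 \<and> A x b)"
  \<comment> \<open>The last coordinate \<open>u\<close> now stands for the original parameter
    \<open>1 / u\<close>; at \<open>u = 0\<close> the equation has no solution and the fibre is
    empty.\<close>
  define A2 where "A2 = (\<lambda>x b. \<bar>x ! n\<bar> \<le> 1 \<and> (\<exists>y. x ! n * y = 1 \<and> A (take n x @ [y]) b))"
  have take: "take n (map e [0..<Suc n]) = map e [0..<n]" "map e [0..<Suc n] ! n = e n" for e :: "nat \<Rightarrow> 'a"
    by (simp_all add: take_map nth_append)
  have "\<exists>N. \<forall>x y. length x = n \<longrightarrow> card {b. A1 (x @ [y]) b} \<le> N"
  proof (rule unif_finite_bounded_parameter[OF UF])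
    show "dpred M (\<lambda>e. A1 (map e [0..<Suc n]) (e (Suc n)))"
      unfolding A1_def take by (intro dpred_intros A)
    show "finite {b. A1 x b} \<and> (\<forall>b. A1 x b \<longrightarrow> \<bar>b\<bar> \<le> 1)" if "length x = Suc n" for x
      using fib that unfolding A1_def by auto
  qed (auto simp: A1_def)
  then obtain N1 where N1: "\<And>x y. length x = n \<Longrightarrow> card {b. A1 (x @ [y]) b} \<le> N1" by blast
  have A2_eq: "A2 (x @ [u]) b \<longleftrightarrow> (u \<noteq> 0 \<and> \<bar>u\<bar> \<le> 1) \<and> A (x @ [1 / u]) b"
    if "length x = n" for x u b
  proof -
    have "u * y = 1 \<longleftrightarrow> u \<noteq> 0 \<and> y = 1 / u" for y
      by (metis mult_zero_left nonzero_eq_divide_eq mult.commute zero_neq_one)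
    then show ?thesis unfolding A2_def using that by auto
  qed
  have "\<exists>N. \<forall>x y. length x = n \<longrightarrow> card {b. A2 (x @ [y]) b} \<le> N"
  proof (rule unif_finite_bounded_parameter[OF UF])
    show "dpred M (\<lambda>e. A2 (map e [0..<Suc n]) (e (Suc n)))"
      unfolding A2_def take by (intro dpred_intros dA dvec_intros)
    show "finite {b. A2 x b} \<and> (\<forall>b. A2 x b \<longrightarrow> \<bar>b\<bar> \<le> 1)" if x: "length x = Suc n" for x
    proof -
      obtain x' u where xu: "x = x' @ [u]" "length x' = n" using x by (metis length_Suc_conv_rev)
      have len: "length (x' @ [1 / u]) = Suc n" using xu by simp
      have eq: "A2 x b \<longleftrightarrow> (u \<noteq> 0 \<and> \<bar>u\<bar> \<le> 1) \<and> A (x' @ [1 / u]) b" for b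
        using A2_eq[OF xu(2), of u] unfolding xu(1) by simp
      show ?thesis unfolding eq using fib[rule_format, OF len] by simp
    qed
  qed (auto simp: A2_def)
  then obtain N2 where N2: "\<And>x y. length x = n \<Longrightarrow> card {b. A2 (x @ [y]) b} \<le> N2" by blast
  have "card {b. A x b} \<le> max N1 N2" if x: "length x = Suc n" for x
  proof -
    obtain x' y where xy: "x = x' @ [y]" "length x' = n" using x by (metis length_Suc_conv_rev)
    show ?thesis
    proof (cases "\<bar>y\<bar> \<le> 1")
      case True
      then have "{b. A x b} = {b. A1 (x' @ [y]) b}" unfolding A1_def using xy by auto
      then show ?thesis using N1[OF xy(2), of y] by simp
    next
      case False
      then have "y \<noteq> 0" "\<bar>1 / y\<bar> \<le> 1" by auto
      then have "{b. A x b} = {b. A2 (x' @ [1 / y]) b}" unfolding A2_eq[OF xy(2)] xy(1) by simp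
      then show ?thesis using N2[OF xy(2), of "1 / y"] by simp
    qed
  qed
  then show "\<exists>N. \<forall>x. length x = Suc n \<longrightarrow> card {b. A x b} \<le> N" by blast
qed

theorem uniform_finiteness: "unif_finite M n"
proof (induction n)
  case 0
  show ?case unfolding unif_finite_def by auto
qed (rule unif_finite_Suc)

end

section \<open>The sup-metric description of the topology\<close>

text \<open>The open sup-metric ball with radius in the field. Equal length is part of the relation,
  so points of different powers are never near.\<close>

definition near :: "'a::linordered_field \<Rightarrow> 'a list \<Rightarrow> 'a list \<Rightarrow> bool" where
  "near r x y \<longleftrightarrow> length x = length y \<and> (\<forall>i<length x. \<bar>x ! i - y ! i\<bar> < r)"

lemma near_refl: "r > 0 \<Longrightarrow> near r x x"
  unfolding near_def by simp

lemma near_sym: "near r x y \<Longrightarrow> near r y x"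
  unfolding near_def by (simp add: abs_minus_commute)

lemma near_mono: "near r x y \<Longrightarrow> r \<le> s \<Longrightarrow> near s x y"
  unfolding near_def by force

lemma near_trans: "near r x y \<Longrightarrow> near s y z \<Longrightarrow> near (r + s) x z"
  unfolding near_def
proof (intro conjI allI impI)
  fix i assume a: "length x = length y \<and> (\<forall>i<length x. \<bar>x ! i - y ! i\<bar> < r)"
    "length y = length z \<and> (\<forall>i<length y. \<bar>y ! i - z ! i\<bar> < s)" "i < length x"
  then have "\<bar>x ! i - y ! i\<bar> < r" "\<bar>y ! i - z ! i\<bar> < s" by auto
  then show "\<bar>x ! i - z ! i\<bar> < r + s" by (auto simp: abs_if split: if_splits)
qed auto

lemma near_append:
  "length x = length x' \<Longrightarrow> near r (x @ y) (x' @ y') \<longleftrightarrow> near r x x' \<and> near r y y'"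
  unfolding near_def
proof (intro iffI; elim conjE; intro conjI allI impI)
  assume len: "length x = length x'" "length (x @ y) = length (x' @ y')"
    and all: "\<forall>i<length (x @ y). \<bar>(x @ y) ! i - (x' @ y') ! i\<bar> < r"
  show "\<bar>x ! i - x' ! i\<bar> < r" if "i < length x" for i
    using all[rule_format, of i] that len by (simp add: nth_append)
  show "\<bar>y ! i - y' ! i\<bar> < r" if "i < length y" for i
    using all[rule_format, of "length x + i"] that len by (simp add: nth_append)
next
  fix i assume "length x = length x'" "\<forall>i<length x. \<bar>x ! i - x' ! i\<bar> < r"
    "\<forall>i<length y. \<bar>y ! i - y' ! i\<bar> < r" "i < length (x @ y)"
  then show "\<bar>(x @ y) ! i - (x' @ y') ! i\<bar> < r"
    by (auto simp: nth_append)
qed auto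

lemma near_single: "near r [a] [b] \<longleftrightarrow> \<bar>a - b\<bar> < r"
  unfolding near_def by simp

lemma near_snoc:
  "length x = length x' \<Longrightarrow> near r (x @ [a]) (x' @ [b]) \<longleftrightarrow> near r x x' \<and> \<bar>a - b\<bar> < r"
  by (simp add: near_append near_single)

lemma near_open:
  assumes "near r x y"
  obtains s where "s > 0" "\<And>z. near s y z \<Longrightarrow> near r x z"
proof -
  have "\<exists>s>0. \<forall>i\<in>{..<length x}. \<forall>a. \<bar>y ! i - a\<bar> < s \<longrightarrow> \<bar>x ! i - a\<bar> < r"
  proof (rule finite_uniform_positive)
    fix i assume "i \<in> {..<length x}"
    then have "\<bar>x ! i - y ! i\<bar> < r" using assms unfolding near_def by auto
    then show "\<exists>s>0. \<forall>a. \<bar>y ! i - a\<bar> < s \<longrightarrow> \<bar>x ! i - a\<bar> < r"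
      by (intro exI[of _ "r - \<bar>x ! i - y ! i\<bar>"]) (auto simp: abs_if split: if_splits)
  qed auto
  then obtain s where s: "s > 0" "\<forall>i\<in>{..<length x}. \<forall>a. \<bar>y ! i - a\<bar> < s \<longrightarrow> \<bar>x ! i - a\<bar> < r"
    by blast
  show ?thesis by (rule that[OF s(1)]) (use s(2) assms in \<open>auto simp: near_def\<close>)
qed

lemma dpred_near:
  assumes r: "dterm M r" and v: "dvec M n v" and w: "dvec M n w"
  shows "dpred M (\<lambda>e. near (r e) (v e) (w e))"
proof -
  have "dpred M (\<lambda>e. \<forall>i\<in>{..<n}. \<bar>v e ! i - w e ! i\<bar> < r e)"
    by (rule dpred_finite_ball, simp, intro dpred_intros r)
      (use v w in \<open>auto simp: dvec_def\<close>)
  then show ?thesis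
    by (rule dpred_cong) (use v w in \<open>auto simp: dvec_def near_def\<close>)
qed

lemma open_abs_ball:
  fixes x :: "'a::{linordered_field, linorder_topology}"
  assumes "open S" "x \<in> S"
  shows "\<exists>r>0. \<forall>y. \<bar>x - y\<bar> < r \<longrightarrow> y \<in> S"
proof -
  obtain b where b: "b > x" "{x..<b} \<subseteq> S" using open_right[OF assms, of "x + 1"] by auto
  obtain c where c: "c < x" "{c<..x} \<subseteq> S" using open_left[OF assms, of "x - 1"] by auto
  have "y \<in> S" if "\<bar>x - y\<bar> < min (b - x) (x - c)" for y
  proof (cases "x \<le> y")
    case True
    then have "y \<in> {x..<b}" using that by auto
    then show ?thesis using b by blast
  next
    case False
    then have "y \<in> {c<..x}" using that by auto
    then show ?thesis using c by blast
  qed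
  then show ?thesis using b(1) c(1) by (intro exI[of _ "min (b - x) (x - c)"]) auto
qed

lemma topspace_power_topology: "topspace (power_topology n) = {xs. length xs = n}"
  unfolding power_topology_def topspace_pullback_topology by (auto simp: PiE_def)

text \<open>Finitely many coordinates allow one radius for all of them. Hereby openness and
  continuity become statements about radii in the field, over which formulas can quantify.\<close>

lemma openin_power_topology:
  fixes U :: "'a::{linordered_field, linorder_topology} list set"
  shows "openin (power_topology n) U \<longleftrightarrow>
    U \<subseteq> {xs. length xs = n} \<and> (\<forall>x\<in>U. \<exists>r>0. \<forall>y. near r x y \<longrightarrow> y \<in> U)"
proof
  assume "openin (power_topology n) U"
  then obtain W where W: "openin (product_topology (\<lambda>_. euclidean) {..<n}) W"
    "U = (\<lambda>xs. \<lambda>i\<in>{..<n}. xs ! i) -` W \<inter> {xs. length xs = n}"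
    unfolding power_topology_def openin_pullback_topology by blast
  have "\<exists>r>0. \<forall>y. near r x y \<longrightarrow> y \<in> U" if x: "x \<in> U" for x
  proof -
    have "(\<lambda>i\<in>{..<n}. x ! i) \<in> W" and len: "length x = n" using x W(2) by auto
    then obtain V where V: "\<forall>i\<in>{..<n}. openin euclidean (V i)"
      "(\<lambda>i\<in>{..<n}. x ! i) \<in> Pi\<^sub>E {..<n} V" "Pi\<^sub>E {..<n} V \<subseteq> W"
      using W(1) unfolding openin_product_topology_alt by blast
    have "\<exists>r>0. \<forall>i\<in>{..<n}. \<forall>y. \<bar>x ! i - y\<bar> < r \<longrightarrow> y \<in> V i"
    proof (rule finite_uniform_positive)
      fix i assume i: "i \<in> {..<n}"
      have "open (V i)" using V(1) i by (simp add: open_openin[symmetric])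
      moreover have "x ! i \<in> V i" using V(2) i by (auto simp: PiE_iff)
      ultimately show "\<exists>r>0. \<forall>y. \<bar>x ! i - y\<bar> < r \<longrightarrow> y \<in> V i" by (rule open_abs_ball)
    qed auto
    then obtain r where r: "r > 0" "\<forall>i\<in>{..<n}. \<forall>y. \<bar>x ! i - y\<bar> < r \<longrightarrow> y \<in> V i" by blast
    have "y \<in> U" if y: "near r x y" for y
    proof -
      have "(\<lambda>i\<in>{..<n}. y ! i) \<in> Pi\<^sub>E {..<n} V" using r(2) y len unfolding near_def by auto
      then have "(\<lambda>i\<in>{..<n}. y ! i) \<in> W" using V(3) by blast
      then show ?thesis unfolding W(2) using y len unfolding near_def by simp
    qed
    then show ?thesis using r(1) by blast
  qed
  then show "U \<subseteq> {xs. length xs = n} \<and> (\<forall>x\<in>U. \<exists>r>0. \<forall>y. near r x y \<longrightarrow> y \<in> U)"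
    using W(2) by auto
next
  assume U: "U \<subseteq> {xs. length xs = n} \<and> (\<forall>x\<in>U. \<exists>r>0. \<forall>y. near r x y \<longrightarrow> y \<in> U)"
  define W where "W = {g \<in> Pi\<^sub>E {..<n} (\<lambda>_. UNIV). map g [0..<n] \<in> U}"
  have "openin (product_topology (\<lambda>_. euclidean) {..<n}) W"
    unfolding openin_product_topology_alt
  proof
    fix g assume g: "g \<in> W"
    then obtain r where r: "r > 0" "\<And>y. near r (map g [0..<n]) y \<Longrightarrow> y \<in> U" using U unfolding W_def by blast
    define V where "V = (\<lambda>i. {g i - r<..<g i + r})"
    have "Pi\<^sub>E {..<n} V \<subseteq> W"
    proof
      fix h assume h: "h \<in> Pi\<^sub>E {..<n} V"
      have "\<bar>g i - h i\<bar> < r" if "i < n" for i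
      proof -
        have "h i \<in> V i" using h that by auto
        then show ?thesis unfolding V_def by (auto simp: abs_if)
      qed
      then have "near r (map g [0..<n]) (map h [0..<n])"
        unfolding near_def by auto
      then show "h \<in> W" unfolding W_def using r(2) h by auto
    qed
    moreover have "g \<in> Pi\<^sub>E {..<n} (\<lambda>_. UNIV)" using g unfolding W_def by simp
    then have "g \<in> Pi\<^sub>E {..<n} V" using r(1) by (simp add: PiE_iff V_def)
    moreover have "openin euclidean (V i)" for i unfolding V_def by simp
    ultimately show "\<exists>V. finite {i \<in> {..<n}. V i \<noteq> topspace euclidean} \<and>
        (\<forall>i\<in>{..<n}. openin euclidean (V i)) \<and> g \<in> Pi\<^sub>E {..<n} V \<and> Pi\<^sub>E {..<n} V \<subseteq> W"
      by (intro exI[of _ V] conjI ballI) simp_all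
  qed
  moreover have "U = (\<lambda>xs. \<lambda>i\<in>{..<n}. xs ! i) -` W \<inter> {xs. length xs = n}"
  proof -
    have "map (\<lambda>i\<in>{..<n}. xs ! i) [0..<n] = xs" if "length xs = n" for xs :: "'a list"
      using that by (auto intro: nth_equalityI)
    then show ?thesis using U unfolding W_def by (auto simp: PiE_def)
  qed
  ultimately show "openin (power_topology n) U"
    unfolding power_topology_def openin_pullback_topology by blast
qed

lemma openin_induced_topology:
  fixes U :: "'a::{linordered_field, linorder_topology} list set"
  assumes X: "X \<subseteq> {xs. length xs = n}"
  shows "openin (induced_topology n X) U \<longleftrightarrow> U \<subseteq> X \<and> (\<forall>x\<in>U. \<exists>r>0. \<forall>y\<in>X. near r x y \<longrightarrow> y \<in> U)"
proof
  assume "openin (induced_topology n X) U"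
  then obtain T where "openin (power_topology n) T" "U = T \<inter> X" unfolding openin_subtopology by blast
  then show "U \<subseteq> X \<and> (\<forall>x\<in>U. \<exists>r>0. \<forall>y\<in>X. near r x y \<longrightarrow> y \<in> U)"
    unfolding openin_power_topology by blast
next
  assume U: "U \<subseteq> X \<and> (\<forall>x\<in>U. \<exists>r>0. \<forall>y\<in>X. near r x y \<longrightarrow> y \<in> U)"
  \<comment> \<open>The union of all balls around points of \<open>U\<close> whose trace on
    \<open>X\<close> stays in \<open>U\<close>.\<close>
  define T where "T = {y. \<exists>x\<in>U. \<exists>r>0. near r x y \<and> (\<forall>z\<in>X. near r x z \<longrightarrow> z \<in> U)}"
  have "openin (power_topology n) T"
    unfolding openin_power_topology
  proof (intro conjI subsetI ballI)
    fix y assume "y \<in> T"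
    then obtain x r where xr: "x \<in> U" "r > 0" "near r x y" "\<forall>z\<in>X. near r x z \<longrightarrow> z \<in> U"
      unfolding T_def by blast
    show "y \<in> {xs. length xs = n}" using xr(1,3) U X unfolding near_def by auto
    obtain s where "s > 0" "\<And>z. near s y z \<Longrightarrow> near r x z" using near_open[OF xr(3)] by blast
    then show "\<exists>r>0. \<forall>z. near r y z \<longrightarrow> z \<in> T"
      unfolding T_def using xr by blast
  qed
  moreover have "U = T \<inter> X"
  proof
    show "U \<subseteq> T \<inter> X" unfolding T_def using U near_refl by fastforce
  qed (auto simp: T_def)
  ultimately show "openin (induced_topology n X) U" unfolding openin_subtopology by blast
qed

section \<open>Continuity and pasting in the sup-metric\<close>

definition contin :: "'a::linordered_field list set \<Rightarrow> ('a list \<Rightarrow> 'a list) \<Rightarrow> bool" where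
  "contin X f \<longleftrightarrow> (\<forall>x\<in>X. \<forall>\<epsilon>>0. \<exists>\<delta>>0. \<forall>y\<in>X. near \<delta> x y \<longrightarrow> near \<epsilon> (f x) (f y))"

lemma contin_subset: "contin X f \<Longrightarrow> Y \<subseteq> X \<Longrightarrow> contin Y f"
  unfolding contin_def by (meson subsetD)

lemma contin_compose:
  assumes "contin X f" "contin Y g" "f \<in> X \<rightarrow> Y"
  shows "contin X (\<lambda>x. g (f x))"
  unfolding contin_def
proof (intro ballI allI impI)
  fix x and \<epsilon> :: 'a assume x: "x \<in> X" "\<epsilon> > 0"
  have "f x \<in> Y" using assms(3) x by auto
  then obtain \<delta> where \<delta>: "\<delta> > 0" "\<And>y. y \<in> Y \<Longrightarrow> near \<delta> (f x) y \<Longrightarrow> near \<epsilon> (g (f x)) (g y)"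
    using assms(2) x(2) unfolding contin_def by blast
  obtain d where "d > 0" "\<And>y. y \<in> X \<Longrightarrow> near d x y \<Longrightarrow> near \<delta> (f x) (f y)"
    using assms(1) x(1) \<delta>(1) unfolding contin_def by blast
  then show "\<exists>\<delta>>0. \<forall>y\<in>X. near \<delta> x y \<longrightarrow> near \<epsilon> (g (f x)) (g (f y))"
    using \<delta>(2) assms(3) by (meson PiE)
qed

lemma contin_append:
  assumes "contin X f" "contin X g" "\<And>x. x \<in> X \<Longrightarrow> length (f x) = k"
  shows "contin X (\<lambda>x. f x @ g x)"
  unfolding contin_def
proof (intro ballI allI impI)
  fix x and \<epsilon> :: 'a assume x: "x \<in> X" "\<epsilon> > 0"
  obtain d where d: "d > 0" "\<And>y. y \<in> X \<Longrightarrow> near d x y \<Longrightarrow> near \<epsilon> (f x) (f y)"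
    using assms(1) x unfolding contin_def by blast
  obtain d' where d': "d' > 0" "\<And>y. y \<in> X \<Longrightarrow> near d' x y \<Longrightarrow> near \<epsilon> (g x) (g y)"
    using assms(2) x unfolding contin_def by blast
  have "near \<epsilon> (f x @ g x) (f y @ g y)" if "y \<in> X" "near (min d d') x y" for y
    using that d(2)[OF that(1)] d'(2)[OF that(1)] near_mono[OF that(2)] assms(3) x
    by (simp add: near_append)
  then show "\<exists>\<delta>>0. \<forall>y\<in>X. near \<delta> x y \<longrightarrow> near \<epsilon> (f x @ g x) (f y @ g y)"
    using d(1) d'(1) by (intro exI[of _ "min d d'"]) auto
qed

lemma contin_cong: "contin X f \<Longrightarrow> (\<And>x. x \<in> X \<Longrightarrow> f x = g x) \<Longrightarrow> contin X g"
  unfolding contin_def by simp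

definition rel_closed :: "'a::linordered_field list set \<Rightarrow> 'a list set \<Rightarrow> bool" where
  "rel_closed Y D \<longleftrightarrow> (\<forall>x\<in>Y - D. \<exists>r>0. \<forall>y\<in>D \<inter> Y. \<not> near r x y)"

lemma contin_pasting:
  assumes f: "contin D f" and g: "contin Q g" and D: "rel_closed (D \<union> Q) D" and Q: "rel_closed (D \<union> Q) Q"
    and agree: "\<And>x. x \<in> D \<Longrightarrow> x \<in> Q \<Longrightarrow> f x = g x"
  shows "contin (D \<union> Q) (\<lambda>x. if x \<in> D then f x else g x)"
proof -
  \<comment> \<open>At a point outside the relatively closed set \<open>S\<close> the estimate on
    \<open>S\<close> holds vacuously, because a ball around the point misses
    \<open>S\<close>.\<close>
  have half: "\<exists>\<delta>>0. \<forall>y\<in>S. near \<delta> x y \<longrightarrow> near \<epsilon> (h x) (h y)"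
    if "contin S h" "rel_closed (D \<union> Q) S" "S \<subseteq> D \<union> Q" "x \<in> D \<union> Q" "\<epsilon> > 0"
    for S x and \<epsilon> :: 'a and h :: "'a list \<Rightarrow> 'a list"
    using that unfolding contin_def rel_closed_def by (cases "x \<in> S") blast+
  show ?thesis unfolding contin_def
  proof (intro ballI allI impI)
    fix x and \<epsilon> :: 'a assume x: "x \<in> D \<union> Q" "\<epsilon> > 0"
    let ?h = "\<lambda>x. if x \<in> D then f x else g x"
    have "contin D ?h" by (rule contin_cong[OF f]) simp
    then obtain d where d: "d > 0" "\<And>y. y \<in> D \<Longrightarrow> near d x y \<Longrightarrow> near \<epsilon> (?h x) (?h y)"
      using half[of D ?h, OF _ D _ x] by blast
    have "contin Q ?h" by (rule contin_cong[OF g]) (simp add: agree)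
    then obtain d' where d': "d' > 0" "\<And>y. y \<in> Q \<Longrightarrow> near d' x y \<Longrightarrow> near \<epsilon> (?h x) (?h y)"
      using half[of Q ?h, OF _ Q _ x] by blast
    have "near \<epsilon> (?h x) (?h y)" if "y \<in> D \<union> Q" "near (min d d') x y" for y
      using that(1) d(2)[of y] d'(2)[of y] near_mono[OF that(2), of d] near_mono[OF that(2), of d'] by auto
    then show "\<exists>\<delta>>0. \<forall>y\<in>D \<union> Q. near \<delta> x y \<longrightarrow> near \<epsilon> (?h x) (?h y)"
      using d(1) d'(1) by (intro exI[of _ "min d d'"]) auto
  qed
qed

lemma continuous_map_induced_iff:
  fixes f :: "'a::{linordered_field, linorder_topology} list \<Rightarrow> 'a list"
  assumes X: "X \<subseteq> {xs. length xs = n}" and Y: "Y \<subseteq> {xs. length xs = m}"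
  shows "continuous_map (induced_topology n X) (induced_topology m Y) f \<longleftrightarrow> f \<in> X \<rightarrow> Y \<and> contin X f"
proof -
  have tX: "topspace (induced_topology n X) = X" and tY: "topspace (induced_topology m Y) = Y"
    using X Y by (auto simp: topspace_power_topology)
  show ?thesis
  proof
    assume c: "continuous_map (induced_topology n X) (induced_topology m Y) f"
    then have fY: "f \<in> X \<rightarrow> Y" unfolding continuous_map_def tX tY by auto
    moreover have "contin X f"
      unfolding contin_def
    proof (intro ballI allI impI)
      fix x and \<epsilon> :: 'a assume x: "x \<in> X" "\<epsilon> > 0"
      have "openin (induced_topology m Y) {y \<in> Y. near \<epsilon> (f x) y}"
        unfolding openin_induced_topology[OF Y]
      proof (intro conjI ballI)
        fix y assume "y \<in> {y \<in> Y. near \<epsilon> (f x) y}"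
        then have "near \<epsilon> (f x) y" by simp
        then obtain s where "s > 0" "\<And>z. near s y z \<Longrightarrow> near \<epsilon> (f x) z" by (rule near_open) auto
        then show "\<exists>r>0. \<forall>z\<in>Y. near r y z \<longrightarrow> z \<in> {y \<in> Y. near \<epsilon> (f x) y}" by blast
      qed auto
      then have "openin (induced_topology n X) {z \<in> X. f z \<in> {y \<in> Y. near \<epsilon> (f x) y}}"
        using openin_continuous_map_preimage[OF c, unfolded tX] by blast
      moreover have "x \<in> {z \<in> X. f z \<in> {y \<in> Y. near \<epsilon> (f x) y}}" using x fY near_refl by auto
      ultimately show "\<exists>\<delta>>0. \<forall>y\<in>X. near \<delta> x y \<longrightarrow> near \<epsilon> (f x) (f y)"
        unfolding openin_induced_topology[OF X] by blast
    qed
    ultimately show "f \<in> X \<rightarrow> Y \<and> contin X f" by blast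
  next
    assume f: "f \<in> X \<rightarrow> Y \<and> contin X f"
    have "openin (induced_topology n X) {x \<in> X. f x \<in> U}" if U: "openin (induced_topology m Y) U" for U
      unfolding openin_induced_topology[OF X]
    proof (intro conjI ballI)
      fix x assume "x \<in> {x \<in> X. f x \<in> U}"
      then have x: "x \<in> X" "f x \<in> U" by auto
      obtain r where r: "r > 0" "\<forall>y\<in>Y. near r (f x) y \<longrightarrow> y \<in> U"
        using U x(2) unfolding openin_induced_topology[OF Y] by blast
      obtain d where "d > 0" "\<forall>y\<in>X. near d x y \<longrightarrow> near r (f x) (f y)"
        using f x(1) r(1) unfolding contin_def by blast
      then show "\<exists>r>0. \<forall>y\<in>X. near r x y \<longrightarrow> y \<in> {x \<in> X. f x \<in> U}" using r(2) f by blast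
    qed auto
    then show "continuous_map (induced_topology n X) (induced_topology m Y) f"
      unfolding continuous_map_def tX tY using f by auto
  qed
qed

section \<open>Continuous definable scalar functions\<close>

definition locally_at :: "'a::linordered_field list set \<Rightarrow> 'a list \<Rightarrow> ('a list \<Rightarrow> bool) \<Rightarrow> bool" where
  "locally_at X x P \<longleftrightarrow> (\<exists>\<delta>>0. \<forall>y\<in>X. near \<delta> x y \<longrightarrow> P y)"

lemma locally_at_conj:
  assumes "locally_at X x P" "locally_at X x Q"
  shows "locally_at X x (\<lambda>y. P y \<and> Q y)"
proof -
  obtain d d' where "d > 0" "\<forall>y\<in>X. near d x y \<longrightarrow> P y" "d' > 0" "\<forall>y\<in>X. near d' x y \<longrightarrow> Q y"
    using assms unfolding locally_at_def by blast
  then show ?thesis unfolding locally_at_def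
    by (intro exI[of _ "min d d'"]) (auto dest: near_mono[OF _ min.cobounded1] near_mono[OF _ min.cobounded2])
qed

lemma locally_at_mono:
  "locally_at X x P \<Longrightarrow> (\<And>y. y \<in> X \<Longrightarrow> P y \<Longrightarrow> Q y) \<Longrightarrow> locally_at X x Q"
  unfolding locally_at_def by blast

definition cont1 :: "'a::linordered_field list set \<Rightarrow> ('a list \<Rightarrow> 'a) \<Rightarrow> bool" where
  "cont1 X s \<longleftrightarrow> (\<forall>x\<in>X. \<forall>\<epsilon>>0. locally_at X x (\<lambda>y. \<bar>s x - s y\<bar> < \<epsilon>))"

lemma cont1D: "cont1 X s \<Longrightarrow> x \<in> X \<Longrightarrow> \<epsilon> > 0 \<Longrightarrow> locally_at X x (\<lambda>y. \<bar>s x - s y\<bar> < \<epsilon>)"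
  unfolding cont1_def by blast

lemma cont1_subset: "cont1 X s \<Longrightarrow> Y \<subseteq> X \<Longrightarrow> cont1 Y s"
  unfolding cont1_def locally_at_def by (meson subsetD)

lemma contin_single: "cont1 X s \<Longrightarrow> contin X (\<lambda>x. [s x])"
  unfolding cont1_def contin_def locally_at_def near_single .

lemma cont1_const: "cont1 X (\<lambda>x. c)"
  unfolding cont1_def locally_at_def using zero_less_one by auto

lemma cont1_add:
  assumes "cont1 X s" "cont1 X t"
  shows "cont1 X (\<lambda>x. s x + t x)"
  unfolding cont1_def
proof (intro ballI allI impI)
  fix x and \<epsilon> :: 'a assume x: "x \<in> X" "\<epsilon> > 0"
  define h where "h = \<epsilon> / 2"
  have h: "h > 0" "\<epsilon> = h + h" unfolding h_def using x(2) by auto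
  then have "locally_at X x (\<lambda>y. \<bar>s x - s y\<bar> < h \<and> \<bar>t x - t y\<bar> < h)"
    using x(1)
    using assms by (intro locally_at_conj cont1D) simp_all
  then show "locally_at X x (\<lambda>y. \<bar>s x + t x - (s y + t y)\<bar> < \<epsilon>)"
    by (rule locally_at_mono) (auto simp: abs_less_iff h(2))
qed

lemma cont1_uminus: "cont1 X s \<Longrightarrow> cont1 X (\<lambda>x. - s x)"
  unfolding cont1_def by (simp add: abs_minus_commute)

lemma cont1_diff: "cont1 X s \<Longrightarrow> cont1 X t \<Longrightarrow> cont1 X (\<lambda>x. s x - t x)"
  using cont1_add[of X s "\<lambda>x. - t x"] cont1_uminus[of X t] by simp

lemma cont1_max:
  assumes "cont1 X s" "cont1 X t"
  shows "cont1 X (\<lambda>x. max (s x) (t x))"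
  unfolding cont1_def
proof (intro ballI allI impI)
  fix x and \<epsilon> :: 'a assume x: "x \<in> X" "\<epsilon> > 0"
  then have "locally_at X x (\<lambda>y. \<bar>s x - s y\<bar> < \<epsilon> \<and> \<bar>t x - t y\<bar> < \<epsilon>)"
    using assms by (intro locally_at_conj cont1D) simp_all
  then show "locally_at X x (\<lambda>y. \<bar>max (s x) (t x) - max (s y) (t y)\<bar> < \<epsilon>)"
    by (rule locally_at_mono) (auto simp: abs_less_iff max_def)
qed

lemma cont1_divide:
  assumes k: "cont1 X k" and m: "cont1 X m" and pos: "\<And>x. x \<in> X \<Longrightarrow> 0 < m x"
  shows "cont1 X (\<lambda>x. k x / m x)"
  unfolding cont1_def
proof (intro ballI allI impI)
  fix x and \<epsilon> :: 'a assume x: "x \<in> X" "\<epsilon> > 0"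
  have mx: "0 < m x" using pos x by blast
  \<comment> \<open>Chosen so that the numerator of the difference, at most
    \<open>\<eta> * (\<bar>k x\<bar> + m x)\<close>, is \<open>\<epsilon> * m x * m x / 2\<close>;
    the bound \<open>m y > m x / 2\<close> then absorbs the denominator.\<close>
  define \<eta> where "\<eta> = \<epsilon> * (m x * m x / 2) / (\<bar>k x\<bar> + m x)"
  have \<eta>: "0 < \<eta>" unfolding \<eta>_def using mx x(2) by (simp add: add_nonneg_pos)
  have "locally_at X x (\<lambda>y. \<bar>m x - m y\<bar> < m x / 2 \<and> \<bar>m x - m y\<bar> < \<eta> \<and> \<bar>k x - k y\<bar> < \<eta>)"
    using assms x mx \<eta> by (intro locally_at_conj cont1D) simp_all
  then show "locally_at X x (\<lambda>y. \<bar>k x / m x - k y / m y\<bar> < \<epsilon>)"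
  proof (rule locally_at_mono)
    fix y assume y: "y \<in> X" "\<bar>m x - m y\<bar> < m x / 2 \<and> \<bar>m x - m y\<bar> < \<eta> \<and> \<bar>k x - k y\<bar> < \<eta>"
    have "m x - m y < m x / 2" using y(2) abs_ge_self le_less_trans by blast
    then have my: "m x / 2 < m y" by (simp add: field_simps)
    then have my0: "0 < m y" using pos y by blast
    have nz: "\<bar>k x\<bar> + m x \<noteq> 0" using mx abs_ge_zero[of "k x"] by linarith
    have "k x * m y - k y * m x = k x * (m y - m x) + m x * (k x - k y)" by (simp add: algebra_simps)
    also have "\<bar>\<dots>\<bar> \<le> \<bar>k x\<bar> * \<bar>m x - m y\<bar> + m x * \<bar>k x - k y\<bar>"
      using abs_triangle_ineq[of "k x * (m y - m x)" "m x * (k x - k y)"] mx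
      by (simp add: abs_mult abs_minus_commute)
    also have "\<dots> < \<bar>k x\<bar> * \<eta> + m x * \<eta>"
      using y(2) mx by (intro add_le_less_mono mult_left_mono mult_strict_left_mono) auto
    also have "\<dots> = \<eta> * (\<bar>k x\<bar> + m x)" by (simp add: algebra_simps)
    also have "\<dots> = \<epsilon> * (m x * m x / 2)"
      unfolding \<eta>_def times_divide_eq_left by (rule nonzero_mult_div_cancel_right[OF nz])
    also have "\<dots> = \<epsilon> * m x * (m x / 2)" by simp
    also have "\<dots> \<le> \<epsilon> * m x * m y" using my x(2) mx by (intro mult_left_mono) auto
    finally have "\<bar>k x * m y - k y * m x\<bar> < \<epsilon> * m x * m y" .
    moreover have "k x / m x - k y / m y = (k x * m y - k y * m x) / (m x * m y)"
      using mx my0 by (simp add: field_simps)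
    moreover have "0 < m x * m y" using mx my0 by simp
    ultimately show "\<bar>k x / m x - k y / m y\<bar> < \<epsilon>"
      by (simp add: abs_divide divide_less_eq mult.assoc)
  qed
qed

section \<open>Continuous suprema and selections\<close>

context o_minimal_expansion
begin

text \<open>By \<open>lip\<close>, moving by a distance below \<open>d\<close> costs at most
  \<open>d\<close> in the supremum, so it is Lipschitz with constant 1. Radii and selected cut
  points all get their continuity from here.\<close>

lemma definable_sup_lipschitz:
  assumes X: "dpred M (\<lambda>e. map e [0..<l] \<in> X)"
    and S: "dpred M (\<lambda>e. S (map e [0..<l]) (e l))"
    and ne: "\<And>x. x \<in> X \<Longrightarrow> \<exists>v. S x v" and bd: "\<And>x v. x \<in> X \<Longrightarrow> S x v \<Longrightarrow> v \<le> K"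
    and len: "X \<subseteq> {xs. length xs = l}"
    and lip: "\<And>x x' d v. x \<in> X \<Longrightarrow> x' \<in> X \<Longrightarrow> 0 < d \<Longrightarrow> near d x x' \<Longrightarrow> S x v \<Longrightarrow>
      \<exists>v'. S x' v' \<and> v - d \<le> v'"
  obtains s where "dterm M (\<lambda>e. s (map e [0..<l]))" "\<And>x v. x \<in> X \<Longrightarrow> S x v \<Longrightarrow> v \<le> s x"
    "\<And>x y. x \<in> X \<Longrightarrow> y < s x \<Longrightarrow> \<exists>v. S x v \<and> y < v" "cont1 X s"
proof -
  define lub where "lub = (\<lambda>x s. (\<forall>v. S x v \<longrightarrow> v \<le> s) \<and> (\<forall>y. y < s \<longrightarrow> (\<exists>v. S x v \<and> y < v)))"
  have lub_ex: "\<exists>s. lub x s" if x: "x \<in> X" for x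
  proof -
    have d: "dpred M (\<lambda>e. S x (e 0))"
      using x len by (intro dpred_app_list[OF S] dvec_const dpred_intros) auto
    obtain v where v: "S x v" using ne[OF x] by blast
    obtain s where "\<And>v. S x v \<Longrightarrow> v \<le> s" "\<And>y. y < s \<Longrightarrow> \<exists>v. S x v \<and> y < v"
      by (rule definable_lub[of "S x", OF d v]) (use bd[OF x] in blast)+
    then show ?thesis unfolding lub_def by blast
  qed
  have uniq: "lub x s \<Longrightarrow> lub x s' \<Longrightarrow> s = s'" for x s s'
    unfolding lub_def by (metis linorder_neqE not_le)
  define s where "s = (\<lambda>x. if x \<in> X then SOME b. lub x b else 0)"
  have s: "lub x (s x)" if "x \<in> X" for x
    unfolding s_def using someI_ex[OF lub_ex[OF that]] that by simp
  have iff: "s x = b \<longleftrightarrow> (if x \<in> X then lub x b else b = 0)" for x b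
    using s[of x] uniq[of x "s x" b] by (auto simp: s_def)
  have "dterm M (\<lambda>e. s (map e [0..<l]))"
    unfolding dterm_def iff lub_def
    by (intro dpred_if dpred_intros dpred_mem[OF X] dpred_app_list[OF S] dvec_intros)
  moreover have le: "s x \<le> s x' + d" if xx: "x \<in> X" "x' \<in> X" "0 < d" "near d x x'" for x x' d
  proof (rule ccontr)
    assume "\<not> s x \<le> s x' + d"
    then have "s x' + d < s x" by simp
    then obtain v where "S x v" "s x' + d < v" using s[OF xx(1)] unfolding lub_def by blast
    then obtain v' where "S x' v'" "v - d \<le> v'" using lip[OF xx] by blast
    then have "v - d \<le> s x'" using s[OF xx(2)] unfolding lub_def by force
    then show False using \<open>s x' + d < v\<close> by simp
  qed
  have "cont1 X s"
    unfolding cont1_def locally_at_def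
  proof (intro ballI allI impI)
    fix x and \<epsilon> :: 'a assume x: "x \<in> X" "\<epsilon> > 0"
    obtain d where d: "0 < d" "d < \<epsilon>" using dense x(2) by blast
    have "\<bar>s x - s y\<bar> < \<epsilon>" if "y \<in> X" "near d x y" for y
      using le[OF x(1) that(1) d(1) that(2)] le[OF that(1) x(1) d(1) near_sym[OF that(2)]] d(2)
      by (auto simp: abs_less_iff)
    then show "\<exists>\<delta>>0. \<forall>y\<in>X. near \<delta> x y \<longrightarrow> \<bar>s x - s y\<bar> < \<epsilon>" using d(1) by blast
  qed
  ultimately show ?thesis using that[of s] s unfolding lub_def by blast
qed

text \<open>
  With \<open>m x\<close> the largest radius \<open>r\<close> of a ball inside \<open>G\<close> centred at some \<open>(x, t)\<close>, and \<open>k x\<close> the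
  supremum of \<open>t * r\<close> over all such balls, the quotient \<open>k / m\<close> lies between two points of the fibre.
\<close>

lemma convex_open_selection:
  assumes Z: "dpred M (\<lambda>e. map e [0..<l] \<in> Z)" and len: "Z \<subseteq> {xs. length xs = l}"
    and G: "dpred M (\<lambda>e. G (map e [0..<l]) (e l))"
    and opn: "\<And>x t. x \<in> Z \<Longrightarrow> 0 \<le> t \<Longrightarrow> t \<le> 1 \<Longrightarrow> G x t \<Longrightarrow>
      \<exists>r>0. \<forall>x'\<in>Z. \<forall>t'. 0 \<le> t' \<and> t' \<le> 1 \<and> near r x x' \<and> \<bar>t' - t\<bar> < r \<longrightarrow> G x' t'"
    and convex: "\<And>x a b c. x \<in> Z \<Longrightarrow> 0 \<le> a \<Longrightarrow> b \<le> 1 \<Longrightarrow> G x a \<Longrightarrow> G x b \<Longrightarrow> a \<le> c \<Longrightarrow> c \<le> b \<Longrightarrow> G x c"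
    and ne: "\<And>x. x \<in> Z \<Longrightarrow> \<exists>t. 0 \<le> t \<and> t \<le> 1 \<and> G x t"
  obtains u where "dterm M (\<lambda>e. u (map e [0..<l]))" "cont1 Z u"
    "\<And>x. x \<in> Z \<Longrightarrow> 0 \<le> u x \<and> u x \<le> 1 \<and> G x (u x)"
proof -
  \<comment> \<open>Only points over \<open>Z\<close> with \<open>t'\<close> in the unit interval
    are tested. Radius 0 is vacuously admissible, which makes the sets of radii nonempty
    everywhere.\<close>
  define Ball where "Ball = (\<lambda>x t r. \<forall>x'. length x' = l \<longrightarrow> x' \<in> Z \<longrightarrow>
    (\<forall>t'. 0 \<le> t' \<and> t' \<le> 1 \<and> near r x x' \<and> \<bar>t' - t\<bar> < r \<longrightarrow> G x' t'))"
  have dBall: "dpred M (\<lambda>e. Ball (v e) (f e) (g e))" if "dvec M l v" "dterm M f" "dterm M g" for v f g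
    unfolding Ball_def
    by (intro dpred_intros dpred_mem[OF Z] dpred_app_list[OF G] dvec_intros dpred_near[where n = l]
        dvec_rename[OF that(1)] dterm_rename[OF that(2)] dterm_rename[OF that(3)])
  have Ball_mem: "G x t'" if "Ball x t r" "x \<in> Z" "0 \<le> t'" "t' \<le> 1" "\<bar>t' - t\<bar> < r" for x t t' r
    using that len near_refl[of r x] unfolding Ball_def by fastforce
  have Ball_0: "Ball x t 0" for x t unfolding Ball_def by auto
  have Ball_lip: "Ball x' t (max 0 (r - d))" if "Ball x t r" "0 < d" "near d x x'" for x x' t r d
  proof (cases "r - d \<le> 0")
    case True
    then show ?thesis using Ball_0 by (simp add: max_def)
  next
    case False
    have "near r x y" if "near (r - d) x' y" for y
      using near_trans[OF \<open>near d x x'\<close> that] by simp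
    then show ?thesis using False that(1,2) unfolding Ball_def by (auto simp: max_def)
  qed
  define Sm where "Sm = (\<lambda>x r. \<exists>t. 0 \<le> t \<and> t \<le> 1 \<and> 0 \<le> r \<and> r \<le> 1 \<and> Ball x t r)"
  define Sk where "Sk = (\<lambda>x w. \<exists>t r. 0 \<le> t \<and> t \<le> 1 \<and> 0 \<le> r \<and> r \<le> 1 \<and> Ball x t r \<and> w = t * r)"
  have dSm: "dpred M (\<lambda>e. Sm (map e [0..<l]) (e l))"
    unfolding Sm_def by (intro dpred_intros dBall dvec_intros)
  have dSk: "dpred M (\<lambda>e. Sk (map e [0..<l]) (e l))"
    unfolding Sk_def by (intro dpred_intros dBall dvec_intros)
  obtain m where m: "dterm M (\<lambda>e. m (map e [0..<l]))" "\<And>x v. x \<in> Z \<Longrightarrow> Sm x v \<Longrightarrow> v \<le> m x"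
    "\<And>x y. x \<in> Z \<Longrightarrow> y < m x \<Longrightarrow> \<exists>v. Sm x v \<and> y < v" "cont1 Z m"
  proof (rule definable_sup_lipschitz[OF Z dSm _ _ len])
    show "\<exists>v. Sm x v" for x unfolding Sm_def using Ball_0 by (intro exI[of _ 0]) auto
    show "v \<le> 1" if "Sm x v" for x v using that unfolding Sm_def by auto
    show "\<exists>v'. Sm x' v' \<and> v - d \<le> v'" if that: "0 < d" "near d x x'" "Sm x v" for x x' d v
    proof -
      note sm = that(3)
      obtain t where t: "0 \<le> t" "t \<le> 1" "0 \<le> v" "v \<le> 1" "Ball x t v" using sm unfolding Sm_def by blast
      have "Sm x' (max 0 (v - d))"
        unfolding Sm_def using t that(1) Ball_lip[OF t(5) that(1,2)] by (intro exI[of _ t]) auto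
      then show ?thesis by (intro exI[of _ "max 0 (v - d)"]) auto
    qed
  qed (rule that)
  obtain k where k: "dterm M (\<lambda>e. k (map e [0..<l]))" "\<And>x v. x \<in> Z \<Longrightarrow> Sk x v \<Longrightarrow> v \<le> k x"
    "\<And>x y. x \<in> Z \<Longrightarrow> y < k x \<Longrightarrow> \<exists>v. Sk x v \<and> y < v" "cont1 Z k"
  proof (rule definable_sup_lipschitz[OF Z dSk _ _ len])
    show "\<exists>v. Sk x v" for x unfolding Sk_def using Ball_0[of x 0] by (intro exI[of _ 0]) auto
    show "v \<le> 1" if "Sk x v" for x v using that unfolding Sk_def by (auto simp: mult_le_one)
    show "\<exists>v'. Sk x' v' \<and> v - d \<le> v'" if that: "0 < d" "near d x x'" "Sk x v" for x x' d v
    proof -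
      note sk = that(3)
      obtain t r where t: "0 \<le> t" "t \<le> 1" "0 \<le> r" "r \<le> 1" "Ball x t r" "v = t * r"
        using sk unfolding Sk_def by blast
      have "Sk x' (t * max 0 (r - d))"
        unfolding Sk_def using t that(1) Ball_lip[OF t(5) that(1,2)]
        by (intro exI[of _ t] exI[of _ "max 0 (r - d)"]) auto
      moreover have "t * r - d \<le> t * (r - d)"
        using t(1,2) that(1) mult_right_mono[of t 1 d] by (simp add: algebra_simps)
      moreover have "t * (r - d) \<le> t * max 0 (r - d)" using t(1) by (intro mult_left_mono) auto
      ultimately show ?thesis unfolding t(6) by (meson order_trans)
    qed
  qed (rule that)
  define u where "u = (\<lambda>x. k x / m x)"
  have mpos: "0 < m x" if x: "x \<in> Z" for x
  proof -
    obtain t where t: "0 \<le> t" "t \<le> 1" "G x t" using ne[OF x] by blast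
    obtain r where r: "r > 0" "\<forall>x'\<in>Z. \<forall>t'. 0 \<le> t' \<and> t' \<le> 1 \<and> near r x x' \<and> \<bar>t' - t\<bar> < r \<longrightarrow> G x' t'"
      using opn[OF x t] by blast
    have "Ball x t (min r 1)" unfolding Ball_def using r(2) near_mono[of "min r 1" x _ r] by auto
    then have "Sm x (min r 1)" unfolding Sm_def using t r(1) by auto
    then have "min r 1 \<le> m x" using m(2)[OF x] by blast
    then show ?thesis using r(1) by (meson less_le_trans min_less_iff_conj zero_less_one)
  qed
  have "dterm M (\<lambda>e. u (map e [0..<l]))" unfolding u_def by (intro dterm_divide k(1) m(1))
  moreover have "cont1 Z u" unfolding u_def by (rule cont1_divide[OF k(4) m(4) mpos])
  moreover have "0 \<le> u x \<and> u x \<le> 1 \<and> G x (u x)" if x: "x \<in> Z" for x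
  proof -
    have m1: "m x \<le> 1"
      using m(3)[OF x, of 1] unfolding Sm_def by (meson not_le)
    have km: "t * r \<le> k x" "r \<le> m x" if "0 \<le> t" "t \<le> 1" "0 \<le> r" "r \<le> 1" "Ball x t r" for t r
      using that k(2)[OF x, of "t * r"] m(2)[OF x, of r] unfolding Sk_def Sm_def by blast+
    have k0: "0 \<le> k x" using km(1)[of 0 0] Ball_0 by simp
    have kle: "k x \<le> m x"
    proof (rule ccontr)
      assume "\<not> k x \<le> m x"
      then obtain t r where "0 \<le> t" "t \<le> 1" "0 \<le> r" "r \<le> 1" "Ball x t r" "m x < t * r"
        using k(3)[OF x, of "m x"] unfolding Sk_def by auto
      then show False using km(2)[of t r] mult_left_le_one_le[of r t] by auto
    qed
    have u01: "0 \<le> u x" "u x \<le> 1" unfolding u_def using k0 kle mpos[OF x] by auto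
    have um: "u x * m x = k x" unfolding u_def using mpos[OF x] by simp
    have "\<exists>a. 0 \<le> a \<and> G x a \<and> a \<le> u x"
    proof -
      \<comment> \<open>A ball of radius \<open>v\<close> above \<open>m x * (1 - \<eta>)\<close>
        has a centre with \<open>t * (1 - \<eta>) \<le> u x\<close>, because
        \<open>t * v \<le> k x\<close>. So \<open>t - \<eta>\<close> is at most \<open>u x\<close>,
        and it lies in the ball since \<open>\<eta> < v\<close>.\<close>
      define \<eta> where "\<eta> = m x / 2"
      have \<eta>: "0 < \<eta>" "\<eta> \<le> 1 / 2" "m x = \<eta> + \<eta>" unfolding \<eta>_def using mpos[OF x] m1 by auto
      have "m x * (1 - \<eta>) < m x" using mpos[OF x] \<eta> by (simp add: algebra_simps)
      then obtain v t where v: "m x * (1 - \<eta>) < v" "0 \<le> t" "t \<le> 1" "0 \<le> v" "v \<le> 1" "Ball x t v"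
        using m(3)[OF x] unfolding Sm_def by blast
      have "m x * (1 / 2) \<le> m x * (1 - \<eta>)" using \<eta> mpos[OF x] by (intro mult_left_mono) auto
      then have "\<eta> < v" using v(1) unfolding \<eta>_def by simp
      then have G: "G x (max 0 (t - \<eta>))"
        by (intro Ball_mem[OF v(6) x]) (use v \<eta> in \<open>auto simp: max_def abs_if\<close>)
      have "t * (m x * (1 - \<eta>)) \<le> t * v" using v by (intro mult_left_mono) auto
      also have "\<dots> \<le> u x * m x" unfolding um using km(1) v by blast
      finally have "(t * (1 - \<eta>)) * m x \<le> u x * m x" by (simp add: algebra_simps)
      then have "t * (1 - \<eta>) \<le> u x" using mpos[OF x] by simp
      moreover have "t * \<eta> \<le> 1 * \<eta>" using v(3) \<eta>(1) by (intro mult_right_mono) auto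
      ultimately have "t - \<eta> \<le> u x" by (simp add: algebra_simps)
      then show ?thesis using G u01(1) by (intro exI[of _ "max 0 (t - \<eta>)"]) auto
    qed
    then obtain a where a: "0 \<le> a" "G x a" "a \<le> u x" by blast
    have "\<exists>b. b \<le> 1 \<and> G x b \<and> u x \<le> b"
    proof (cases "k x = 0")
      case True
      then have "u x = 0" unfolding u_def by simp
      then show ?thesis using ne[OF x] by auto
    next
      case False
      \<comment> \<open>Here the product \<open>t * v\<close> nearly attains \<open>k x\<close>.
        From \<open>v \<le> m x\<close> follows \<open>u x < t + \<eta>\<close>, and again
        \<open>\<eta> < v\<close> keeps this point inside the ball.\<close>
      define \<eta> where "\<eta> = k x / 2"
      have \<eta>: "0 < \<eta>" "k x = \<eta> + \<eta>" unfolding \<eta>_def using k0 False by auto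
      have "\<eta> * m x \<le> \<eta> * 1" using \<eta>(1) m1 by (intro mult_left_mono) auto
      have "k x - \<eta> * m x < k x" using \<eta>(1) mpos[OF x] by simp
      then obtain t v where v: "k x - \<eta> * m x < t * v" "0 \<le> t" "t \<le> 1" "0 \<le> v" "v \<le> 1" "Ball x t v"
        using k(3)[OF x] unfolding Sk_def by blast
      have "t * v \<le> v" using v by (simp add: mult_left_le_one_le)
      then have "\<eta> < v" using v(1) \<open>\<eta> * m x \<le> \<eta> * 1\<close> \<eta>(2) by simp
      then have G: "G x (min 1 (t + \<eta>))"
        by (intro Ball_mem[OF v(6) x]) (use v \<eta> in \<open>auto simp: min_def abs_if\<close>)
      have "t * v \<le> t * m x" using km(2)[OF v(2-6)] v(2) by (rule mult_left_mono)
      then have "u x * m x < (t + \<eta>) * m x" using v(1) unfolding um by (simp add: algebra_simps)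
      then have "u x < t + \<eta>" using mpos[OF x] by simp
      then show ?thesis using G u01(2) by (intro exI[of _ "min 1 (t + \<eta>)"]) auto
    qed
    then obtain b where b: "b \<le> 1" "G x b" "u x \<le> b" by blast
    show ?thesis using convex[OF x a(1) b(1) a(2) b(2) a(3) b(3)] u01 by blast
  qed
  ultimately show ?thesis using that[of u] by blast
qed

end

section \<open>Extending partial lifts over a cylinder\<close>

definition cyl :: "'a::linordered_field list set \<Rightarrow> ('a list \<Rightarrow> 'a \<Rightarrow> bool) \<Rightarrow> 'a list set" where
  "cyl X P = {x @ [t] |x t. x \<in> X \<and> 0 \<le> t \<and> t \<le> 1 \<and> P x t}"

lemma mem_cyl [simp]: "x @ [t] \<in> cyl X P \<longleftrightarrow> x \<in> X \<and> 0 \<le> t \<and> t \<le> 1 \<and> P x t"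
  unfolding cyl_def by auto

lemma cylE:
  assumes "z \<in> cyl X P"
  obtains x t where "z = x @ [t]" "x \<in> X" "0 \<le> t" "t \<le> 1" "P x t"
  using assms unfolding cyl_def by blast

lemma cyl_subset: "(\<And>x t. x \<in> X \<Longrightarrow> 0 \<le> t \<Longrightarrow> t \<le> 1 \<Longrightarrow> P x t \<Longrightarrow> Q x t) \<Longrightarrow> cyl X P \<subseteq> cyl X Q"
  unfolding cyl_def by blast

lemma cyl_length: "X \<subseteq> {xs. length xs = l} \<Longrightarrow> cyl X P \<subseteq> {xs. length xs = Suc l}"
  unfolding cyl_def by auto

lemma times_unit_interval: "X \<otimes>\<^sub>d unit_interval = cyl X (\<lambda>_ _. True)"
proof (intro equalityI subsetI)
  fix z assume "z \<in> X \<otimes>\<^sub>d unit_interval"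
  then show "z \<in> cyl X (\<lambda>_ _. True)" unfolding times_set_def unit_interval_def by auto
next
  fix z assume "z \<in> cyl X (\<lambda>_ _. True)"
  then obtain x t where "z = x @ [t]" "x \<in> X" "0 \<le> t" "t \<le> 1" by (rule cylE)
  moreover from this have "[t] \<in> unit_interval" unfolding unit_interval_def by simp
  ultimately show "z \<in> X \<otimes>\<^sub>d unit_interval" unfolding times_set_def by blast
qed

lemma map_upt_Suc: "map e [0..<Suc l] = map e [0..<l] @ [e l]"
  by simp

lemma map_upt_add: "map e [0..<a + b] = map e [0..<a] @ map (\<lambda>i. e (a + i)) [0..<b]"
  by (rule nth_equalityI) (auto simp: nth_append)

lemma dpred_cyl:
  assumes "dpred M (\<lambda>e. map e [0..<l] \<in> X)" "dpred M (\<lambda>e. P (map e [0..<l]) (e l))"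
  shows "dpred M (\<lambda>e. map e [0..<Suc l] \<in> cyl X P)"
  unfolding map_upt_Suc mem_cyl by (intro dpred_intros assms)

text \<open>Maps are total functions, but only their graph over \<open>D\<close> is definable. A
  value can therefore enter a formula only together with membership of the argument in
  \<open>D\<close>, which is the form of \<open>dgraph_app\<close>.\<close>

definition dgraph ::
  "('f, 'r, 'a::linordered_field) expansion \<Rightarrow> nat \<Rightarrow> nat \<Rightarrow> 'a list set \<Rightarrow> ('a list \<Rightarrow> 'a list) \<Rightarrow> bool" where
  "dgraph M a b D h \<longleftrightarrow> dpred M (\<lambda>e. map e [0..<a + b] \<in> (\<lambda>x. x @ h x) ` D)"

lemma mem_graph_image:
  assumes "D \<subseteq> {xs. length xs = a}" "length v = a"
  shows "v @ w \<in> (\<lambda>x. x @ h x) ` D \<longleftrightarrow> v \<in> D \<and> h v = w"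
proof
  assume "v @ w \<in> (\<lambda>x. x @ h x) ` D"
  then obtain x where x: "x \<in> D" "v @ w = x @ h x" by blast
  then have "length x = length v" using assms by blast
  then show "v \<in> D \<and> h v = w" using x by (simp add: append_eq_append_conv)
qed (auto simp: image_iff)

lemma dgraph_app:
  assumes "dgraph M a b D h" "D \<subseteq> {xs. length xs = a}" "dvec M a v" "dvec M b w"
  shows "dpred M (\<lambda>e. v e \<in> D \<and> h (v e) = w e)"
proof -
  have "dpred M (\<lambda>e. v e @ w e \<in> (\<lambda>x. x @ h x) ` D)"
    by (rule dpred_mem[OF assms(1)[unfolded dgraph_def] dvec_append[OF assms(3,4)]])
  then show ?thesis
    by (rule dpred_cong) (rule mem_graph_image[OF assms(2)], use assms(3) in \<open>simp add: dvec_def\<close>)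
qed

lemma dgraphI:
  assumes "D \<subseteq> {xs. length xs = a}"
    and "dpred M (\<lambda>e. map e [0..<a] \<in> D \<and> h (map e [0..<a]) = map (\<lambda>i. e (a + i)) [0..<b])"
  shows "dgraph M a b D h"
  unfolding dgraph_def
  by (rule dpred_cong[OF assms(2)]) (simp add: map_upt_add mem_graph_image[OF assms(1)])

lemma contin_take: "contin S (take j)"
  unfolding contin_def near_def by (intro ballI allI impI, rule_tac x = \<epsilon> in exI) auto

lemma contin_drop: "contin S (drop j)"
  unfolding contin_def near_def by (intro ballI allI impI, rule_tac x = \<epsilon> in exI) auto

lemma cont1_take:
  assumes "cont1 Z s" "\<And>z. z \<in> Q \<Longrightarrow> take l z \<in> Z"
  shows "cont1 Q (\<lambda>z. s (take l z))"
  unfolding cont1_def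
proof (intro ballI allI impI)
  fix z and \<epsilon> :: 'a assume z: "z \<in> Q" "\<epsilon> > 0"
  obtain \<delta> where \<delta>: "\<delta> > 0" "\<forall>y\<in>Z. near \<delta> (take l z) y \<longrightarrow> \<bar>s (take l z) - s y\<bar> < \<epsilon>"
    using cont1D[OF assms(1) assms(2)[OF z(1)] z(2)] unfolding locally_at_def by blast
  have "near \<delta> (take l z) (take l y)" if "near \<delta> z y" for y
    using that unfolding near_def by auto
  then show "locally_at Q z (\<lambda>y. \<bar>s (take l z) - s (take l y)\<bar> < \<epsilon>)"
    unfolding locally_at_def using \<delta> assms(2) by blast
qed

section \<open>Relatively closed subsets of the cylinder\<close>

lemma rel_closed_Un:
  assumes "rel_closed Y A" "rel_closed Y B"
  shows "rel_closed Y (A \<union> B)"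
  unfolding rel_closed_def
proof
  fix x assume x: "x \<in> Y - (A \<union> B)"
  then obtain r r' where "r > 0" "\<forall>y\<in>A \<inter> Y. \<not> near r x y" "r' > 0" "\<forall>y\<in>B \<inter> Y. \<not> near r' x y"
    using assms unfolding rel_closed_def by blast
  then show "\<exists>r>0. \<forall>y\<in>(A \<union> B) \<inter> Y. \<not> near r x y"
    by (intro exI[of _ "min r r'"]) (auto dest: near_mono[OF _ min.cobounded1] near_mono[OF _ min.cobounded2])
qed

lemma rel_closed_Int: "rel_closed Y A \<Longrightarrow> rel_closed Y B \<Longrightarrow> rel_closed Y (A \<inter> B)"
  unfolding rel_closed_def by blast

lemma rel_closed_subset: "rel_closed Y D \<Longrightarrow> Y' \<subseteq> Y \<Longrightarrow> rel_closed Y' D"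
  unfolding rel_closed_def by blast

text \<open>As \<open>a\<close> is continuous only on \<open>Z\<close>, two kinds of points outside
  the set are separated from it differently: those over \<open>X - Z\<close> by closedness of
  \<open>Z\<close>, those over \<open>Z\<close> by continuity of \<open>a\<close>.\<close>

lemma rel_closed_cyl:
  assumes X: "X \<subseteq> {xs. length xs = l}" and Z: "Z \<subseteq> X" "rel_closed X Z" and a: "cont1 Z a"
  shows "rel_closed (cyl X (\<lambda>_ _. True)) (cyl X (\<lambda>x t. x \<in> Z \<and> t \<le> a x))"
    and "rel_closed (cyl X (\<lambda>_ _. True)) (cyl X (\<lambda>x t. x \<in> Z \<and> a x \<le> t))"
proof -
  have len: "length x = length x'" if "x \<in> X" "x' \<in> X" for x x' using that X by blast
  have out: "\<exists>r>0. \<forall>y\<in>cyl X (\<lambda>x t. x \<in> Z \<and> P x t). \<not> near r (x @ [t]) y" if xX: "x \<in> X" "x \<notin> Z" for x t P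
  proof -
    obtain r where r: "r > 0" "\<forall>y\<in>Z \<inter> X. \<not> near r x y" using Z(2) xX unfolding rel_closed_def by blast
    have "\<not> near r (x @ [t]) y" if yc: "y \<in> cyl X (\<lambda>x t. x \<in> Z \<and> P x t)" for y
    proof -
      obtain x' t' where y: "y = x' @ [t']" "x' \<in> X" "x' \<in> Z \<and> P x' t'" using yc by (rule cylE)
      then have "\<not> near r x x'" using r(2) by blast
      then show ?thesis unfolding y(1) near_snoc[OF len[OF xX(1) y(2)]] by blast
    qed
    then show ?thesis using r(1) by blast
  qed
  \<comment> \<open>Both sides of the graph are treated at once: \<open>P\<close> is a condition on
    the signed height above the graph that fails within distance \<open>\<bar>t - a x\<bar>\<close>
    of the given height. One half of this distance is spent on \<open>t\<close>, the other on
    \<open>a\<close>.\<close>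
  have inn: "\<exists>r>0. \<forall>y\<in>cyl X (\<lambda>x t. x \<in> Z \<and> P (t - a x)). \<not> near r (x @ [t]) y"
    if x: "x \<in> Z" "t \<noteq> a x" and P: "\<And>v. \<bar>(t - a x) - v\<bar> < \<bar>t - a x\<bar> \<Longrightarrow> \<not> P v" for x t P
  proof -
    define \<epsilon> where "\<epsilon> = \<bar>t - a x\<bar> / 2"
    have \<epsilon>: "\<epsilon> > 0" "\<bar>t - a x\<bar> = \<epsilon> + \<epsilon>" unfolding \<epsilon>_def using x(2) by auto
    obtain \<delta> where \<delta>: "\<delta> > 0" "\<And>y. y \<in> Z \<Longrightarrow> near \<delta> x y \<Longrightarrow> \<bar>a x - a y\<bar> < \<epsilon>"
      using cont1D[OF a x(1) \<epsilon>(1)] unfolding locally_at_def by blast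
    have "\<not> near (min \<delta> \<epsilon>) (x @ [t]) y" if yc: "y \<in> cyl X (\<lambda>x t. x \<in> Z \<and> P (t - a x))" for y
    proof
      assume nr: "near (min \<delta> \<epsilon>) (x @ [t]) y"
      obtain x' t' where y: "y = x' @ [t']" "x' \<in> X" "x' \<in> Z \<and> P (t' - a x')" using yc by (rule cylE)
      have "near (min \<delta> \<epsilon>) x x'" "\<bar>t - t'\<bar> < \<epsilon>" using nr y len[of x x'] x(1) Z(1) by (auto simp: near_snoc)
      then have "\<bar>a x - a x'\<bar> < \<epsilon>" using \<delta>(2)[of x'] y(3) near_mono[of _ x x' \<delta>] by auto
      then have "\<bar>(t - a x) - (t' - a x')\<bar> < \<epsilon> + \<epsilon>"
        using \<open>\<bar>t - t'\<bar> < \<epsilon>\<close> by (auto simp: abs_if split: if_splits)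
      then show False using P[of "t' - a x'"] y(3) \<epsilon>(2) by simp
    qed
    then show ?thesis using \<delta>(1) \<epsilon>(1) by (intro exI[of _ "min \<delta> \<epsilon>"]) auto
  qed
  show "rel_closed (cyl X (\<lambda>_ _. True)) (cyl X (\<lambda>x t. x \<in> Z \<and> t \<le> a x))"
    unfolding rel_closed_def
  proof
    fix z assume z: "z \<in> cyl X (\<lambda>_ _. True) - cyl X (\<lambda>x t. x \<in> Z \<and> t \<le> a x)"
    obtain x t where xt: "z = x @ [t]" "x \<in> X" "0 \<le> t" "t \<le> 1" using cylE z by blast
    have nxt: "\<not> (x \<in> Z \<and> t \<le> a x)" using z xt by auto
    have "\<exists>r>0. \<forall>y\<in>cyl X (\<lambda>x t. x \<in> Z \<and> t \<le> a x). \<not> near r (x @ [t]) y"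
    proof (cases "x \<in> Z")
      case True
      then show ?thesis using inn[of x t "\<lambda>v. v \<le> 0"] nxt by (simp add: abs_if split: if_splits)
    qed (rule out[OF xt(2)])
    then show "\<exists>r>0. \<forall>y\<in>cyl X (\<lambda>x t. x \<in> Z \<and> t \<le> a x) \<inter> cyl X (\<lambda>_ _. True). \<not> near r z y"
      unfolding xt(1) by blast
  qed
  show "rel_closed (cyl X (\<lambda>_ _. True)) (cyl X (\<lambda>x t. x \<in> Z \<and> a x \<le> t))"
    unfolding rel_closed_def
  proof
    fix z assume z: "z \<in> cyl X (\<lambda>_ _. True) - cyl X (\<lambda>x t. x \<in> Z \<and> a x \<le> t)"
    obtain x t where xt: "z = x @ [t]" "x \<in> X" "0 \<le> t" "t \<le> 1" using cylE z by blast
    have nxt: "\<not> (x \<in> Z \<and> a x \<le> t)" using z xt by auto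
    have "\<exists>r>0. \<forall>y\<in>cyl X (\<lambda>x t. x \<in> Z \<and> a x \<le> t). \<not> near r (x @ [t]) y"
    proof (cases "x \<in> Z")
      case True
      then show ?thesis using inn[of x t "\<lambda>v. 0 \<le> v"] nxt by (simp add: abs_if split: if_splits)
    qed (rule out[OF xt(2)])
    then show "\<exists>r>0. \<forall>y\<in>cyl X (\<lambda>x t. x \<in> Z \<and> a x \<le> t) \<inter> cyl X (\<lambda>_ _. True). \<not> near r z y"
      unfolding xt(1) by blast
  qed
qed

text \<open>
  All that is used about a bundle: over a trivialising set \<open>U\<close>, \<open>T b y\<close> moves the point \<open>y\<close>
  to the fibre over \<open>b\<close> along the trivialisation.
\<close>

definition transport ::
  "('f, 'r, 'a::linordered_field) expansion \<Rightarrow> nat \<Rightarrow> nat \<Rightarrow> 'a list set \<Rightarrow> ('a list \<Rightarrow> 'a list) \<Rightarrow>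
    'a list set \<Rightarrow> ('a list \<Rightarrow> 'a list \<Rightarrow> 'a list) \<Rightarrow> bool" where
  "transport M n m E p U T \<longleftrightarrow>
    (\<forall>b\<in>U. \<forall>y\<in>E. p y \<in> U \<longrightarrow> T b y \<in> E \<and> p (T b y) = b) \<and>
    (\<forall>y\<in>E. p y \<in> U \<longrightarrow> T (p y) y = y) \<and>
    (\<forall>u v w. dvec M n u \<and> dvec M m v \<and> dvec M m w \<longrightarrow>
      dpred M (\<lambda>e. u e \<in> U \<and> v e \<in> E \<and> p (v e) \<in> U \<and> T (u e) (v e) = w e)) \<and>
    contin {b @ y |b y. b \<in> U \<and> y \<in> E \<and> p y \<in> U} (\<lambda>z. T (take n z) (drop n z))"

text \<open>The homotopy problem in terms of radii and definable predicates; the trivialisations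
  enter only through the transports \<open>T\<close>.\<close>

locale lifting_problem = o_minimal_expansion M
  for M :: "('f, 'r, 'a::linordered_field) expansion" +
  fixes l n m k :: nat and X B E :: "'a list set" and f p :: "'a list \<Rightarrow> 'a list"
    and U :: "nat \<Rightarrow> 'a list set" and T :: "nat \<Rightarrow> 'a list \<Rightarrow> 'a list \<Rightarrow> 'a list"
  assumes X_len: "X \<subseteq> {xs. length xs = l}" and B_len: "B \<subseteq> {xs. length xs = n}"
    and E_len: "E \<subseteq> {xs. length xs = m}"
    and X_def: "dpred M (\<lambda>e. map e [0..<l] \<in> X)"
    and f_B: "f \<in> cyl X (\<lambda>_ _. True) \<rightarrow> B"
    and f_graph: "dgraph M (Suc l) n (cyl X (\<lambda>_ _. True)) f"
    and f_contin: "contin (cyl X (\<lambda>_ _. True)) f"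
    and B_cover: "B = (\<Union>i\<in>{1..k}. U i)"
    and U_def: "\<And>i. i \<in> {1..k} \<Longrightarrow> dpred M (\<lambda>e. map e [0..<n] \<in> U i)"
    and U_open: "\<And>i x. i \<in> {1..k} \<Longrightarrow> x \<in> U i \<Longrightarrow> \<exists>r>0. \<forall>y\<in>B. near r x y \<longrightarrow> y \<in> U i"
    and T: "\<And>i. i \<in> {1..k} \<Longrightarrow> transport M n m E p (U i) (T i)"
begin

lemma T_mem: "i \<in> {1..k} \<Longrightarrow> b \<in> U i \<Longrightarrow> y \<in> E \<Longrightarrow> p y \<in> U i \<Longrightarrow> T i b y \<in> E"
  and p_T: "i \<in> {1..k} \<Longrightarrow> b \<in> U i \<Longrightarrow> y \<in> E \<Longrightarrow> p y \<in> U i \<Longrightarrow> p (T i b y) = b"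
  and T_id: "i \<in> {1..k} \<Longrightarrow> y \<in> E \<Longrightarrow> p y \<in> U i \<Longrightarrow> T i (p y) y = y"
  and T_graph: "i \<in> {1..k} \<Longrightarrow> dvec M n u \<Longrightarrow> dvec M m v \<Longrightarrow> dvec M m w \<Longrightarrow>
      dpred M (\<lambda>e. u e \<in> U i \<and> v e \<in> E \<and> p (v e) \<in> U i \<and> T i (u e) (v e) = w e)"
  and T_contin: "i \<in> {1..k} \<Longrightarrow>
      contin {b @ y |b y. b \<in> U i \<and> y \<in> E \<and> p y \<in> U i} (\<lambda>z. T i (take n z) (drop n z))"
  using T unfolding transport_def by simp_all

abbreviation Y :: "'a list set" where
  "Y \<equiv> cyl X (\<lambda>_ _. True)"

text \<open>Membership in \<open>Y\<close> is included, so that asserting \<open>V\<close> along a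
  segment also asserts that the segment stays in the unit interval.\<close>

definition V :: "nat \<Rightarrow> 'a list \<Rightarrow> 'a \<Rightarrow> bool" where
  "V i x t \<longleftrightarrow> x @ [t] \<in> Y \<and> f (x @ [t]) \<in> U i"

text \<open>A partial lift of \<open>f\<close>, bundled with the definability and continuity that
  the next extension step needs.\<close>

definition sect :: "'a list set \<Rightarrow> ('a list \<Rightarrow> 'a list) \<Rightarrow> bool" where
  "sect D h \<longleftrightarrow> D \<subseteq> Y \<and> dpred M (\<lambda>e. map e [0..<Suc l] \<in> D) \<and> h \<in> D \<rightarrow> E \<and>
    dgraph M (Suc l) m D h \<and> contin D h \<and> (\<forall>z\<in>D. p (h z) = f z)"

lemma Y_len: "Y \<subseteq> {xs. length xs = Suc l}"
  by (rule cyl_length[OF X_len])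

lemma dpred_V:
  assumes "i \<in> {1..k}" "dvec M l v" "dterm M g"
  shows "dpred M (\<lambda>e. V i (v e) (g e))"
proof (rule dpred_app_list[OF _ assms(2,3)])
  have "dpred M (\<lambda>e. \<exists>b. length b = n \<and> (map e [0..<l] @ [e l] \<in> Y \<and> f (map e [0..<l] @ [e l]) = b) \<and> b \<in> U i)"
    by (intro dpred_ex_list dpred_conj dgraph_app[OF f_graph Y_len] dpred_mem[OF U_def[OF assms(1)]]
        dvec_intros dterm_var)
  then show "dpred M (\<lambda>e. V i (map e [0..<l]) (e l))"
    unfolding V_def by (rule dpred_cong) (use f_B B_len in \<open>auto simp del: mem_cyl\<close>)
qed

lemma V_dom: "V i x t \<Longrightarrow> x \<in> X \<and> 0 \<le> t \<and> t \<le> 1"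
  unfolding V_def by simp

lemma V_cover: "x \<in> X \<Longrightarrow> 0 \<le> t \<Longrightarrow> t \<le> 1 \<Longrightarrow> \<exists>i\<in>{1..k}. V i x t"
  unfolding V_def using f_B B_cover by (metis (no_types, lifting) PiE UN_E mem_cyl)

lemma V_open:
  assumes i: "i \<in> {1..k}" and V: "V i x t"
  shows "\<exists>r>0. \<forall>x'\<in>X. near r x x' \<longrightarrow> (\<forall>t'. 0 \<le> t' \<and> t' \<le> 1 \<and> \<bar>t' - t\<bar> < r \<longrightarrow> V i x' t')"
proof -
  have xt: "x @ [t] \<in> Y" "f (x @ [t]) \<in> U i" using V unfolding V_def by auto
  obtain r where r: "r > 0" "\<forall>y\<in>B. near r (f (x @ [t])) y \<longrightarrow> y \<in> U i" using U_open[OF i xt(2)] by blast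
  obtain d where d: "d > 0" "\<forall>y\<in>Y. near d (x @ [t]) y \<longrightarrow> near r (f (x @ [t])) (f y)"
    using f_contin xt(1) r(1) unfolding contin_def by blast
  have "V i x' t'" if "x' \<in> X" "near d x x'" "0 \<le> t'" "t' \<le> 1" "\<bar>t' - t\<bar> < d" for x' t'
  proof -
    have y: "x' @ [t'] \<in> Y" using that by simp
    have "near d (x @ [t]) (x' @ [t'])"
      using that by (subst near_snoc) (auto simp: near_def abs_minus_commute)
    then have "near r (f (x @ [t])) (f (x' @ [t']))" using d(2) y by blast
    moreover have "f (x' @ [t']) \<in> B" using f_B y by blast
    ultimately show ?thesis unfolding V_def using r(2) y by blast
  qed
  then show ?thesis using d(1) by blast
qed

lemma sect_subset:
  assumes "sect D h" "D' \<subseteq> D" "dpred M (\<lambda>e. map e [0..<Suc l] \<in> D')"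
  shows "sect D' h"
proof -
  have D: "D \<subseteq> Y" "dgraph M (Suc l) m D h" using assms(1) unfolding sect_def by auto
  have len: "D \<subseteq> {xs. length xs = Suc l}" using D(1) Y_len by blast
  have "dgraph M (Suc l) m D' h"
  proof (rule dgraphI)
    have "dpred M (\<lambda>e. map e [0..<Suc l] \<in> D' \<and> (map e [0..<Suc l] \<in> D \<and>
        h (map e [0..<Suc l]) = map (\<lambda>i. e (Suc l + i)) [0..<m]))"
      by (intro dpred_conj dgraph_app[OF D(2) len] dvec_vars assms(3))
    then show "dpred M (\<lambda>e. map e [0..<Suc l] \<in> D' \<and> h (map e [0..<Suc l]) = map (\<lambda>i. e (Suc l + i)) [0..<m])"
      by (rule dpred_cong) (use assms(2) in blast)
  qed (use len assms(2) in blast)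
  then show ?thesis
    using assms unfolding sect_def by (auto intro: contin_subset)
qed

text \<open>Over \<open>x\<close> the lift is already known at height \<open>r x\<close>, and both
  this point and \<open>x @ [t]\<close> lie in the same trivialising set, so its value is
  transported to the fibre over \<open>f (x @ [t])\<close>. On the overlap \<open>r x = t\<close>,
  where transport is the identity; the two closed pieces therefore paste.\<close>

lemma sect_extend:
  assumes h: "sect D h" and i: "i \<in> {1..k}"
    and Q: "Q \<subseteq> Y" "dpred M (\<lambda>e. map e [0..<Suc l] \<in> Q)"
    and r: "dterm M (\<lambda>e. r (map e [0..<l]))" "cont1 Q (\<lambda>z. r (take l z))"
    and rD: "\<And>x t. x @ [t] \<in> Q \<Longrightarrow> x @ [r x] \<in> D \<and> V i x t \<and> V i x (r x)"
    and rid: "\<And>x t. x @ [t] \<in> Q \<Longrightarrow> x @ [t] \<in> D \<Longrightarrow> r x = t"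
    and closed: "rel_closed Y D" "rel_closed Y Q"
  obtains h' where "sect (D \<union> Q) h'" "\<And>z. z \<in> D \<Longrightarrow> h' z = h z"
proof -
  have D: "D \<subseteq> Y" "dpred M (\<lambda>e. map e [0..<Suc l] \<in> D)" "h \<in> D \<rightarrow> E" "dgraph M (Suc l) m D h"
    "contin D h" "\<And>z. z \<in> D \<Longrightarrow> p (h z) = f z"
    using h unfolding sect_def by auto
  have lenD: "D \<subseteq> {xs. length xs = Suc l}" and lenQ: "Q \<subseteq> {xs. length xs = Suc l}"
    using D(1) Q(1) Y_len by blast+
  define rr where "rr = (\<lambda>z. take l z @ [r (take l z)])"
  define g where "g = (\<lambda>z. T i (f z) (h (rr z)))"
  define h' where "h' = (\<lambda>z. if z \<in> D then h z else g z)"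
  have split: "\<exists>x t. z = x @ [t] \<and> length x = l \<and> take l z = x" if z: "z \<in> Q" for z
  proof -
    obtain x t where "z = x @ [t]" "x \<in> X" using z Q(1) cylE by blast
    then show ?thesis using X_len by auto
  qed
  have Qz: "rr z \<in> D \<and> f z \<in> U i \<and> f (rr z) \<in> U i \<and> (z \<in> D \<longrightarrow> rr z = z)" if z: "z \<in> Q" for z
  proof -
    obtain x t where xt: "z = x @ [t]" "take l z = x" using split[OF z] by blast
    have "rr z = x @ [r x]" unfolding rr_def xt(2) ..
    then show ?thesis using rD[of x t] rid[of x t] z unfolding xt(1) V_def by auto
  qed
  have gz: "h (rr z) \<in> E" "p (h (rr z)) \<in> U i" "g z \<in> E" "p (g z) = f z" "z \<in> D \<Longrightarrow> g z = h z" if z: "z \<in> Q" for z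
  proof -
    show e: "h (rr z) \<in> E" using Qz[OF z] D(3) by blast
    show pu: "p (h (rr z)) \<in> U i" using Qz[OF z] D(6) by simp
    show "g z \<in> E" "p (g z) = f z" unfolding g_def using T_mem[OF i _ e pu] p_T[OF i _ e pu] Qz[OF z] by auto
    show "g z = h z" if "z \<in> D"
      unfolding g_def using T_id[OF i e pu] Qz[OF z] D(6)[OF that] that by simp
  qed
  have "sect (D \<union> Q) h'"
    unfolding sect_def
  proof (intro conjI)
    show "D \<union> Q \<subseteq> Y" using D(1) Q(1) by blast
    show "dpred M (\<lambda>e. map e [0..<Suc l] \<in> D \<union> Q)"
      unfolding Un_iff by (intro dpred_disj D(2) Q(2))
    show "h' \<in> D \<union> Q \<rightarrow> E" unfolding h'_def using D(3) gz(3) by auto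
    show "\<forall>z\<in>D \<union> Q. p (h' z) = f z" unfolding h'_def using D(6) gz(4) by auto
    have fQ: "contin Q f" using contin_subset[OF f_contin Q(1)] .
    have "contin Q rr"
      unfolding rr_def by (rule contin_append[OF contin_take contin_single[OF r(2)], of l]) (use lenQ in auto)
    then have hQ: "contin Q (\<lambda>z. h (rr z))" by (rule contin_compose[OF _ D(5)]) (use Qz in auto)
    have "contin Q (\<lambda>z. f z @ h (rr z))"
      by (rule contin_append[OF fQ hQ, of n]) (use f_B Q(1) B_len in blast)
    then have "contin Q (\<lambda>z. T i (take n (f z @ h (rr z))) (drop n (f z @ h (rr z))))"
      by (rule contin_compose[OF _ T_contin[OF i]]) (use Qz gz in blast)
    moreover have "length (f z) = n" if "z \<in> Q" for z using f_B Q(1) B_len that by blast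
    ultimately have "contin Q g" unfolding g_def by (auto intro: contin_cong)
    then show "contin (D \<union> Q) h'"
      unfolding h'_def
      by (rule contin_pasting[OF D(5)])
        (use closed rel_closed_subset[of Y _ "D \<union> Q"] D(1) Q(1) gz(5) in auto)
    show "dgraph M (Suc l) m (D \<union> Q) h'"
    proof (rule dgraphI)
      \<comment> \<open>On the new part the intermediate values \<open>b\<close> of \<open>f\<close>
        and \<open>y\<close> of \<open>h\<close> are quantified, because all three maps are
        accessible only through their graphs.\<close>
      have "dpred M (\<lambda>e. (map e [0..<Suc l] \<in> D \<and> h (map e [0..<Suc l]) = map (\<lambda>i. e (Suc l + i)) [0..<m]) \<or>
        (map e [0..<Suc l] \<in> Q \<and> map e [0..<Suc l] \<notin> D \<and>
         (\<exists>b. length b = n \<and> (map e [0..<Suc l] \<in> Y \<and> f (map e [0..<Suc l]) = b) \<and>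
          (\<exists>y. length y = m \<and> (map e [0..<l] @ [r (map e [0..<l])] \<in> D \<and> h (map e [0..<l] @ [r (map e [0..<l])]) = y) \<and>
            (b \<in> U i \<and> y \<in> E \<and> p y \<in> U i \<and> T i b y = map (\<lambda>i. e (Suc l + i)) [0..<m])))))"
        by (intro dpred_disj dpred_conj dpred_not dpred_ex_list Q(2) D(2) dgraph_app[OF D(4) lenD]
            dgraph_app[OF f_graph Y_len] T_graph[OF i] dvec_vars dvec_snoc dterm_fun[OF r(1)])
      then show "dpred M (\<lambda>e. map e [0..<Suc l] \<in> D \<union> Q \<and> h' (map e [0..<Suc l]) = map (\<lambda>i. e (Suc l + i)) [0..<m])"
      proof (rule dpred_cong)
        fix e :: "nat \<Rightarrow> 'a"
        let ?z = "map e [0..<Suc l]" and ?w = "map (\<lambda>i. e (Suc l + i)) [0..<m]"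
        have rz: "map e [0..<l] @ [r (map e [0..<l])] = rr ?z" unfolding rr_def by (simp add: take_map)
        have "length (f ?z) = n" "length (h (rr ?z)) = m" "?z \<in> Y" "rr ?z \<in> D" "f ?z \<in> U i"
          "h (rr ?z) \<in> E" "p (h (rr ?z)) \<in> U i" if "?z \<in> Q"
          using that f_B Q(1) B_len Qz gz E_len by blast+
        then show "((?z \<in> D \<and> h ?z = ?w) \<or> (?z \<in> Q \<and> ?z \<notin> D \<and>
           (\<exists>b. length b = n \<and> (?z \<in> Y \<and> f ?z = b) \<and>
            (\<exists>y. length y = m \<and> (map e [0..<l] @ [r (map e [0..<l])] \<in> D \<and> h (map e [0..<l] @ [r (map e [0..<l])]) = y) \<and>
              (b \<in> U i \<and> y \<in> E \<and> p y \<in> U i \<and> T i b y = ?w))))) =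
          (?z \<in> D \<union> Q \<and> h' ?z = ?w)"
          unfolding rz h'_def g_def by (auto simp del: upt_Suc)
      qed
    qed (use lenD lenQ in blast)
  qed
  then show ?thesis by (rule that) (simp add: h'_def)
qed

end

text \<open>
  \<open>reaches V js i x a\<close>: the segment from \<open>a\<close> to \<open>1\<close> over \<open>x\<close> can be cut into consecutive pieces
  lying in the sets \<open>V\<close> with indices \<open>i # js\<close>. A piece may be empty (right end below left end);
  this makes the condition upward closed in \<open>a\<close>, so that admissible cut points form convex sets.
\<close>

primrec reaches ::
  "(nat \<Rightarrow> 'a list \<Rightarrow> 'a \<Rightarrow> bool) \<Rightarrow> nat list \<Rightarrow> nat \<Rightarrow> 'a list \<Rightarrow> 'a::linordered_field \<Rightarrow> bool" where
  "reaches V [] i x a \<longleftrightarrow> (\<forall>s. a \<le> s \<and> s \<le> 1 \<longrightarrow> V i x s)"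
| "reaches V (j # js) i x a \<longleftrightarrow>
    (\<exists>b. 0 \<le> b \<and> b \<le> 1 \<and> (\<forall>s. a \<le> s \<and> s \<le> b \<longrightarrow> V i x s) \<and> reaches V js j x b)"

lemma reaches_mono: "reaches V js i x a \<Longrightarrow> a \<le> a' \<Longrightarrow> reaches V js i x a'"
  by (cases js) (auto intro: order_trans)

section \<open>Openness of cut conditions and lifting along one sequence\<close>

context lifting_problem
begin

lemma dpred_reaches:
  assumes "i \<in> {1..k}" "set js \<subseteq> {1..k}" "dvec M l v" "dterm M g"
  shows "dpred M (\<lambda>e. reaches V js i (v e) (g e))"
proof (rule dpred_app_list[OF _ assms(3,4)])
  show "dpred M (\<lambda>e. reaches V js i (map e [0..<l]) (e l))"
    using assms(1,2)
  proof (induction js arbitrary: i)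
    case Nil
    show ?case unfolding reaches.simps by (intro dpred_intros dpred_V[OF Nil(1)] dvec_intros)
  next
    case (Cons j js)
    have "j \<in> {1..k}" "set js \<subseteq> {1..k}" using Cons.prems by auto
    then show ?case unfolding reaches.simps
      by (intro dpred_intros dpred_V[OF Cons.prems(1)] dvec_intros dpred_app_list[OF Cons.IH])
  qed
qed

text \<open>A tube lemma: the radii from openness of \<open>V i\<close> at the single points of the
  segment are made uniform by \<open>interval_uniform\<close>, and the segment may even be
  lengthened by the resulting radius at both ends.\<close>

lemma segment_open:
  assumes i: "i \<in> {1..k}" and x: "x \<in> X" and seg: "\<And>s. a \<le> s \<Longrightarrow> s \<le> b \<Longrightarrow> V i x s"
  shows "\<exists>r>0. \<forall>x'\<in>X. near r x x' \<longrightarrow> (\<forall>s. 0 \<le> s \<and> s \<le> 1 \<and> a - r < s \<and> s < b + r \<longrightarrow> V i x' s)"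
proof (cases "b < a")
  case True
  \<comment> \<open>An empty segment stays empty when enlarged by half of its gap at each
    end.\<close>
  define h where "h = (a - b) / 2"
  have h: "h > 0" "a - b = h + h" unfolding h_def using True by auto
  show ?thesis by (rule exI[of _ h]) (use h in \<open>auto simp: algebra_simps\<close>)
next
  case False
  then have "a \<le> b" by simp
  define Q where "Q = (\<lambda>t s. \<forall>x'. length x' = l \<longrightarrow> x' \<in> X \<longrightarrow> near t x x' \<longrightarrow>
    (\<forall>s'. 0 \<le> s' \<and> s' \<le> 1 \<and> \<bar>s' - s\<bar> < t \<longrightarrow> V i x' s'))"
  have lenx: "length x = l" using x X_len by blast
  have "\<exists>t>0. \<forall>s. a \<le> s \<and> s \<le> b \<longrightarrow> Q t s"
  proof (rule interval_uniform[OF _ _ \<open>a \<le> b\<close>])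
    show "dpred M (\<lambda>e. Q (e 0) (e 1))"
      unfolding Q_def
      by (intro dpred_intros dpred_mem[OF X_def] dpred_near[where n = l] dpred_V[OF i] dvec_intros
          dvec_const lenx)
    show "Q t' s" if "Q t s" "0 < t'" "t' \<le> t" for t t' s
      unfolding Q_def
    proof (intro allI impI)
      fix x' s' assume a: "length x' = l" "x' \<in> X" "near t' x x'" "0 \<le> s' \<and> s' \<le> 1 \<and> \<bar>s' - s\<bar> < t'"
      show "V i x' s'"
        by (rule that(1)[unfolded Q_def, rule_format, OF a(1,2) near_mono[OF a(3) that(3)]])
          (use a(4) that(3) in auto)
    qed
    fix y assume "a \<le> y" "y \<le> b"
    then obtain r where r: "r > 0"
      "\<forall>x'\<in>X. near r x x' \<longrightarrow> (\<forall>t'. 0 \<le> t' \<and> t' \<le> 1 \<and> \<bar>t' - y\<bar> < r \<longrightarrow> V i x' t')"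
      using V_open[OF i seg] by blast
    define h where "h = r / 2"
    have h: "h > 0" "r = h + h" unfolding h_def using r(1) by auto
    have "Q h s" if s: "\<bar>s - y\<bar> < h" for s
      unfolding Q_def
    proof (intro allI impI)
      fix x' s' assume a: "x' \<in> X" "near h x x'" "0 \<le> s' \<and> s' \<le> 1 \<and> \<bar>s' - s\<bar> < h"
      have "near r x x'" using near_mono[OF a(2)] h by simp
      moreover have "\<bar>s' - y\<bar> < r" using a(3) s h(2) by (auto simp: abs_if split: if_splits)
      ultimately show "V i x' s'" using r(2) a by blast
    qed
    then show "\<exists>s>0. \<exists>t>0. \<forall>b'. a \<le> b' \<and> b' \<le> b \<and> \<bar>b' - y\<bar> < s \<longrightarrow> Q t b'" using h(1) by blast
  qed
  then obtain t where t: "t > 0" "\<And>s. a \<le> s \<Longrightarrow> s \<le> b \<Longrightarrow> Q t s" by blast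
  have "V i x' s" if x': "x' \<in> X" "near t x x'" and s: "0 \<le> s" "s \<le> 1" "a - t < s" "s < b + t" for x' s
  proof -
    \<comment> \<open>The point of the original segment closest to \<open>s\<close>.\<close>
    define s0 where "s0 = max a (min b s)"
    have "Q t s0" using t(2) \<open>a \<le> b\<close> unfolding s0_def by auto
    moreover have "\<bar>s - s0\<bar> < t" unfolding s0_def using s t(1) by (auto simp: max_def min_def abs_if)
    moreover have "length x' = l" using x'(1) X_len by blast
    ultimately show ?thesis unfolding Q_def using x' s by blast
  qed
  then show ?thesis using t(1) by blast
qed

text \<open>The cut points found over \<open>x\<close> serve unchanged over all nearby
  \<open>x'\<close>; only the left end of the first piece has to move.\<close>

lemma reaches_open:
  assumes "i \<in> {1..k}" "set js \<subseteq> {1..k}" "x \<in> X" "reaches V js i x a"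
  shows "\<exists>r>0. \<forall>x'\<in>X. near r x x' \<longrightarrow> (\<forall>a'. 0 \<le> a' \<and> a' \<le> 1 \<and> \<bar>a' - a\<bar> < r \<longrightarrow> reaches V js i x' a')"
  using assms
proof (induction js arbitrary: i a)
  case Nil
  then obtain r where "r > 0" "\<forall>x'\<in>X. near r x x' \<longrightarrow> (\<forall>s. 0 \<le> s \<and> s \<le> 1 \<and> a - r < s \<and> s < 1 + r \<longrightarrow> V i x' s)"
    using segment_open[of i x a 1] by auto
  then show ?case
    by (intro exI[of _ r]) (auto simp: abs_less_iff)
next
  case (Cons j js)
  then obtain b where b: "0 \<le> b" "b \<le> 1" "\<forall>s. a \<le> s \<and> s \<le> b \<longrightarrow> V i x s" "reaches V js j x b" by auto
  obtain r where r: "r > 0" "\<forall>x'\<in>X. near r x x' \<longrightarrow> (\<forall>s. 0 \<le> s \<and> s \<le> 1 \<and> a - r < s \<and> s < b + r \<longrightarrow> V i x' s)"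
    using segment_open[of i x a b] Cons.prems b(3) by blast
  have "j \<in> {1..k}" "set js \<subseteq> {1..k}" using Cons.prems by auto
  then obtain r' where r': "r' > 0"
    "\<forall>x'\<in>X. near r' x x' \<longrightarrow> (\<forall>a'. 0 \<le> a' \<and> a' \<le> 1 \<and> \<bar>a' - b\<bar> < r' \<longrightarrow> reaches V js j x' a')"
    using Cons.IH[OF _ _ Cons.prems(3) b(4)] by blast
  have "reaches V (j # js) i x' a'"
    if x': "x' \<in> X" "near (min r r') x x'" and a': "0 \<le> a'" "\<bar>a' - a\<bar> < min r r'" for x' a'
  proof -
    have nr: "near r x x'" "near r' x x'" using near_mono[OF x'(2)] by auto
    have "reaches V js j x' b" using r' x'(1) nr(2) b by simp
    moreover have "V i x' s" if "a' \<le> s" "s \<le> b" for s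
      using r x'(1) nr(1) a' that b by (auto simp: abs_less_iff)
    ultimately show ?thesis using b by auto
  qed
  then show ?case using r(1) r'(1) by (intro exI[of _ "min r r'"]) simp
qed

text \<open>The region already lifted: \<open>c\<close> is the height due to earlier index
  sequences, valid over all of \<open>X\<close>, and \<open>u\<close> is the progress of the current
  sequence over \<open>Z\<close>.\<close>

definition under :: "('a list \<Rightarrow> 'a) \<Rightarrow> 'a list set \<Rightarrow> ('a list \<Rightarrow> 'a) \<Rightarrow> 'a list set" where
  "under c Z u = cyl X (\<lambda>x t. t \<le> c x \<or> x \<in> Z \<and> t \<le> u x)"

lemma dpred_under:
  assumes "dterm M (\<lambda>e. c (map e [0..<l]))" "dterm M (\<lambda>e. u (map e [0..<l]))"
    "dpred M (\<lambda>e. map e [0..<l] \<in> Z)"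
  shows "dpred M (\<lambda>e. map e [0..<Suc l] \<in> under c Z u)"
  unfolding under_def by (rule dpred_cyl[OF X_def]) (intro dpred_intros assms)

text \<open>Where \<open>u'\<close> lies below \<open>u\<close> the piece is empty, nothing is
  added, and the lift is merely restricted; this is why the extended lift is cut back to the region
  of \<open>u'\<close> at the end.\<close>

lemma lift_step:
  assumes i: "i \<in> {1..k}"
    and Z: "Z \<subseteq> X" "rel_closed X Z" "dpred M (\<lambda>e. map e [0..<l] \<in> Z)"
    and c: "dterm M (\<lambda>e. c (map e [0..<l]))" "cont1 X c" "\<And>x. x \<in> X \<Longrightarrow> 0 \<le> c x"
    and u: "dterm M (\<lambda>e. u (map e [0..<l]))" "cont1 Z u" "\<And>x. x \<in> Z \<Longrightarrow> 0 \<le> u x \<and> u x \<le> 1"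
    and u': "dterm M (\<lambda>e. u' (map e [0..<l]))" "cont1 Z u'"
    and seg: "\<And>x s. x \<in> Z \<Longrightarrow> u x \<le> s \<Longrightarrow> s \<le> u' x \<Longrightarrow> s \<le> 1 \<Longrightarrow> V i x s"
    and h: "sect (under c Z u) h"
  obtains h' where "sect (under c Z u') h'" "\<And>x. x \<in> X \<Longrightarrow> h' (x @ [0]) = h (x @ [0])"
proof -
  \<comment> \<open>The condition \<open>x \<in> Z\<close> is repeated so that \<open>Q\<close> is
    an intersection of three cylinders of the shape treated in
    \<open>rel_closed_cyl\<close>.\<close>
  define Q where "Q = cyl X (\<lambda>x t. (x \<in> Z \<and> c x \<le> t) \<and> (x \<in> Z \<and> u x \<le> t) \<and> (x \<in> Z \<and> t \<le> u' x))"
  \<comment> \<open>The height up to which the lift over a point of \<open>Z\<close> is known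
    already. Starting from it, and not from \<open>u\<close>, makes the transported values agree
    with the earlier lift.\<close>
  define r where "r = (\<lambda>x. max (c x) (u x))"
  have cyl_Int: "cyl X (\<lambda>x t. P x t \<and> R x t) = cyl X P \<inter> cyl X R" for P R
    by (auto elim!: cylE)
  have cyl_Un: "cyl X (\<lambda>x t. P x t \<or> R x t) = cyl X P \<union> cyl X R" for P R
    by (auto elim!: cylE)
  have cZ: "cont1 Z c" using cont1_subset[OF c(2) Z(1)] .
  have "rel_closed Y (cyl X (\<lambda>x t. x \<in> X \<and> t \<le> c x))"
    by (rule rel_closed_cyl(1)[OF X_len order_refl _ c(2)]) (simp add: rel_closed_def)
  moreover have "cyl X (\<lambda>x t. x \<in> X \<and> t \<le> c x) = cyl X (\<lambda>x t. t \<le> c x)" by (auto elim!: cylE)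
  ultimately have clD: "rel_closed Y (under c Z u)"
    unfolding under_def cyl_Un using rel_closed_cyl(1)[OF X_len Z(1,2) u(2)] by (auto intro: rel_closed_Un)
  have Q_eq: "Q = cyl X (\<lambda>x t. x \<in> Z \<and> c x \<le> t) \<inter>
      (cyl X (\<lambda>x t. x \<in> Z \<and> u x \<le> t) \<inter> cyl X (\<lambda>x t. x \<in> Z \<and> t \<le> u' x))"
    unfolding Q_def cyl_Int[symmetric] ..
  have clQ: "rel_closed Y Q"
    unfolding Q_eq
    by (intro rel_closed_Int rel_closed_cyl[OF X_len Z(1,2)] cZ u(2) u'(2))
  obtain h' where h': "sect (under c Z u \<union> Q) h'" "\<And>z. z \<in> under c Z u \<Longrightarrow> h' z = h z"
  proof (rule sect_extend[OF h i])
    show "Q \<subseteq> Y" unfolding Q_def by (rule cyl_subset) simp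
    show "dpred M (\<lambda>e. map e [0..<Suc l] \<in> Q)"
      unfolding Q_def by (rule dpred_cyl[OF X_def]) (intro dpred_intros c(1) u(1) u'(1) Z(3))
    show "dterm M (\<lambda>e. r (map e [0..<l]))" unfolding r_def by (intro dterm_max c(1) u(1))
    show "cont1 Q (\<lambda>z. r (take l z))"
    proof (rule cont1_take)
      show "cont1 Z r" unfolding r_def by (rule cont1_max[OF cZ u(2)])
      show "take l z \<in> Z" if "z \<in> Q" for z
        using that X_len unfolding Q_def by (auto elim!: cylE)
    qed
    show "x @ [r x] \<in> under c Z u \<and> V i x t \<and> V i x (r x)" if "x @ [t] \<in> Q" for x t
    proof -
      have q: "x \<in> X" "0 \<le> t" "t \<le> 1" "x \<in> Z" "c x \<le> t" "u x \<le> t" "t \<le> u' x" using that unfolding Q_def by auto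
      have "r x \<le> t" "u x \<le> r x" unfolding r_def using q by auto
      then have "V i x t" "V i x (r x)" using q seg by auto
      moreover have "r x \<le> c x \<or> r x \<le> u x" unfolding r_def by (simp add: max_def)
      ultimately show ?thesis
        unfolding under_def using q u(3)[OF q(4)] \<open>r x \<le> t\<close> \<open>u x \<le> r x\<close> by auto
    qed
    show "r x = t" if "x @ [t] \<in> Q" "x @ [t] \<in> under c Z u" for x t
      using that unfolding Q_def under_def r_def by (auto simp: max_def)
  qed (rule clD clQ that; assumption)+
  have "under c Z u' \<subseteq> under c Z u \<union> Q"
    unfolding under_def Q_def by (auto elim!: cylE)
  then have "sect (under c Z u') h'"
    by (rule sect_subset[OF h'(1) _ dpred_under[OF c(1) u'(1) Z(3)]])
  then show ?thesis by (rule that) (use h'(2) c(3) in \<open>simp add: under_def\<close>)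
qed

text \<open>Each further index replaces the current cut \<open>u\<close> by a continuous choice of
  the next one, and one application of \<open>lift_step\<close> moves the lift up to it.\<close>

lemma lift_chain:
  assumes "i \<in> {1..k}" "set js \<subseteq> {1..k}"
    and Z: "Z \<subseteq> X" "rel_closed X Z" "dpred M (\<lambda>e. map e [0..<l] \<in> Z)"
    and c: "dterm M (\<lambda>e. c (map e [0..<l]))" "cont1 X c" "\<And>x. x \<in> X \<Longrightarrow> 0 \<le> c x"
    and "dterm M (\<lambda>e. u (map e [0..<l]))" "cont1 Z u" "\<And>x. x \<in> Z \<Longrightarrow> 0 \<le> u x \<and> u x \<le> 1"
    and "\<And>x. x \<in> Z \<Longrightarrow> reaches V js i x (u x)"
    and "sect (under c Z u) h"
  shows "\<exists>h'. sect (under c Z (\<lambda>_. 1)) h' \<and> (\<forall>x\<in>X. h' (x @ [0]) = h (x @ [0]))"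
  using assms(1,2,9-)
proof (induction js arbitrary: i u h)
  case Nil
  obtain h' where "sect (under c Z (\<lambda>_. 1)) h'" "\<And>x. x \<in> X \<Longrightarrow> h' (x @ [0]) = h (x @ [0])"
    by (rule lift_step[OF Nil.prems(1) Z c Nil.prems(3-5) dterm_const cont1_const _ Nil.prems(7)])
      (use Nil.prems(6) in auto)
  then show ?case by blast
next
  case (Cons j js)
  have j: "j \<in> {1..k}" "set js \<subseteq> {1..k}" using Cons.prems(2) by auto
  \<comment> \<open>The first condition is inherited by smaller \<open>b\<close>, the second by
    larger \<open>b\<close>, so the admissible cut points form a convex set; both are open
    conditions.\<close>
  define G where "G = (\<lambda>x b. (\<forall>s. u x \<le> s \<and> s \<le> b \<longrightarrow> V i x s) \<and> reaches V js j x b)"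
  have Zlen: "Z \<subseteq> {xs. length xs = l}" using Z(1) X_len by blast
  obtain u' where u': "dterm M (\<lambda>e. u' (map e [0..<l]))" "cont1 Z u'"
    "\<And>x. x \<in> Z \<Longrightarrow> 0 \<le> u' x \<and> u' x \<le> 1 \<and> G x (u' x)"
  proof (rule convex_open_selection[OF Z(3) Zlen])
    show "dpred M (\<lambda>e. G (map e [0..<l]) (e l))"
      unfolding G_def
      by (intro dpred_intros dpred_V[OF Cons.prems(1)] dpred_reaches[OF j] dvec_intros dterm_fun[OF Cons.prems(3)])
    show "\<exists>r>0. \<forall>x'\<in>Z. \<forall>t'. 0 \<le> t' \<and> t' \<le> 1 \<and> near r x x' \<and> \<bar>t' - t\<bar> < r \<longrightarrow> G x' t'"
      if x: "x \<in> Z" and G: "G x t" for x t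
    proof -
      have xX: "x \<in> X" using x Z(1) by blast
      obtain r where r: "r > 0"
        "\<forall>x'\<in>X. near r x x' \<longrightarrow> (\<forall>s. 0 \<le> s \<and> s \<le> 1 \<and> u x - r < s \<and> s < t + r \<longrightarrow> V i x' s)"
        using segment_open[OF Cons.prems(1) xX, of "u x" t] G unfolding G_def by blast
      obtain r' where r': "r' > 0"
        "\<forall>x'\<in>X. near r' x x' \<longrightarrow> (\<forall>a'. 0 \<le> a' \<and> a' \<le> 1 \<and> \<bar>a' - t\<bar> < r' \<longrightarrow> reaches V js j x' a')"
        using reaches_open[OF j xX, of t] G unfolding G_def by blast
      obtain d where d: "d > 0" "\<forall>y\<in>Z. near d x y \<longrightarrow> \<bar>u x - u y\<bar> < r"
        using cont1D[OF Cons.prems(4) x r(1)] unfolding locally_at_def by blast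
      define q where "q = min d (min r r')"
      have q: "q > 0" "q \<le> d" "q \<le> r" "q \<le> r'" unfolding q_def using d(1) r(1) r'(1) by auto
      have "G x' t'" if x': "x' \<in> Z" and t': "0 \<le> t'" "t' \<le> 1" "near q x x'" "\<bar>t' - t\<bar> < q" for x' t'
      proof -
        have nr: "near d x x'" "near r x x'" "near r' x x'" using near_mono[OF t'(3)] q by auto
        have x'X: "x' \<in> X" using x' Z(1) by blast
        have du: "\<bar>u x - u x'\<bar> < r" "0 \<le> u x'" using d(2) x' nr(1) Cons.prems(5)[OF x'] by auto
        have "V i x' s" if "u x' \<le> s" "s \<le> t'" for s
          using r(2) x'X nr(2) du that t' q(3) by (auto simp: abs_less_iff)
        moreover have "reaches V js j x' t'"
          using r'(2) x'X nr(3) t' q(4) by auto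
        ultimately show ?thesis unfolding G_def by blast
      qed
      then show ?thesis using q(1) by blast
    qed
    show "G x b'" if "G x a" "G x b" "a \<le> b'" "b' \<le> b" for x a b b'
      using that reaches_mono[of V js j x a b'] unfolding G_def by auto
    show "\<exists>t. 0 \<le> t \<and> t \<le> 1 \<and> G x t" if "x \<in> Z" for x
      using Cons.prems(6)[OF that] unfolding G_def by auto
  qed (rule that; assumption)
  obtain h1 where h1: "sect (under c Z u') h1" "\<And>x. x \<in> X \<Longrightarrow> h1 (x @ [0]) = h (x @ [0])"
    by (rule lift_step[OF Cons.prems(1) Z c Cons.prems(3-5) u'(1,2) _ Cons.prems(7)])
      (use u'(3) in \<open>auto simp: G_def\<close>)
  obtain h' where "sect (under c Z (\<lambda>_. 1)) h'" "\<forall>x\<in>X. h' (x @ [0]) = h1 (x @ [0])"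
    using Cons.IH[OF j u'(1,2) _ _ h1(1)] u'(3) unfolding G_def by blast
  then show ?case using h1(2) by auto
qed

end

section \<open>A uniform subdivision and the global lift\<close>

text \<open>The initial value 0 is the height at which only the given map on the bottom of the
  cylinder is known.\<close>

primrec list_max :: "('s \<Rightarrow> 'b \<Rightarrow> 'a::linordered_field) \<Rightarrow> 's list \<Rightarrow> 'b \<Rightarrow> 'a" where
  "list_max F [] x = 0"
| "list_max F (s # ss) x = max (F s x) (list_max F ss x)"

lemma list_max_nonneg: "0 \<le> list_max F ss x"
  by (induction ss) (auto simp: le_max_iff_disj)

lemma list_max_ge: "s \<in> set ss \<Longrightarrow> F s x \<le> list_max F ss x"
  by (induction ss) (auto simp: le_max_iff_disj)

lemma list_max_attained: "0 < list_max F ss x \<Longrightarrow> \<exists>s\<in>set ss. F s x = list_max F ss x"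
  by (induction ss) (auto simp: max_def)

lemma cont1_list_max: "(\<And>s. s \<in> set ss \<Longrightarrow> cont1 X (F s)) \<Longrightarrow> cont1 X (list_max F ss)"
proof (induction ss)
  case Nil
  have "list_max F [] = (\<lambda>x. 0)" by auto
  then show ?case by (simp add: cont1_const)
next
  case (Cons s ss)
  have "list_max F (s # ss) = (\<lambda>x. max (F s x) (list_max F ss x))" by auto
  moreover have "cont1 X (\<lambda>x. max (F s x) (list_max F ss x))"
    using Cons by (intro cont1_max) auto
  ultimately show ?case by simp
qed

lemma dterm_list_max:
  "(\<And>s. s \<in> set ss \<Longrightarrow> dterm M (\<lambda>e. F s (map e [0..<l]))) \<Longrightarrow> dterm M (\<lambda>e. list_max F ss (map e [0..<l]))"
  by (induction ss) (auto simp: dterm_const intro: dterm_max)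

lemma rel_closed_le_0:
  assumes "cont1 X w"
  shows "rel_closed X {x \<in> X. w x \<le> 0}"
  unfolding rel_closed_def
proof
  fix x assume x: "x \<in> X - {x \<in> X. w x \<le> 0}"
  then have "0 < w x" by auto
  then obtain r where r: "r > 0" "\<forall>y\<in>X. near r x y \<longrightarrow> \<bar>w x - w y\<bar> < w x"
    using cont1D[OF assms, of x "w x"] x unfolding locally_at_def by blast
  have "\<not> near r x y" if "y \<in> {x \<in> X. w x \<le> 0}" for y
    using r(2) that by (auto simp: abs_less_iff)
  then show "\<exists>r>0. \<forall>y\<in>{x \<in> X. w x \<le> 0} \<inter> X. \<not> near r x y" using r(1) by blast
qed

section \<open>Boundary points and the number of pieces\<close>

context lifting_problem
begin

text \<open>The boundary is taken within the unit interval over a fixed \<open>x\<close>, so 0 and 1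
  are not boundary points automatically.\<close>

definition bdry :: "'a list \<Rightarrow> 'a \<Rightarrow> bool" where
  "bdry x t \<longleftrightarrow> x \<in> X \<and> 0 \<le> t \<and> t \<le> 1 \<and> (\<exists>i\<in>{1..k}. \<not> (\<exists>s>0.
    (\<forall>t'. 0 \<le> t' \<and> t' \<le> 1 \<and> \<bar>t' - t\<bar> < s \<longrightarrow> V i x t') \<or>
    (\<forall>t'. 0 \<le> t' \<and> t' \<le> 1 \<and> \<bar>t' - t\<bar> < s \<longrightarrow> \<not> V i x t')))"

lemma dpred_bdry: "dpred M (\<lambda>e. bdry (map e [0..<l]) (e l))"
  unfolding bdry_def
  by (intro dpred_conj dpred_finite_bex X_def dpred_intros dpred_V dvec_intros) simp_all

text \<open>An interval of boundary points would contain a subinterval on which \<open>V i x\<close>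
  has one truth value, and its points are not boundary points for \<open>i\<close>.\<close>

lemma finite_bdry: "finite {t. bdry x t}"
proof (cases "x \<in> X")
  case True
  define S where "S = (\<lambda>i t. 0 \<le> t \<and> t \<le> 1 \<and> \<not> (\<exists>s>0.
    (\<forall>t'. 0 \<le> t' \<and> t' \<le> 1 \<and> \<bar>t' - t\<bar> < s \<longrightarrow> V i x t') \<or>
    (\<forall>t'. 0 \<le> t' \<and> t' \<le> 1 \<and> \<bar>t' - t\<bar> < s \<longrightarrow> \<not> V i x t')))"
  have lenx: "length x = l" using True X_len by blast
  have fin: "finite {t. S i t}" if i: "i \<in> {1..k}" for i
  proof (rule ccontr)
    assume inf: "infinite {t. S i t}"
    have "dpred M (\<lambda>e. S i (e 0))"
      unfolding S_def by (intro dpred_intros dpred_V[OF i] dvec_const lenx)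
    then obtain a b where ab: "a < b" "\<And>t. a < t \<Longrightarrow> t < b \<Longrightarrow> S i t"
      by (rule infinite_interval[OF _ inf]) (rule that)
    have "{a<..<b} \<subseteq> {t. a < t \<and> t < b \<and> V i x t = True} \<union> {t. a < t \<and> t < b \<and> V i x t = False}" by auto
    then have "infinite ({t. a < t \<and> t < b \<and> V i x t = True} \<union> {t. a < t \<and> t < b \<and> V i x t = False})"
      using infinite_Ioo[OF ab(1)] finite_subset by blast
    then obtain v where v: "infinite {t. a < t \<and> t < b \<and> V i x t = v}" by blast
    have "dpred M (\<lambda>e. a < e 0 \<and> e 0 < b \<and> V i x (e 0) = v)"
      by (intro dpred_intros dpred_V[OF i] dvec_const lenx)
    then obtain a' b' where ab': "a' < b'" "\<And>t. a' < t \<Longrightarrow> t < b' \<Longrightarrow> a < t \<and> t < b \<and> V i x t = v"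
      by (rule infinite_interval[OF _ v]) (rule that)
    obtain t where t: "a' < t" "t < b'" using dense ab'(1) by blast
    have "V i x t' = v" if "\<bar>t' - t\<bar> < min (t - a') (b' - t)" for t'
      using ab'(2)[of t'] that by (auto simp: abs_less_iff)
    moreover have "0 < min (t - a') (b' - t)" using t by simp
    moreover have "S i t" using ab ab'(2) t by blast
    ultimately show False unfolding S_def by (cases v) blast+
  qed
  have "{t. bdry x t} \<subseteq> (\<Union>i\<in>{1..k}. {t. S i t})" unfolding bdry_def S_def by blast
  then show ?thesis using fin by (meson finite_UN finite_atLeastAtMost finite_subset)
qed (simp add: bdry_def)

text \<open>Away from boundary points membership in \<open>V i\<close> is locally constant. The left
  end \<open>a\<close> may itself be a boundary point, but there openness of \<open>V i\<close>
  suffices because \<open>V i x a\<close> is given.\<close>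

lemma V_along:
  assumes i: "i \<in> {1..k}" and "0 \<le> a" "a \<le> s" "s \<le> 1" and V: "V i x a"
    and no: "\<And>y. a < y \<Longrightarrow> y \<le> s \<Longrightarrow> \<not> bdry x y"
  shows "V i x s"
proof (rule interval_connected[of "V i x" a s])
  have x: "x \<in> X" using V_dom[OF V] by blast
  then have "length x = l" using X_len by blast
  then show "dpred M (\<lambda>e. V i x (e 0))" by (intro dpred_V[OF i] dvec_const dterm_var)
  fix y assume y: "a \<le> y" "y \<le> s"
  show "\<exists>r>0. \<forall>y' y''. a \<le> y' \<and> y' \<le> s \<and> \<bar>y' - y\<bar> < r \<and> a \<le> y'' \<and> y'' \<le> s \<and> \<bar>y'' - y\<bar> < r \<longrightarrow>
      V i x y' \<longrightarrow> V i x y''"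
  proof (cases "y = a")
    case True
    obtain r where r: "r > 0" "\<forall>x'\<in>X. near r x x' \<longrightarrow> (\<forall>t'. 0 \<le> t' \<and> t' \<le> 1 \<and> \<bar>t' - a\<bar> < r \<longrightarrow> V i x' t')"
      using V_open[OF i V] by blast
    then have "V i x y''" if "a \<le> y''" "y'' \<le> s" "\<bar>y'' - y\<bar> < r" for y''
      using x near_refl[OF r(1)] that True assms(2,4) by auto
    then show ?thesis using r(1) by blast
  next
    case False
    then have "\<not> bdry x y" using no y by auto
    moreover have "0 \<le> y" "y \<le> 1" using y assms(2,4) by auto
    ultimately obtain r where r: "r > 0" "(\<forall>t'. 0 \<le> t' \<and> t' \<le> 1 \<and> \<bar>t' - y\<bar> < r \<longrightarrow> V i x t') \<or>
      (\<forall>t'. 0 \<le> t' \<and> t' \<le> 1 \<and> \<bar>t' - y\<bar> < r \<longrightarrow> \<not> V i x t')"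
      unfolding bdry_def using x i by blast
    have "0 \<le> y'" "y' \<le> 1" if "a \<le> y'" "y' \<le> s" for y' using that assms(2,4) by auto
    then show ?thesis using r by blast
  qed
qed (use assms in auto)

text \<open>Each boundary point \<open>b\<close> costs two pieces, hence the factor 2: one ends
  shortly before \<open>b\<close>, and one crosses to \<open>b\<close> inside a set that contains
  \<open>b\<close>. From \<open>b\<close> on the argument starts anew with one boundary point
  fewer.\<close>

lemma reaches_exists:
  assumes "x \<in> X" "0 \<le> a" "a \<le> 1" "card {t. bdry x t \<and> a < t} \<le> N"
  shows "\<exists>i\<in>{1..k}. \<exists>js. set js \<subseteq> {1..k} \<and> length js \<le> 2 * N \<and> reaches V js i x a"
  using assms
proof (induction N arbitrary: a)
  case 0
  have fin: "finite {t. bdry x t \<and> a < t}" using finite_bdry[of x] by (auto intro: rev_finite_subset)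
  then have no: "\<not> bdry x y" if "a < y" for y using 0(4) that by auto
  obtain i where i: "i \<in> {1..k}" "V i x a" using V_cover 0 by blast
  have "reaches V [] i x a" using V_along[OF i(1) 0(2) _ _ i(2)] no by auto
  then show ?case using i(1) by (intro bexI[of _ i] exI[of _ "[]"]) auto
next
  case (Suc N)
  define F where "F = {t. bdry x t \<and> a < t}"
  have fin: "finite F" unfolding F_def using finite_bdry[of x] by (auto intro: rev_finite_subset)
  obtain i where i: "i \<in> {1..k}" "V i x a" using V_cover Suc.prems by blast
  show ?case
  proof (cases "F = {}")
    case True
    then have "reaches V [] i x a" using V_along[OF i(1) Suc.prems(2) _ _ i(2)] unfolding F_def by auto
    then show ?thesis using i(1) by (intro bexI[of _ i] exI[of _ "[]"]) auto
  next
    case False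
    define b where "b = Min F"
    have "b \<in> F" unfolding b_def using Min_in[OF fin False] .
    then have b: "a < b" "0 \<le> b" "b \<le> 1" unfolding F_def bdry_def by auto
    have no: "\<not> bdry x y" if "a < y" "y < b" for y
      using Min_le[OF fin, of y] that unfolding b_def F_def by auto
    obtain j where j: "j \<in> {1..k}" "V j x b" using V_cover Suc.prems(1) b by blast
    obtain r where r: "r > 0" "\<forall>x'\<in>X. near r x x' \<longrightarrow> (\<forall>t'. 0 \<le> t' \<and> t' \<le> 1 \<and> \<bar>t' - b\<bar> < r \<longrightarrow> V j x' t')"
      using V_open[OF j] by blast
    \<comment> \<open>The set \<open>V j\<close> containing \<open>b\<close> is open, so it already
      covers a stretch to the left of \<open>b\<close>; the change of index takes place
      there.\<close>
    obtain b' where b': "max a (b - r) < b'" "b' < b" using dense[of "max a (b - r)" b] b r(1) by auto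
    have seg1: "V i x s" if "a \<le> s" "s \<le> b'" for s
      by (rule V_along[OF i(1) Suc.prems(2) that(1) _ i(2)]) (use that b b' no in auto)
    have seg2: "V j x s" if "b' \<le> s" "s \<le> b" for s
      using r(2) Suc.prems(1,2) near_refl[OF r(1)] that b b' by (auto simp: abs_less_iff)
    have "{t. bdry x t \<and> b < t} \<subseteq> F - {b}" unfolding F_def using b by auto
    then have "card {t. bdry x t \<and> b < t} \<le> card (F - {b})" using fin by (intro card_mono) auto
    also have "\<dots> \<le> N" using Suc.prems(4) \<open>b \<in> F\<close> fin unfolding F_def[symmetric] by simp
    finally obtain i' js where i': "i' \<in> {1..k}" "set js \<subseteq> {1..k}" "length js \<le> 2 * N" "reaches V js i' x b"
      using Suc.IH[OF Suc.prems(1) b(2,3)] by blast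
    have "reaches V (i' # js) j x b'" using b seg2 i'(4) by auto
    then have "reaches V (j # i' # js) i x a"
      using seg1 b' b Suc.prems(2) unfolding reaches.simps(2)[of V j] by (intro exI[of _ b']) auto
    then show ?thesis using i(1) j(1) i' by (intro bexI[of _ i] exI[of _ "j # i' # js"]) auto
  qed
qed

lemma reaches_uniform:
  "\<exists>L. \<forall>x\<in>X. \<exists>i\<in>{1..k}. \<exists>js. set js \<subseteq> {1..k} \<and> length js \<le> L \<and> reaches V js i x 0"
proof -
  have "finite {t. bdry x t} \<and> (\<forall>t. bdry x t \<longrightarrow> \<bar>t\<bar> \<le> 1)" for x
    using finite_bdry by (auto simp: bdry_def)
  then obtain N where N: "\<And>x. length x = l \<Longrightarrow> card {t. bdry x t} \<le> N"
    using uniform_finiteness[of l, unfolded unif_finite_def, rule_format, OF dpred_bdry] by blast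
  have "card {t. bdry x t \<and> 0 < t} \<le> N" if "x \<in> X" for x
  proof -
    have "card {t. bdry x t \<and> 0 < t} \<le> card {t. bdry x t}" by (rule card_mono[OF finite_bdry]) auto
    also have "\<dots> \<le> N" using N that X_len by blast
    finally show ?thesis .
  qed
  then show ?thesis using reaches_exists[of _ 0 N] by (intro exI[of _ "2 * N"]) auto
qed

text \<open>A capped distance to the points where the sequence fails, written as a supremum of radii
  so that the absence of such points causes no exception.\<close>

lemma reach_radius:
  assumes i: "i \<in> {1..k}" "set js \<subseteq> {1..k}"
  shows "\<exists>\<rho>. dterm M (\<lambda>e. \<rho> (map e [0..<l])) \<and> cont1 X \<rho> \<and> (\<forall>x\<in>X. 0 < \<rho> x \<longleftrightarrow> reaches V js i x 0)"
proof -
  \<comment> \<open>The guard \<open>0 < r\<close> admits radius 0 also where the sequence fails,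
    giving the supremum 0 there; the cap 1 keeps the supremum in the field.\<close>
  define S where "S = (\<lambda>x r. 0 \<le> r \<and> r \<le> 1 \<and>
    (0 < r \<longrightarrow> (\<forall>x'. length x' = l \<longrightarrow> x' \<in> X \<longrightarrow> near r x x' \<longrightarrow> reaches V js i x' 0)))"
  have dS: "dpred M (\<lambda>e. S (map e [0..<l]) (e l))"
    unfolding S_def
    by (intro dpred_intros dpred_mem[OF X_def] dpred_near[where n = l] dpred_reaches[OF i] dvec_intros)
  obtain \<rho> where \<rho>: "dterm M (\<lambda>e. \<rho> (map e [0..<l]))" "\<And>x v. x \<in> X \<Longrightarrow> S x v \<Longrightarrow> v \<le> \<rho> x"
    "\<And>x y. x \<in> X \<Longrightarrow> y < \<rho> x \<Longrightarrow> \<exists>v. S x v \<and> y < v" "cont1 X \<rho>"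
  proof (rule definable_sup_lipschitz[OF X_def dS _ _ X_len])
    show "\<exists>v. S x v" for x unfolding S_def by (intro exI[of _ 0]) auto
    show "v \<le> 1" if "S x v" for x v using that unfolding S_def by blast
    show "\<exists>v'. S x' v' \<and> v - d \<le> v'" if d: "0 < d" "near d x x'" and S: "S x v" for x x' d v
    proof (intro exI[of _ "max 0 (v - d)"] conjI)
      have "near v x y" if "near (v - d) x' y" for y using near_trans[OF d(2) that] by simp
      then show "S x' (max 0 (v - d))" using S d(1) unfolding S_def by (auto simp: max_def)
    qed simp
  qed (rule that; assumption)
  have "0 < \<rho> x \<longleftrightarrow> reaches V js i x 0" if x: "x \<in> X" for x
  proof
    assume "0 < \<rho> x"
    then obtain v where "S x v" "0 < v" using \<rho>(3)[OF x] by blast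
    then show "reaches V js i x 0" unfolding S_def using x X_len near_refl by blast
  next
    assume "reaches V js i x 0"
    then obtain r where r: "r > 0"
      "\<forall>x'\<in>X. near r x x' \<longrightarrow> (\<forall>a'. 0 \<le> a' \<and> a' \<le> 1 \<and> \<bar>a' - 0\<bar> < r \<longrightarrow> reaches V js i x' a')"
      using reaches_open[OF i x] by blast
    have "S x (min r 1)" unfolding S_def
    proof (intro conjI impI allI)
      fix x' assume "x' \<in> X" "near (min r 1) x x'"
      then show "reaches V js i x' 0" using r near_mono[of "min r 1" x x' r] by simp
    qed (use r(1) in auto)
    then have "min r 1 \<le> \<rho> x" by (rule \<rho>(2)[OF x])
    then show "0 < \<rho> x" using r(1) by (meson less_le_trans min_less_iff_conj zero_less_one)
  qed
  then show ?thesis using \<rho>(1,4) by blast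
qed

theorem lift_exists:
  assumes g: "g \<in> X \<rightarrow> E" "dgraph M l m X g" "contin X g" "\<And>x. x \<in> X \<Longrightarrow> p (g x) = f (x @ [0])"
  shows "\<exists>h. sect Y h \<and> (\<forall>x\<in>X. h (x @ [0]) = g x)"
proof -
  obtain L where L: "\<And>x. x \<in> X \<Longrightarrow> \<exists>i\<in>{1..k}. \<exists>js. set js \<subseteq> {1..k} \<and> length js \<le> L \<and> reaches V js i x 0"
    using reaches_uniform by blast
  \<comment> \<open>Bounded length over finitely many indices leaves finitely many sequences, and
    every point of \<open>X\<close> is served by one of them.\<close>
  define \<Sigma> where "\<Sigma> = {1..k} \<times> {js. set js \<subseteq> {1..k} \<and> length js \<le> L}"
  have "finite \<Sigma>" unfolding \<Sigma>_def by (simp add: finite_lists_length_le)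
  then obtain ss where ss: "set ss = \<Sigma>" using finite_list by blast
  have "\<forall>\<sigma>\<in>\<Sigma>. \<exists>\<rho>. dterm M (\<lambda>e. \<rho> (map e [0..<l])) \<and> cont1 X \<rho> \<and>
      (\<forall>x\<in>X. 0 < \<rho> x \<longleftrightarrow> reaches V (snd \<sigma>) (fst \<sigma>) x 0)"
    unfolding \<Sigma>_def using reach_radius by auto
  then obtain \<rho> where \<rho>: "\<And>\<sigma>. \<sigma> \<in> \<Sigma> \<Longrightarrow> dterm M (\<lambda>e. \<rho> \<sigma> (map e [0..<l]))"
    "\<And>\<sigma>. \<sigma> \<in> \<Sigma> \<Longrightarrow> cont1 X (\<rho> \<sigma>)"
    "\<And>\<sigma> x. \<sigma> \<in> \<Sigma> \<Longrightarrow> x \<in> X \<Longrightarrow> 0 < \<rho> \<sigma> x \<longleftrightarrow> reaches V (snd \<sigma>) (fst \<sigma>) x 0"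
    using bchoice[of \<Sigma>] by metis
  define \<mu> where "\<mu> = list_max \<rho> ss"
  have d\<mu>: "dterm M (\<lambda>e. \<mu> (map e [0..<l]))" unfolding \<mu>_def using \<rho>(1) ss by (intro dterm_list_max) auto
  have c\<mu>: "cont1 X \<mu>" unfolding \<mu>_def using \<rho>(2) ss by (intro cont1_list_max) auto
  have \<mu>_pos: "0 < \<mu> x" if x: "x \<in> X" for x
  proof -
    obtain i js where "i \<in> {1..k}" "set js \<subseteq> {1..k}" "length js \<le> L" "reaches V js i x 0" using L[OF x] by blast
    then have "(i, js) \<in> \<Sigma>" "0 < \<rho> (i, js) x" using \<rho>(3)[of "(i, js)" x] x unfolding \<Sigma>_def by auto
    then show ?thesis using list_max_ge[of "(i, js)" ss \<rho> x] ss unfolding \<mu>_def by auto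
  qed
  \<comment> \<open>A bump of value \<open>2 * \<rho> \<sigma> / \<mu> - 1\<close>, cut off at 0: it
    is 1 where \<open>\<rho> \<sigma>\<close> attains the maximum \<open>\<mu>\<close>, and 0 where
    \<open>\<rho> \<sigma>\<close> is at most half of it.\<close>
  define \<theta> where "\<theta> = (\<lambda>\<sigma> x. max 0 ((\<rho> \<sigma> x + \<rho> \<sigma> x - \<mu> x) / \<mu> x))"
  have d\<theta>: "dterm M (\<lambda>e. \<theta> \<sigma> (map e [0..<l]))" if "\<sigma> \<in> \<Sigma>" for \<sigma>
    unfolding \<theta>_def by (intro dpred_intros \<rho>(1)[OF that] d\<mu>)
  have c\<theta>: "cont1 X (\<theta> \<sigma>)" if "\<sigma> \<in> \<Sigma>" for \<sigma>
    unfolding \<theta>_def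
    by (intro cont1_max cont1_const cont1_divide cont1_diff cont1_add \<rho>(2)[OF that] c\<mu> \<mu>_pos)
  have "\<exists>h. sect (cyl X (\<lambda>x t. t \<le> list_max \<theta> ts x)) h \<and> (\<forall>x\<in>X. h (x @ [0]) = g x)"
    if "set ts \<subseteq> \<Sigma>" for ts
    using that
  proof (induction ts)
    case Nil
    \<comment> \<open>With no sequence used, the domain is the bottom of the cylinder and the lift
      is \<open>g\<close> itself.\<close>
    let ?D = "cyl X (\<lambda>x t. t \<le> 0)"
    have tk: "take l z \<in> X \<and> z = take l z @ [0]" if "z \<in> ?D" for z
      using that X_len by (auto elim!: cylE)
    have "sect ?D (\<lambda>z. g (take l z))"
      unfolding sect_def
    proof (intro conjI)
      show "?D \<subseteq> Y" by (rule cyl_subset) simp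
      show dD: "dpred M (\<lambda>e. map e [0..<Suc l] \<in> ?D)"
        by (rule dpred_cyl[OF X_def]) (intro dpred_intros)
      show "(\<lambda>z. g (take l z)) \<in> ?D \<rightarrow> E" using tk g(1) by blast
      show "contin ?D (\<lambda>z. g (take l z))" by (rule contin_compose[OF contin_take g(3)]) (use tk in blast)
      show "\<forall>z\<in>?D. p (g (take l z)) = f z"
      proof
        fix z assume "z \<in> ?D"
        from tk[OF this] show "p (g (take l z)) = f z" using g(4)[of "take l z"] by simp
      qed
      show "dgraph M (Suc l) m ?D (\<lambda>z. g (take l z))"
      proof (rule dgraphI[OF cyl_length[OF X_len]])
        have "dpred M (\<lambda>e. map e [0..<Suc l] \<in> ?D \<and>
            (map e [0..<l] \<in> X \<and> g (map e [0..<l]) = map (\<lambda>i. e (Suc l + i)) [0..<m]))"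
          by (intro dpred_conj dD dgraph_app[OF g(2) X_len] dvec_vars)
        then show "dpred M (\<lambda>e. map e [0..<Suc l] \<in> ?D \<and>
            g (take l (map e [0..<Suc l])) = map (\<lambda>i. e (Suc l + i)) [0..<m])"
          by (rule dpred_cong) (auto simp: take_map)
      qed
    qed
    moreover have "g (take l (x @ [0])) = g x" if "x \<in> X" for x using that X_len by auto
    ultimately show ?case by (auto intro: exI[of _ "\<lambda>z. g (take l z)"])
  next
    case (Cons \<sigma> ts)
    then obtain h where h: "sect (cyl X (\<lambda>x t. t \<le> list_max \<theta> ts x)) h" "\<And>x. x \<in> X \<Longrightarrow> h (x @ [0]) = g x" by auto
    have \<sigma>: "\<sigma> \<in> \<Sigma>" "set ts \<subseteq> \<Sigma>" using Cons.prems by auto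
    define c where "c = list_max \<theta> ts"
    \<comment> \<open>The points with \<open>\<rho> \<sigma>\<close> at least half of
      \<open>\<mu>\<close>: a relatively closed set containing the support of
      \<open>\<theta> \<sigma>\<close>, on which \<open>\<rho> \<sigma>\<close> is still positive
      and the sequence therefore works.\<close>
    define Z where "Z = {x \<in> X. \<mu> x - (\<rho> \<sigma> x + \<rho> \<sigma> x) \<le> 0}"
    have c: "dterm M (\<lambda>e. c (map e [0..<l]))" "cont1 X c" "\<And>x. x \<in> X \<Longrightarrow> 0 \<le> c x"
      unfolding c_def using d\<theta> c\<theta> \<sigma>(2) by (auto intro!: dterm_list_max cont1_list_max list_max_nonneg)
    have Z: "Z \<subseteq> X" "rel_closed X Z" "dpred M (\<lambda>e. map e [0..<l] \<in> Z)"
    proof -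
      show "rel_closed X Z" unfolding Z_def by (intro rel_closed_le_0 cont1_diff cont1_add c\<mu> \<rho>(2)[OF \<sigma>(1)])
      show "dpred M (\<lambda>e. map e [0..<l] \<in> Z)"
        unfolding Z_def mem_Collect_eq by (intro dpred_intros X_def d\<mu> \<rho>(1)[OF \<sigma>(1)])
    qed (auto simp: Z_def)
    have reach: "reaches V (snd \<sigma>) (fst \<sigma>) x 0" if "x \<in> Z" for x
    proof -
      have x: "x \<in> X" "\<mu> x \<le> \<rho> \<sigma> x + \<rho> \<sigma> x" using that unfolding Z_def by auto
      then have "0 < \<rho> \<sigma> x" using \<mu>_pos[OF x(1)] by (metis add_nonpos_nonpos less_le_trans not_le)
      then show ?thesis using \<rho>(3)[OF \<sigma>(1) x(1)] by blast
    qed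
    \<comment> \<open>Because \<open>c\<close> is nonnegative, starting the sequence at height 0
      over \<open>Z\<close> adds nothing to the known region.\<close>
    have "under c Z (\<lambda>_. 0) = cyl X (\<lambda>x t. t \<le> c x)"
      unfolding under_def using c(3) by (auto elim!: cylE intro: order_trans)
    then have h0: "sect (under c Z (\<lambda>_. 0)) h" using h(1) unfolding c_def by simp
    have "fst \<sigma> \<in> {1..k}" "set (snd \<sigma>) \<subseteq> {1..k}" using \<sigma>(1) unfolding \<Sigma>_def by auto
    then obtain h' where h': "sect (under c Z (\<lambda>_. 1)) h'" "\<forall>x\<in>X. h' (x @ [0]) = h (x @ [0])"
      using lift_chain[OF _ _ Z c dterm_const cont1_const _ reach h0] by auto
    \<comment> \<open>Over \<open>Z\<close> the lift now has full height, but its domain need not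
      lie below a continuous graph. Cutting it back to the next height restores that shape; outside
      \<open>Z\<close> the height does not change, since \<open>\<theta> \<sigma>\<close> vanishes
      there.\<close>
    have "sect (cyl X (\<lambda>x t. t \<le> list_max \<theta> (\<sigma> # ts) x)) h'"
    proof (rule sect_subset[OF h'(1)])
      show "cyl X (\<lambda>x t. t \<le> list_max \<theta> (\<sigma> # ts) x) \<subseteq> under c Z (\<lambda>_. 1)"
        unfolding under_def
      proof (rule cyl_subset)
        fix x t assume x: "x \<in> X" "0 \<le> t" "t \<le> 1" "t \<le> list_max \<theta> (\<sigma> # ts) x"
        show "t \<le> c x \<or> x \<in> Z \<and> t \<le> 1"
        proof (cases "x \<in> Z")
          case False
          then have "\<rho> \<sigma> x + \<rho> \<sigma> x - \<mu> x \<le> 0" using x(1) unfolding Z_def by auto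
          then have "(\<rho> \<sigma> x + \<rho> \<sigma> x - \<mu> x) / \<mu> x \<le> 0" using \<mu>_pos[OF x(1)] by (rule divide_nonpos_pos)
          then have "\<theta> \<sigma> x = 0" unfolding \<theta>_def by simp
          then show ?thesis using x(4) c(3)[OF x(1)] unfolding c_def by simp
        qed (use x(3) in simp)
      qed
      show "dpred M (\<lambda>e. map e [0..<Suc l] \<in> cyl X (\<lambda>x t. t \<le> list_max \<theta> (\<sigma> # ts) x))"
        by (rule dpred_cyl[OF X_def])
          (use d\<theta> Cons.prems in \<open>intro dpred_le dterm_var dterm_list_max, auto\<close>)
    qed
    then show ?case using h'(2) h(2) by auto
  qed
  from this[of ss] obtain h where h: "sect (cyl X (\<lambda>x t. t \<le> list_max \<theta> ss x)) h" "\<forall>x\<in>X. h (x @ [0]) = g x"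
    using ss by auto
  \<comment> \<open>At each point some \<open>\<rho> \<sigma>\<close> attains the positive maximum
    \<open>\<mu>\<close>, and for it \<open>\<theta> \<sigma>\<close> equals 1.\<close>
  have "1 \<le> list_max \<theta> ss x" if x: "x \<in> X" for x
  proof -
    obtain \<sigma> where \<sigma>: "\<sigma> \<in> set ss" "\<rho> \<sigma> x = \<mu> x"
      using list_max_attained[of \<rho> ss x] \<mu>_pos[OF x] unfolding \<mu>_def by blast
    then have "\<theta> \<sigma> x = 1" unfolding \<theta>_def using \<mu>_pos[OF x] by simp
    then show ?thesis using list_max_ge[OF \<sigma>(1), of \<theta> x] by simp
  qed
  then have "cyl X (\<lambda>x t. t \<le> list_max \<theta> ss x) = Y"
    by (intro equalityI cyl_subset) (auto intro: order_trans)
  then show ?thesis using h by auto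
qed

end

section \<open>Transport in a definable fibre bundle\<close>

lemma definable_continuous_iff:
  fixes f :: "'a::{linordered_field, linorder_topology} list \<Rightarrow> 'a list"
  assumes X: "X \<subseteq> {xs. length xs = n}" and Y: "Y \<subseteq> {xs. length xs = m}"
  shows "definable_continuous M n X m Y f \<longleftrightarrow> f \<in> X \<rightarrow> Y \<and> dgraph M n m X f \<and> contin X f"
proof -
  have "(\<lambda>x. x @ f x) ` X \<subseteq> {xs. length xs = n + m}" if "f \<in> X \<rightarrow> Y"
    using that X Y by fastforce
  then show ?thesis
    unfolding definable_continuous_def definable_map_def continuous_map_induced_iff[OF X Y]
      definable_iff dgraph_def by blast
qed

lemma times_set_append:
  assumes "U \<subseteq> {xs. length xs = n}" "length u = n"
  shows "u @ v \<in> U \<otimes>\<^sub>d F \<longleftrightarrow> u \<in> U \<and> v \<in> F"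
proof
  assume "u @ v \<in> U \<otimes>\<^sub>d F"
  then obtain u' v' where u': "u @ v = u' @ v'" "u' \<in> U" "v' \<in> F" unfolding times_set_def by blast
  then have "length u = length u'" using subsetD[OF assms(1) u'(2)] assms(2) by simp
  then show "u \<in> U \<and> v \<in> F" using u' by (simp add: append_eq_append_conv)
qed (auto simp: times_set_def)

text \<open>Transport keeps the coordinate in \<open>F\<close> and replaces the base coordinate.
  Continuity comes from the inverse homeomorphism, definability from the graph of
  \<open>\<phi>\<close> alone.\<close>

lemma trivialisation_transport:
  fixes M :: "('f, 'r, 'a::{linordered_field, linorder_topology}) expansion"
  assumes U: "U \<subseteq> {xs. length xs = n}" and F: "F \<subseteq> {xs. length xs = d}" and E: "E \<subseteq> {xs. length xs = m}"
    and \<phi>: "definable_homeomorphism M (n + d) (U \<otimes>\<^sub>d F) m {e \<in> E. p e \<in> U} \<phi>"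
    and p: "\<forall>u\<in>U. \<forall>v\<in>F. p (\<phi> (u @ v)) = u"
  shows "\<exists>T. transport M n m E p U T"
proof -
  let ?W = "U \<otimes>\<^sub>d F" and ?E = "{e \<in> E. p e \<in> U}"
  have W_len: "?W \<subseteq> {xs. length xs = n + d}" using U F unfolding times_set_def by fastforce
  have E_len: "?E \<subseteq> {xs. length xs = m}" using E by blast
  have tW: "topspace (induced_topology (n + d) ?W) = ?W" and tE: "topspace (induced_topology m ?E) = ?E"
    using W_len E_len by (auto simp: topspace_power_topology)
  have hom: "homeomorphic_map (induced_topology (n + d) ?W) (induced_topology m ?E) \<phi>"
    and "definable_map M (n + d) ?W m ?E \<phi>"
    using \<phi> unfolding definable_homeomorphism_def by auto
  then have \<phi>g: "dgraph M (n + d) m ?W \<phi>" and \<phi>E: "\<phi> \<in> ?W \<rightarrow> ?E"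
    unfolding definable_map_def definable_iff dgraph_def by auto
  obtain \<psi> where "homeomorphic_maps (induced_topology (n + d) ?W) (induced_topology m ?E) \<phi> \<psi>"
    using hom homeomorphic_map_maps by blast
  then have "continuous_map (induced_topology (n + d) ?W) (induced_topology m ?E) \<phi>"
    "continuous_map (induced_topology m ?E) (induced_topology (n + d) ?W) \<psi>"
    and \<psi>\<phi>: "\<And>w. w \<in> ?W \<Longrightarrow> \<psi> (\<phi> w) = w" and \<phi>\<psi>: "\<And>y. y \<in> ?E \<Longrightarrow> \<phi> (\<psi> y) = y"
    unfolding homeomorphic_maps_def tW tE by auto
  then have c\<phi>: "contin ?W \<phi>" and c\<psi>: "contin ?E \<psi>" and \<psi>W: "\<psi> \<in> ?E \<rightarrow> ?W"
    using continuous_map_induced_iff[OF W_len E_len] continuous_map_induced_iff[OF E_len W_len] by auto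
  define T where "T = (\<lambda>b y. \<phi> (b @ drop n (\<psi> y)))"
  have \<psi>_split: "\<psi> y = p y @ drop n (\<psi> y) \<and> drop n (\<psi> y) \<in> F" if y: "y \<in> ?E" for y
  proof -
    obtain u v where uv: "\<psi> y = u @ v" "u \<in> U" "v \<in> F" using \<psi>W y unfolding times_set_def by blast
    then have "length u = n" using U by blast
    moreover have "p y = u" using p uv \<phi>\<psi>[OF y] by metis
    ultimately show ?thesis using uv by simp
  qed
  have mem: "b @ drop n (\<psi> y) \<in> ?W" if "b \<in> U" "y \<in> ?E" for b y
    using \<psi>_split[OF that(2)] that(1) unfolding times_set_def by blast
  show ?thesis unfolding transport_def
  proof (intro exI[of _ T] conjI ballI allI impI; (elim conjE)?)
    show "T b y \<in> E" "p (T b y) = b" if "b \<in> U" "y \<in> E" "p y \<in> U" for b y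
    proof -
      have y: "y \<in> ?E" using that by simp
      have "T b y \<in> ?E" unfolding T_def using \<phi>E mem[OF that(1) y] by blast
      moreover have "p (T b y) = b" unfolding T_def using p that(1) \<psi>_split[OF y] by blast
      ultimately show "T b y \<in> E" "p (T b y) = b" by blast+
    qed
    show "T (p y) y = y" if "y \<in> E" "p y \<in> U" for y
    proof -
      have y: "y \<in> ?E" using that by simp
      have "p y @ drop n (\<psi> y) = \<psi> y" using \<psi>_split[OF y] by simp
      then show ?thesis unfolding T_def using \<phi>\<psi>[OF y] by simp
    qed
    show "dpred M (\<lambda>e. u e \<in> U \<and> v e \<in> E \<and> p (v e) \<in> U \<and> T (u e) (v e) = w e)"
      if u: "dvec M n u" and v: "dvec M m v" and w: "dvec M m w" for u v w
    proof -
      \<comment> \<open>The inverse is eliminated from the formula: both points are images under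
        \<open>\<phi>\<close> of pairs with the same second component \<open>b\<close>.\<close>
      have "dpred M (\<lambda>e. \<exists>a. length a = n \<and> (\<exists>b. length b = d \<and> (a @ b \<in> ?W \<and> \<phi> (a @ b) = v e) \<and>
          (u e @ b \<in> ?W \<and> \<phi> (u e @ b) = w e)))"
        by (intro dpred_ex_list dpred_conj dgraph_app[OF \<phi>g W_len] dvec_append dvec_vars
            dvec_rename[OF u] dvec_rename[OF v] dvec_rename[OF w])
      then show ?thesis
      proof (rule dpred_cong)
        fix e
        have ue: "length (u e) = n" using u unfolding dvec_def by simp
        show "(\<exists>a. length a = n \<and> (\<exists>b. length b = d \<and> (a @ b \<in> ?W \<and> \<phi> (a @ b) = v e) \<and>
          (u e @ b \<in> ?W \<and> \<phi> (u e @ b) = w e))) =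
          (u e \<in> U \<and> v e \<in> E \<and> p (v e) \<in> U \<and> T (u e) (v e) = w e)" (is "?l = ?r")
        proof
          assume ?l
          then obtain a b where ab: "length a = n" "a @ b \<in> ?W" "\<phi> (a @ b) = v e" "u e @ b \<in> ?W" "\<phi> (u e @ b) = w e"
            by blast
          have "\<psi> (v e) = a @ b" using \<psi>\<phi>[OF ab(2)] ab(3) by simp
          then have "T (u e) (v e) = w e" unfolding T_def using ab by simp
          moreover have "u e \<in> U" using ab(4) times_set_append[OF U ue] by blast
          moreover have "v e \<in> ?E" using funcset_mem[OF \<phi>E ab(2)] ab(3) by simp
          ultimately show ?r by blast
        next
          assume r: ?r
          then have y: "v e \<in> ?E" by simp
          have s: "p (v e) @ drop n (\<psi> (v e)) = \<psi> (v e)" "drop n (\<psi> (v e)) \<in> F" using \<psi>_split[OF y] by auto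
          have "length (p (v e)) = n" "length (drop n (\<psi> (v e))) = d" using r U s(2) F by blast+
          moreover have "\<psi> (v e) \<in> ?W" using \<psi>W y by blast
          moreover have "u e @ drop n (\<psi> (v e)) \<in> ?W" using mem[OF _ y] r by blast
          ultimately show ?l
            using s(1) \<phi>\<psi>[OF y] r unfolding T_def
            by (intro exI[of _ "p (v e)"] conjI exI[of _ "drop n (\<psi> (v e))"]) simp_all
        qed
      qed
    qed
    let ?S = "{b @ y |b y. b \<in> U \<and> y \<in> E \<and> p y \<in> U}"
    have S: "take n z \<in> U" "drop n z \<in> ?E" if z: "z \<in> ?S" for z
    proof -
      obtain b y where "z = b @ y" "b \<in> U" "y \<in> ?E" using z by blast
      moreover from this have "length b = n" using U by blast
      ultimately show "take n z \<in> U" "drop n z \<in> ?E" by auto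
    qed
    have "contin ?S (\<lambda>z. \<psi> (drop n z))" by (rule contin_compose[OF contin_drop c\<psi>]) (use S in blast)
    then have "contin ?S (\<lambda>z. drop n (\<psi> (drop n z)))"
      by (rule contin_compose[OF _ contin_drop[of UNIV]]) simp
    then have "contin ?S (\<lambda>z. take n z @ drop n (\<psi> (drop n z)))"
      by (rule contin_append[OF contin_take, of _ _ _ n]) (use S U in blast)
    then show "contin ?S (\<lambda>z. T (take n z) (drop n z))"
      unfolding T_def by (rule contin_compose[OF _ c\<phi>]) (use S mem in blast)
  qed
qed

theorem theorem2p3:
  fixes M :: "('f, 'r, 'a::{linordered_field, linorder_topology}) expansion"
    and E B F :: "'a list set"
    and m n d :: nat
    and p :: "'a list \<Rightarrow> 'a list"
  assumes "real_closed TYPE('a)"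
    and "o_minimal M"
    and "definable_fibre_bundle M m E n B d F p"
  shows "definable_fibration M m E n B p"
proof -
  obtain k U \<phi> where E: "definable M m E" and B: "definable M n B" and F: "definable M d F"
    and p: "definable_continuous M m E n B p" and cover: "B = (\<Union>i\<in>{1..k::nat}. U i)"
    and triv: "\<And>i. i \<in> {1..k} \<Longrightarrow> definable M n (U i) \<and> openin (induced_topology n B) (U i) \<and>
      definable_homeomorphism M (n + d) (U i \<otimes>\<^sub>d F) m {e \<in> E. p e \<in> U i} (\<phi> i) \<and>
      (\<forall>u\<in>U i. \<forall>v\<in>F. p (\<phi> i (u @ v)) = u)"
    using assms(3) unfolding definable_fibre_bundle_def by blast
  have E_len: "E \<subseteq> {xs. length xs = m}" and B_len: "B \<subseteq> {xs. length xs = n}"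
    and F_len: "F \<subseteq> {xs. length xs = d}"
    using E B F unfolding definable_iff by auto
  have "\<exists>T. transport M n m E p (U i) T" if i: "i \<in> {1..k}" for i
  proof (rule trivialisation_transport[OF _ F_len E_len, of _ _ M p "\<phi> i"])
    show "U i \<subseteq> {xs. length xs = n}" using cover B_len i by blast
  qed (use triv[OF i] in simp_all)
  then obtain T where T: "\<And>i. i \<in> {1..k} \<Longrightarrow> transport M n m E p (U i) (T i)" by metis
  show ?thesis
    unfolding definable_fibration_def
  proof (intro conjI E B p allI impI, elim conjE)
    fix l X f g
    assume X: "definable M l X"
      and f: "definable_continuous M (l + 1) (X \<otimes>\<^sub>d unit_interval) n B f"
      and g: "definable_continuous M l X m E g" and pg: "\<forall>x\<in>X. p (g x) = f (x @ [0])"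
    let ?Y = "cyl X (\<lambda>_ _. True)"
    have X_len: "X \<subseteq> {xs. length xs = l}" and X_def: "dpred M (\<lambda>e. map e [0..<l] \<in> X)"
      using X unfolding definable_iff by auto
    have Y_len: "?Y \<subseteq> {xs. length xs = Suc l}" by (rule cyl_length[OF X_len])
    have f': "f \<in> ?Y \<rightarrow> B" "dgraph M (Suc l) n ?Y f" "contin ?Y f"
      using f unfolding times_unit_interval by (simp_all add: definable_continuous_iff[OF Y_len B_len])
    have g': "g \<in> X \<rightarrow> E" "dgraph M l m X g" "contin X g"
      using g by (simp_all add: definable_continuous_iff[OF X_len E_len])
    interpret lifting_problem M l n m k X B E f p U T
    proof
      show "o_minimal M" by fact
      show "\<exists>r>0. \<forall>y\<in>B. near r x y \<longrightarrow> y \<in> U i" if "i \<in> {1..k}" "x \<in> U i" for i x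
        using triv[OF that(1)] that(2) unfolding openin_induced_topology[OF B_len] by blast
      show "dpred M (\<lambda>e. map e [0..<n] \<in> U i)" if "i \<in> {1..k}" for i
        using triv[OF that] unfolding definable_iff by blast
    qed (rule X_len B_len E_len X_def f' cover T; assumption)+
    obtain h where h: "sect ?Y h" "\<forall>x\<in>X. h (x @ [0]) = g x" using lift_exists[OF g'] pg by blast
    have "definable_continuous M (l + 1) (X \<otimes>\<^sub>d unit_interval) m E h"
      using h(1) unfolding times_unit_interval sect_def
      by (simp add: definable_continuous_iff[OF Y_len E_len])
    moreover have "\<forall>z\<in>X \<otimes>\<^sub>d unit_interval. p (h z) = f z"
      using h(1) unfolding times_unit_interval sect_def by blast
    ultimately show "\<exists>h. definable_continuous M (l + 1) (X \<otimes>\<^sub>d unit_interval) m E h \<and>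
        (\<forall>z\<in>X \<otimes>\<^sub>d unit_interval. p (h z) = f z) \<and> (\<forall>x\<in>X. h (x @ [0]) = g x)"
      using h(2) by blast
  qed
qed

end
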